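(* Let $d=1$ and $0<p_1,p_2,p\le\infty$ with $\frac1{p_1}+\frac1{p_2}=\frac1p$. Let $E\subset\mathbb R_+$ have upper Minkowski dimension $\beta$ (in the dilation-invariant sense given in the context). Define $$D_1=\begin{cases}(1,0)&\beta<\frac12,\\ \left(\frac1{2\beta},0\right)&\beta\ge\frac12,\end{cases}\qquad D_2=\left(\tfrac12,\tfrac12\right),\qquad D_3=\begin{cases}(0,1)&\beta<\frac12,\\ \left(0,\frac1{2\beta}\right)&\beta\ge\frac12.\end{cases}$$ Then $\mathcal M_E$ is bounded from $L^{p_1}(\mathbb R)\times L^{p_2}(\mathbb R)$ into $L^p(\mathbb R)$, i.e. there is a constant $C<\infty$ with $\|\mathcal M_E(f_1,f_2)\|_{L^p}\le C\|f_1\|_{L^{p_1}}\|f_2\|_{L^{p_2}}$ for all $f_1\in L^{p_1}(\mathbb R)$, $f_2\in L^{p_2}(\mathbb R)$, whenever $\left(\frac1{p_1},\frac1{p_2}\right)\in\Omega(O,D_1,D_2,D_3)\setminus\{D_1D_2,D_2D_3\}$.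
   Context: $\mathbb R_+=(0,\infty)$, $1/\infty=0$, $O=(0,0)$. Let $d\sigma$ be the normalized arc-length measure on the unit circle $\mathbb S^1\subset\mathbb R\times\mathbb R$. For $t>0$, $$\mathcal A_t(f_1,f_2)(x)=\int_{\mathbb S^{1}}f_1(x-ty_1)f_2(x-ty_2)\,d\sigma(y_1,y_2),\qquad x\in\mathbb R,$$ and $\mathcal M_E(f_1,f_2)(x)=\sup_{t\in E}|\mathcal A_t(f_1,f_2)(x)|$. Upper Minkowski dimension: for $E\subset\mathbb R_+$ put $E_k=E\cap[2^{-k},2^{-k+1}]$, $k\in\mathbb Z$. $E$ has upper Minkowski dimension $\beta$ if $$\limsup_{\delta\to0}\ \sup_{k\in\mathbb Z}\frac{\log(1+N(E_k,2^{-k}\delta))}{\log(1+\delta^{-1})}=\beta,$$ where $N(T,\delta)$ is the minimum number of intervals of length $\delta$ needed to cover $T$. (So $0\le\beta\le1$.) $\Omega(P_1,\dots,P_k)$ is the convex hull of the points $P_1,\dots,P_k\in\mathbb R^2$, and for two points $X,Y$, $XY$ denotes the closed line segment joining them; $\setminus\{D_1D_2,D_2D_3\}$ means that these two segments are removed. *)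

theory Defs
  imports "HOL-Analysis.Analysis" "HOL-Probability.Essential_Supremum"
begin

section \<open>Lebesgue norms\<close>

text \<open>Powers of extended nonnegative numbers; only used with exponent \<open>a > 0\<close>.\<close>

definition ennreal_powr :: "ennreal \<Rightarrow> real \<Rightarrow> ennreal" where
  "ennreal_powr u a = (if u = \<infinity> then \<infinity> else ennreal (enn2real u powr a))"

text \<open>
  The \<open>L\<^sup>p(\<real>)\<close> (quasi-)norm, \<open>0 < p \<le> \<infinity>\<close>, of a function given through its absolute value
  \<open>g\<close>, which may be infinite. It is meant for Lebesgue measurable \<open>g\<close> only:
  for other functions \<open>nn_integral\<close> is a lower integral.
\<close>

definition Lp_norm :: "ennreal \<Rightarrow> (real \<Rightarrow> ennreal) \<Rightarrow> ennreal" where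
  "Lp_norm p g =
     (if p = \<infinity> then esssup lebesgue g
      else ennreal_powr (\<integral>\<^sup>+ x. ennreal_powr (g x) (enn2real p) \<partial>lebesgue) (1 / enn2real p))"

definition in_Lp :: "ennreal \<Rightarrow> (real \<Rightarrow> complex) \<Rightarrow> bool" where
  "in_Lp p f \<longleftrightarrow> f \<in> borel_measurable lebesgue \<and> Lp_norm p (\<lambda>x. ennreal (norm (f x))) < \<infinity>"

section \<open>The bilinear spherical averages and maximal function\<close>

text \<open>
  Normalized arc length on the unit circle, as a measure on the plane concentrated on the circle.
  The completion makes \<open>y \<mapsto> f (x - t * fst y)\<close> measurable for Lebesgue (not just Borel)
  measurable \<open>f\<close> and \<open>t > 0\<close>.
\<close>

definition circle_measure :: "(real \<times> real) measure" where
  "circle_measure =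
     completion (distr (uniform_measure lborel {0..2 * pi}) borel (\<lambda>\<theta>. (cos \<theta>, sin \<theta>)))"

definition avg_integrand ::
  "real \<Rightarrow> (real \<Rightarrow> complex) \<Rightarrow> (real \<Rightarrow> complex) \<Rightarrow> real \<Rightarrow> real \<times> real \<Rightarrow> complex" where
  "avg_integrand t f1 f2 x y = f1 (x - t * fst y) * f2 (x - t * snd y)"

definition bilinear_avg ::
  "real \<Rightarrow> (real \<Rightarrow> complex) \<Rightarrow> (real \<Rightarrow> complex) \<Rightarrow> real \<Rightarrow> complex" where
  "bilinear_avg t f1 f2 x = (\<integral>y. avg_integrand t f1 f2 x y \<partial>circle_measure)"

text \<open>
  The Bochner integral of a function that is not absolutely integrable is 0. An average that does
  not exist as an absolutely convergent integral is therefore counted as \<open>\<infinity>\<close>, so that a bound on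
  the maximal function includes the existence of all averages, \<open>t \<in> E\<close>, almost everywhere.
\<close>

definition bilinear_avg_abs ::
  "real \<Rightarrow> (real \<Rightarrow> complex) \<Rightarrow> (real \<Rightarrow> complex) \<Rightarrow> real \<Rightarrow> ennreal" where
  "bilinear_avg_abs t f1 f2 x =
     (if integrable circle_measure (avg_integrand t f1 f2 x)
      then ennreal (norm (bilinear_avg t f1 f2 x)) else \<infinity>)"

definition bilinear_maximal ::
  "real set \<Rightarrow> (real \<Rightarrow> complex) \<Rightarrow> (real \<Rightarrow> complex) \<Rightarrow> real \<Rightarrow> ennreal" where
  "bilinear_maximal E f1 f2 x = (SUP t\<in>E. bilinear_avg_abs t f1 f2 x)"

section \<open>Dilation-invariant upper Minkowski dimension\<close>

text \<open>
  Minimal number of intervals of length \<open>\<delta>\<close> covering \<open>T\<close>, for bounded \<open>T\<close> and \<open>\<delta> > 0\<close>. Every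
  interval of length \<open>\<delta>\<close> lies in a closed one, so closed intervals give the same minimum.
\<close>

definition covering_number :: "real set \<Rightarrow> real \<Rightarrow> nat" where
  "covering_number T \<delta> =
     (LEAST n. \<exists>S. finite S \<and> card S = n \<and> T \<subseteq> (\<Union>a\<in>S. {a..a + \<delta>}))"

definition dyadic_part :: "real set \<Rightarrow> int \<Rightarrow> real set" where
  "dyadic_part E k = E \<inter> {2 powi (- k)..2 powi (- k + 1)}"

definition upper_minkowski_dim :: "real set \<Rightarrow> ereal" where
  "upper_minkowski_dim E =
     Limsup (at_right 0) (\<lambda>\<delta>::real. SUP k::int.
       ereal (ln (1 + real (covering_number (dyadic_part E k) (2 powi (- k) * \<delta>)))
              / ln (1 + inverse \<delta>)))"

end

theory Submission
  imports Defs
begin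

text \<open>
  Up to sign changes and an exchange of the coordinates, the circle near each of its four poles is
  \<open>(cos \<phi>, sin \<phi>)\<close> with small \<open>\<phi>\<close>. On the arc \<open>\<phi> \<approx> 2\<^sup>-\<^sup>i\<close> the point \<open>t cos \<phi>\<close> stays within about
  \<open>4\<^sup>-\<^sup>i t\<close> of \<open>t\<close>, and \<open>t sin \<phi>\<close> within \<open>2\<^sup>-\<^sup>i t\<close> of \<open>0\<close>; on the arc the derivative of
  either one is constant up to a bounded factor.
  Hoelder's inequality on the arc, with exponents \<open>1/w\<close> and \<open>1/(1-w)\<close>, therefore bounds its
  contribution by a constant times
  \<open>2\<^sup>-\<^sup>i (M\<^sub>i f\<^sub>1\<^bsup>1/w\<^esup>)\<^bsup>w\<^esup> (M\<^sub>0 f\<^sub>2\<^bsup>1/(1-w)\<^esup>)\<^bsup>1-w\<^esup>\<close>, where \<open>M\<^sub>0\<close> is of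
  Hardy--Littlewood type and \<open>M\<^sub>i\<close> takes the supremum over \<open>t \<in> E\<close> of averages over intervals of
  length \<open>4\<^sup>-\<^sup>i t\<close> at distance \<open>t\<close> from \<open>x\<close>. The other poles give the same with \<open>f\<^sub>1\<close> and \<open>f\<^sub>2\<close> exchanged.

  The dimension of \<open>E\<close> enters through \<open>M\<^sub>i\<close> only. For any \<open>b > \<beta>\<close> the part of \<open>E\<close> of size \<open>2\<^sup>-\<^sup>k\<close> is covered by
  \<open>N\<^sub>i \<lesssim> 4\<^bsup>ib\<^esup>\<close> intervals of length \<open>4\<^sup>-\<^sup>i 2\<^sup>-\<^sup>k\<close>, whatever \<open>k\<close> is. So \<open>M\<^sub>i\<close> is dominated by a
  dyadic maximal function in which the average over an interval \<open>J\<close> counts on \<open>N\<^sub>i\<close> translates of \<open>J\<close>.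
  Its weak \<open>L\<^sup>1\<close> constant is \<open>\<lesssim> i N\<^sub>i\<close> (lemmas \<open>tent_max_weak_type\<close> and \<open>tent_bound_shifted\<close>): below a
  maximal interval only about \<open>2i\<close> generations of subintervals are translated away from it.
  Interpolation with the trivial bound on \<open>L\<^sup>\<infinity>\<close> gives \<open>(M\<^sub>i f\<^bsup>1/w\<^esup>)\<^bsup>w\<^esup>\<close> the norm
  \<open>\<lesssim> (i 4\<^bsup>ib\<^esup>)\<^bsup>1/p\<^esup>\<close> on \<open>L\<^sup>p\<close>, provided that \<open>1/p < w\<close>. The factor \<open>2\<^sup>-\<^sup>i\<close> beats this norm as soon as
  \<open>2b/p < 1\<close>. One such \<open>w\<close> serves both functions if \<open>1/p\<^sub>1 < w < 1 - 1/p\<^sub>2\<close>. Thus the theorem holds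
  when \<open>1/p\<^sub>1 + 1/p\<^sub>2 < 1\<close>, \<open>\<beta>/p\<^sub>1 < 1/2\<close> and \<open>\<beta>/p\<^sub>2 < 1/2\<close> (\<open>bilinear_maximal_bounded\<close>), and these
  inequalities hold on the quadrilateral without its two outer sides (\<open>region_inequalities\<close>).

  To sum over \<open>i\<close> without mixing the two functions, a part \<open>2\<^bsup>-\<gamma>i\<^esup>\<close>, \<open>\<gamma> < 1\<close>, of the factor \<open>2\<^sup>-\<^sup>i\<close> is moved
  into a supremum over \<open>i\<close>. This yields one pointwise inequality: every average is at most
  \<open>S\<^sub>1 f\<^sub>1 \<cdot> S\<^sub>2 f\<^sub>2\<close> with \<open>S\<^sub>j\<close> bounded on the space of exponent \<open>p\<^sub>j\<close> (\<open>exists_majorant\<close>); Hoelder's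
  inequality on the line then finishes the estimate.

  The supremum over an uncountable \<open>E\<close> is measurable for bounded continuous functions, because it is
  lower semicontinuous. The same pointwise inequality, applied to differences, shows that for almost
  every \<open>x\<close> the averages of general functions are limits, uniformly in \<open>t\<close>, of averages of bounded
  continuous ones; so measurability passes to the limit.
\<close>

section \<open>Powers of extended nonnegative numbers and Hoelder's inequality\<close>

lemma ennreal_powr_ennreal: "0 \<le> a \<Longrightarrow> ennreal_powr (ennreal a) q = ennreal (a powr q)"
  by (simp add: ennreal_powr_def)

lemma power_powr_eq: "0 < a \<Longrightarrow> (a ^ i) powr q = (a powr q) ^ i" for a q :: real
  by (induction i) (simp_all add: powr_mult)

lemma ennreal_powr_top [simp]: "ennreal_powr top q = top"
  by (simp add: ennreal_powr_def)

lemma ennreal_powr_zero [simp]: "ennreal_powr 0 q = 0"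
  by (simp add: ennreal_powr_def)

lemma ennreal_powr_by_one [simp]: "ennreal_powr x 1 = x"
  by (cases x) (auto simp: ennreal_powr_def)

lemma ennreal_powr_mono: "0 \<le> q \<Longrightarrow> x \<le> y \<Longrightarrow> ennreal_powr x q \<le> ennreal_powr y q"
  by (cases x; cases y) (auto simp: ennreal_powr_ennreal powr_mono2 top_unique intro!: ennreal_leI)

lemma ennreal_powr_mult: "ennreal_powr (x * y) q = ennreal_powr x q * ennreal_powr y q"
proof (cases "x = 0 \<or> y = 0")
  case False
  have *: "ennreal_powr (top * ennreal r) q = ennreal_powr top q * ennreal_powr (ennreal r) q"
    if "r \<ge> 0" "ennreal r \<noteq> 0" for r
    using that by (simp add: ennreal_top_mult ennreal_powr_ennreal ennreal_eq_0_iff)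
  show ?thesis
  proof (cases x)
    case (real a)
    show ?thesis
    proof (cases y)
      case (real b)
      with \<open>x = ennreal a\<close> \<open>0 \<le> a\<close> show ?thesis
        by (simp add: ennreal_powr_ennreal powr_mult flip: ennreal_mult)
    next
      case top
      then show ?thesis using *[of a] real False by (simp add: mult.commute)
    qed
  next
    case top
    then show ?thesis using * False by (cases y) auto
  qed
qed auto

lemma ennreal_powr_powr: "ennreal_powr (ennreal_powr x a) b = ennreal_powr x (a * b)"
  by (cases x) (auto simp: ennreal_powr_ennreal powr_powr)

lemma ennreal_powr_add: "0 < a \<Longrightarrow> 0 < b \<Longrightarrow> ennreal_powr x (a + b) = ennreal_powr x a * ennreal_powr x b"
  by (cases x) (auto simp: ennreal_powr_ennreal powr_add ennreal_top_mult simp flip: ennreal_mult)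

lemma ennreal_powr_eq_0_iff [simp]: "ennreal_powr x q = 0 \<longleftrightarrow> x = 0"
  by (cases x) (auto simp: ennreal_powr_ennreal ennreal_eq_0_iff)

lemma ennreal_powr_eq_top_iff [simp]: "ennreal_powr x q = top \<longleftrightarrow> x = top"
  by (cases x) (auto simp: ennreal_powr_ennreal)

lemma ennreal_powr_less_top_iff [simp]: "ennreal_powr x q < top \<longleftrightarrow> x < top"
  by (metis ennreal_powr_eq_top_iff less_top)

lemma measurable_ennreal_powr [measurable]:
  assumes [measurable]: "f \<in> borel_measurable M"
  shows "(\<lambda>x. ennreal_powr (f x) q) \<in> borel_measurable M"
proof -
  have [measurable]: "Measurable.pred M (\<lambda>x. f x = \<infinity>)" by measurable
  show ?thesis unfolding ennreal_powr_def by measurable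
qed

abbreviation power_integral :: "real \<Rightarrow> (real \<Rightarrow> ennreal) \<Rightarrow> ennreal" where
  "power_integral q F \<equiv> \<integral>\<^sup>+ x. ennreal_powr (F x) q \<partial>lborel"

lemma ennreal_powr_le_iff: "0 < q \<Longrightarrow> ennreal_powr x q \<le> y \<longleftrightarrow> x \<le> ennreal_powr y (1 / q)"
  using ennreal_powr_mono[of q x "ennreal_powr y (1 / q)"]
    ennreal_powr_mono[of "1 / q" "ennreal_powr x q" y]
  by (auto simp: ennreal_powr_powr)

lemma ennreal_powr_add_le:
  assumes "0 \<le> q"
  shows "ennreal_powr (x + y) q \<le> ennreal (2 powr q) * (ennreal_powr x q + ennreal_powr y q)"
proof -
  have "ennreal_powr (x + y) q \<le> ennreal_powr (2 * max x y) q"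
    by (intro ennreal_powr_mono assms) (auto simp: mult_2 max_def add_mono)
  also have "\<dots> = ennreal (2 powr q) * ennreal_powr (max x y) q"
    using ennreal_powr_ennreal[of 2 q] by (simp add: ennreal_powr_mult)
  also have "ennreal_powr (max x y) q \<le> ennreal_powr x q + ennreal_powr y q"
    by (auto simp: max_def)
  finally show ?thesis by (simp add: mult_left_mono)
qed

lemma term_le_suminf_ennreal: "f i \<le> suminf f" for f :: "nat \<Rightarrow> ennreal"
  using sum_le_suminf[of f "{i}"] by simp

lemma weighted_AM_GM_ennreal:
  assumes w: "0 < w" "w < 1"
  shows "ennreal_powr x w * ennreal_powr y (1 - w) \<le> ennreal w * x + ennreal (1 - w) * y"
proof (cases "x = top \<or> y = top")
  case True
  then show ?thesis using w by (auto simp: ennreal_mult_top)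
next
  case False
  then obtain a b where ab: "x = ennreal a" "y = ennreal b" "0 \<le> a" "0 \<le> b"
    by (cases x; cases y) auto
  have "a powr w * b powr (1 - w) \<le> w * a + (1 - w) * b"
    using Youngs_inequality_0[of w "1 - w" a b] w ab
    by (cases "a = 0 \<or> b = 0") (auto simp: less_le)
  then have "ennreal (a powr w * b powr (1 - w)) \<le> ennreal (w * a + (1 - w) * b)"
    by (rule ennreal_leI)
  then show ?thesis
    using w ab by (simp add: ennreal_powr_ennreal ennreal_mult ennreal_plus)
qed

text \<open>
  Normalised to \<open>\<integral>X = \<integral>Y = 1\<close>, this is the integrated weighted inequality between the arithmetic and
  the geometric mean. Stated for powers of \<open>X\<close> and \<open>Y\<close> it has no conjugate exponents, so that the same
  form serves for the integral over an arc and for the Lebesgue norms.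
\<close>

lemma Holder_ennreal:
  assumes [measurable]: "X \<in> borel_measurable M" "Y \<in> borel_measurable M" and w: "0 < w" "w < 1"
  shows "(\<integral>\<^sup>+ x. ennreal_powr (X x) w * ennreal_powr (Y x) (1 - w) \<partial>M)
    \<le> ennreal_powr (\<integral>\<^sup>+ x. X x \<partial>M) w * ennreal_powr (\<integral>\<^sup>+ x. Y x \<partial>M) (1 - w)"
proof -
  define a b where "a = (\<integral>\<^sup>+ x. X x \<partial>M)" and "b = (\<integral>\<^sup>+ x. Y x \<partial>M)"
  consider "a = 0 \<or> b = 0" | "a \<noteq> 0" "b \<noteq> 0" "a = top \<or> b = top"
    | "a \<noteq> 0" "b \<noteq> 0" "a \<noteq> top" "b \<noteq> top" by blast
  then show ?thesis
  proof cases
    case 1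
    then have "(AE x in M. X x = 0) \<or> (AE x in M. Y x = 0)"
      unfolding a_def b_def by (auto simp: nn_integral_0_iff_AE)
    then have "AE x in M. ennreal_powr (X x) w * ennreal_powr (Y x) (1 - w) = 0"
      by (auto elim: eventually_mono)
    then have "(\<integral>\<^sup>+ x. ennreal_powr (X x) w * ennreal_powr (Y x) (1 - w) \<partial>M) = 0"
      by (subst nn_integral_0_iff_AE) auto
    then show ?thesis by simp
  next
    case 2
    then have "ennreal_powr a w * ennreal_powr b (1 - w) = top"
      by (auto simp: ennreal_mult_eq_top_iff)
    then show ?thesis by (simp add: a_def b_def)
  next
    case 3
    then obtain a' b' where ab: "a = ennreal a'" "b = ennreal b'" "a' > 0" "b' > 0"
      by (cases a; cases b) (auto simp: ennreal_eq_0_iff not_le)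
    have inv: "ennreal_powr (ennreal (1 / c) ) v * ennreal_powr (ennreal c) v = 1"
      if "c > 0" for c v
      using that by (simp add: ennreal_powr_ennreal powr_divide flip: ennreal_mult)
    let ?X = "\<lambda>x. ennreal (1 / a') * X x" and ?Y = "\<lambda>x. ennreal (1 / b') * Y x"
    have X1: "(\<integral>\<^sup>+ x. ?X x \<partial>M) = 1" "(\<integral>\<^sup>+ x. ?Y x \<partial>M) = 1"
      using ab by (simp_all add: nn_integral_cmult a_def[symmetric] b_def[symmetric] flip: ennreal_mult)
    have "(\<integral>\<^sup>+ x. ennreal_powr (?X x) w * ennreal_powr (?Y x) (1 - w) \<partial>M)
      \<le> (\<integral>\<^sup>+ x. ennreal w * ?X x + ennreal (1 - w) * ?Y x \<partial>M)"
      by (intro nn_integral_mono weighted_AM_GM_ennreal w)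
    also have "\<dots> = ennreal w * (\<integral>\<^sup>+ x. ?X x \<partial>M) + ennreal (1 - w) * (\<integral>\<^sup>+ x. ?Y x \<partial>M)"
      by (subst nn_integral_add) (auto simp: nn_integral_cmult)
    also have "\<dots> = 1"
      using w by (simp add: X1 flip: ennreal_plus)
    finally have le1: "(\<integral>\<^sup>+ x. ennreal_powr (?X x) w * ennreal_powr (?Y x) (1 - w) \<partial>M) \<le> 1" .
    have "(\<integral>\<^sup>+ x. ennreal_powr (X x) w * ennreal_powr (Y x) (1 - w) \<partial>M)
      = (\<integral>\<^sup>+ x. (ennreal_powr a w * ennreal_powr b (1 - w)) *
           (ennreal_powr (?X x) w * ennreal_powr (?Y x) (1 - w)) \<partial>M)"
    proof (intro nn_integral_cong)
      fix x
      have "(ennreal_powr a w * ennreal_powr b (1 - w)) *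
           (ennreal_powr (?X x) w * ennreal_powr (?Y x) (1 - w))
        = (ennreal_powr (ennreal (1 / a')) w * ennreal_powr (ennreal a') w) *
          (ennreal_powr (ennreal (1 / b')) (1 - w) * ennreal_powr (ennreal b') (1 - w)) *
          (ennreal_powr (X x) w * ennreal_powr (Y x) (1 - w))"
        by (simp only: ennreal_powr_mult ab) (simp only: ac_simps)
      then show "ennreal_powr (X x) w * ennreal_powr (Y x) (1 - w) =
        (ennreal_powr a w * ennreal_powr b (1 - w)) *
           (ennreal_powr (?X x) w * ennreal_powr (?Y x) (1 - w))"
        using inv ab by simp
    qed
    also have "\<dots> = (ennreal_powr a w * ennreal_powr b (1 - w)) *
        (\<integral>\<^sup>+ x. ennreal_powr (?X x) w * ennreal_powr (?Y x) (1 - w) \<partial>M)"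
      by (rule nn_integral_cmult) measurable
    also have "\<dots> \<le> (ennreal_powr a w * ennreal_powr b (1 - w)) * 1"
      by (intro mult_left_mono le1) auto
    finally show ?thesis by (simp add: a_def b_def)
  qed
qed

section \<open>Dyadic intervals and tent maximal functions\<close>

definition dyadic :: "int \<Rightarrow> int \<Rightarrow> real set" where
  "dyadic k n = {y. \<lfloor>2 powi k * y\<rfloor> = n}"

definition dyadic_avg :: "int \<Rightarrow> int \<Rightarrow> (real \<Rightarrow> ennreal) \<Rightarrow> ennreal" where
  "dyadic_avg k n F = ennreal (2 powi k) * (\<integral>\<^sup>+ y. F y * indicator (dyadic k n) y \<partial>lborel)"

definition ancestor :: "int \<Rightarrow> int \<Rightarrow> int \<Rightarrow> int" where
  "ancestor k n k' = n div 2 ^ nat (k - k')"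

text \<open>
  The set \<open>A k n\<close> consists of the points at which the average over the dyadic interval with index
  \<open>(k, n)\<close> counts. With a fixed dilate of the interval as \<open>A k n\<close>, the maximal function \<open>tent_max\<close> below is the
  dyadic Hardy--Littlewood one. The tent over an interval collects the sets of all its
  dyadic descendants; as in Carleson's condition, its size compared with the interval governs
  the maximal function.
\<close>

definition tent :: "(int \<Rightarrow> int \<Rightarrow> real set) \<Rightarrow> int \<Rightarrow> int \<Rightarrow> real set" where
  "tent A k0 n0 = (\<Union>(k, n) \<in> {(k, n). k0 \<le> k \<and> ancestor k n k0 = n0}. A k n)"

definition tent_bound :: "(int \<Rightarrow> int \<Rightarrow> real set) \<Rightarrow> real \<Rightarrow> bool" where
  "tent_bound A K \<longleftrightarrow> 0 \<le> K \<and> (\<forall>k n. A k n \<in> sets borel) \<and>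
     (\<forall>k n. emeasure lborel (tent A k n) \<le> ennreal (K * 2 powi (- k)))"

definition tent_max :: "(int \<Rightarrow> int \<Rightarrow> real set) \<Rightarrow> (real \<Rightarrow> ennreal) \<Rightarrow> real \<Rightarrow> ennreal" where
  "tent_max A F x = (SUP (k, n) \<in> UNIV. dyadic_avg k n F * indicator (A k n) x)"

lemma dyadic_eq_interval: "dyadic k n = {of_int n * 2 powi (- k)..<(of_int n + 1) * 2 powi (- k)}"
proof -
  have p: "(2::real) powi k > 0" by simp
  show ?thesis
    unfolding dyadic_def floor_eq_iff set_eq_iff mem_Collect_eq atLeastLessThan_iff
    by (simp add: power_int_minus field_simps)
qed

lemma dyadic_borel [measurable]: "dyadic k n \<in> sets borel"
  by (simp add: dyadic_eq_interval)

lemma dyadic_ancestor: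
  assumes "y \<in> dyadic k n" "k0 \<le> k"
  shows "y \<in> dyadic k0 (ancestor k n k0)"
proof -
  define m where "m = nat (k - k0)"
  have k: "k = k0 + int m" using assms by (simp add: m_def)
  have "(2::real) powi k0 * y = (2 powi k * y) / of_int (2 ^ m)"
    by (simp add: k power_int_add)
  then have "\<lfloor>2 powi k0 * y\<rfloor> = \<lfloor>2 powi k * y\<rfloor> div 2 ^ m"
    by (metis floor_divide_real_eq_div zero_le_numeral zero_le_power)
  then show ?thesis
    using assms by (simp add: dyadic_def ancestor_def m_def)
qed

lemma ancestor_ancestor:
  assumes "k'' \<le> k'" "k' \<le> k"
  shows "ancestor k' (ancestor k n k') k'' = ancestor k n k''"
proof -
  have "nat (k - k'') = nat (k - k') + nat (k' - k'')" using assms by auto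
  then show ?thesis
    by (simp add: ancestor_def power_add zdiv_zmult2_eq)
qed

lemma ancestor_self [simp]: "ancestor k n k = n"
  by (simp add: ancestor_def)

lemma borel_measurable_tent_max:
  assumes "tent_bound A K"
  shows "tent_max A F \<in> borel_measurable borel"
proof -
  have [measurable]: "A k n \<in> sets borel" for k n using assms by (simp add: tent_bound_def)
  show ?thesis
    unfolding tent_max_def case_prod_unfold by measurable
qed

lemma dyadic_avg_mono:
  "(\<And>x. F x \<le> G x) \<Longrightarrow> dyadic_avg k n F \<le> dyadic_avg k n G"
  unfolding dyadic_avg_def by (intro mult_left_mono nn_integral_mono mult_right_mono) auto

lemma dyadic_avg_add:
  assumes [measurable]: "F \<in> borel_measurable borel" "G \<in> borel_measurable borel"
  shows "dyadic_avg k n (\<lambda>x. F x + G x) = dyadic_avg k n F + dyadic_avg k n G"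
  unfolding dyadic_avg_def by (simp add: distrib_right distrib_left nn_integral_add)

lemma dyadic_avg_const: "dyadic_avg k n (\<lambda>x. c) = c"
proof -
  have "emeasure lborel (dyadic k n) = ennreal (2 powi (- k))"
    by (simp add: dyadic_eq_interval left_diff_distrib algebra_simps)
  then have "dyadic_avg k n (\<lambda>x. c) = c * (ennreal (2 powi k) * ennreal (2 powi (- k)))"
    by (simp add: dyadic_avg_def nn_integral_cmult_indicator ac_simps)
  also have "ennreal (2 powi k) * ennreal (2 powi (- k)) = 1"
    by (simp add: power_int_minus flip: ennreal_mult)
  finally show ?thesis by simp
qed

lemma tent_max_upper: "x \<in> A k n \<Longrightarrow> dyadic_avg k n F \<le> tent_max A F x"
  unfolding tent_max_def by (rule SUP_upper2[of "(k, n)"]) auto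

lemma tent_max_least:
  "(\<And>k n. x \<in> A k n \<Longrightarrow> dyadic_avg k n F \<le> c) \<Longrightarrow> tent_max A F x \<le> c"
  unfolding tent_max_def by (rule SUP_least) (auto simp: indicator_def)

text \<open>
  Among the dyadic intervals of length at most \<open>2\<^bsup>-kmin\<^esup>\<close> with average above \<open>lam\<close>, each has a maximal
  ancestor, because only finitely many ancestors are admissible. The maximal ones are disjoint, and every
  set \<open>A k n\<close> lies in the tent over its maximal ancestor. That tent has measure at most \<open>K\<close> times the
  length of the ancestor, hence at most \<open>K / lam\<close> times the integral of \<open>F\<close> over it.
\<close>

lemma tent_max_weak_type_aux:
  assumes A: "tent_bound A K" and lam: "0 < lam" and [measurable]: "F \<in> borel_measurable borel"
  shows "emeasure lborel (\<Union>(k, n) \<in> {(k, n). kmin \<le> k \<and> ennreal lam < dyadic_avg k n F}. A k n)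
    \<le> ennreal (K / lam) * (\<integral>\<^sup>+ x. F x \<partial>lborel)"
proof -
  have K: "0 \<le> K" and [measurable]: "\<And>k n. A k n \<in> sets borel"
    and Kb: "\<And>k n. emeasure lborel (tent A k n) \<le> ennreal (K * 2 powi (- k))"
    using A by (auto simp: tent_bound_def)
  let ?T = "\<lambda>p. tent A (fst p) (snd p)" and ?D = "\<lambda>p. dyadic (fst p) (snd p)"
  define B where "B = {(k, n). kmin \<le> k \<and> ennreal lam < dyadic_avg k n F}"
  define Bmax where
    "Bmax = {(k, n) \<in> B. \<forall>k'. kmin \<le> k' \<and> k' < k \<longrightarrow> (k', ancestor k n k') \<notin> B}"
  have [measurable]: "tent A k n \<in> sets borel" for k n
    unfolding tent_def by (intro sets.countable_UN') (auto simp: uncountable_def)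
  have maximal: "\<exists>k'\<le>k. (k', ancestor k n k') \<in> Bmax" if kn: "(k, n) \<in> B" for k n
  proof -
    define I where "I = {k' \<in> {kmin..k}. (k', ancestor k n k') \<in> B}"
    have "finite I" unfolding I_def by (rule finite_subset[of _ "{kmin..k}"]) auto
    moreover have "k \<in> I" using kn by (auto simp: I_def B_def)
    ultimately have M: "Min I \<in> I" "\<And>k'. k' \<in> I \<Longrightarrow> Min I \<le> k'"
      by (auto intro: Min_in)
    have "(Min I, ancestor k n (Min I)) \<in> Bmax"
      unfolding Bmax_def
    proof (safe)
      show "(Min I, ancestor k n (Min I)) \<in> B" using M(1) by (simp add: I_def)
      fix k' assume k': "kmin \<le> k'" "k' < Min I"
        and b: "(k', ancestor (Min I) (ancestor k n (Min I)) k') \<in> B"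
      have "Min I \<le> k" using M(1) by (simp add: I_def)
      then have "(k', ancestor k n k') \<in> B" using b k' by (simp add: ancestor_ancestor)
      then have "k' \<in> I" using k' \<open>Min I \<le> k\<close> by (simp add: I_def)
      then show False using M(2) k' by force
    qed
    then show ?thesis using M(1) by (auto simp: I_def)
  qed
  have disj: "p = p'" if p: "p \<in> Bmax" "p' \<in> Bmax"
      and y: "y \<in> ?D p" "y \<in> dyadic (fst p') (snd p')" for p p' y
  proof -
    have eq: "(k', ancestor k n k') = (k', n')"
      if "y \<in> dyadic k n" "y \<in> dyadic k' n'" "k' \<le> k" for k n k' n'
      using dyadic_ancestor[OF that(1,3)] that(2) by (simp add: dyadic_def)
    have *: "\<not> fst p' < fst p" if "p \<in> Bmax" "p' \<in> Bmax"
       "y \<in> ?D p" "y \<in> dyadic (fst p') (snd p')" for p p'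
    proof
      assume l: "fst p' < fst p"
      obtain k n k' n' where [simp]: "p = (k, n)" "p' = (k', n')" by (cases p; cases p')
      show False
        using that l eq[of k n k' n'] by (auto simp: Bmax_def B_def)
    qed
    have "fst p = fst p'" using *[OF p y] *[OF p(2,1) y(2,1)] by linarith
    then show ?thesis using y by (auto simp: dyadic_def prod_eq_iff)
  qed
  have "(\<Union>(k, n) \<in> B. A k n) \<subseteq> (\<Union>p \<in> Bmax. ?T p)"
    using maximal by (fastforce simp: tent_def)
  then have "emeasure lborel (\<Union>(k, n) \<in> B. A k n)
    \<le> (\<integral>\<^sup>+ x. indicator (\<Union>p \<in> Bmax. ?T p) x \<partial>lborel)"
    by (subst nn_integral_indicator) (auto intro!: emeasure_mono sets.countable_UN')
  also have "\<dots> \<le> (\<integral>\<^sup>+ x. (\<integral>\<^sup>+ p. indicator (?T p) x \<partial>count_space Bmax) \<partial>lborel)"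
  proof (intro nn_integral_mono)
    fix x :: real
    show "indicator (\<Union>p \<in> Bmax. ?T p) x
      \<le> (\<integral>\<^sup>+ p. indicator (?T p) x \<partial>count_space Bmax :: ennreal)"
    proof (cases "x \<in> (\<Union>p \<in> Bmax. ?T p)")
      case True
      then obtain p where p: "p \<in> Bmax" "x \<in> ?T p" by blast
      have "(1::ennreal) = (\<integral>\<^sup>+ q. indicator {p} q \<partial>count_space Bmax)"
        using p by simp
      also have "\<dots> \<le> (\<integral>\<^sup>+ p. indicator (?T p) x \<partial>count_space Bmax)"
        using p by (intro nn_integral_mono) (auto simp: indicator_def)
      finally show ?thesis using True by simp
    qed simp
  qed
  also have "\<dots> = (\<integral>\<^sup>+ p. (\<integral>\<^sup>+ x. indicator (?T p) x \<partial>lborel) \<partial>count_space Bmax)"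
    by (rule nn_integral_count_space_nn_integral) auto
  also have "\<dots> \<le> (\<integral>\<^sup>+ p. (\<integral>\<^sup>+ x. ennreal (K / lam) * (F x * indicator (?D p) x) \<partial>lborel)
      \<partial>count_space Bmax)"
  proof (rule nn_integral_mono)
    fix p assume "p \<in> space (count_space Bmax)"
    then obtain k n where p: "p = (k, n)" "ennreal lam < dyadic_avg k n F"
      by (cases p) (auto simp: Bmax_def B_def)
    have "(\<integral>\<^sup>+ x. indicator (?T p) x \<partial>lborel) \<le> ennreal (K * 2 powi (- k))"
      using Kb by (simp add: p)
    also have "\<dots> = ennreal (K / lam * 2 powi (- k)) * ennreal lam"
      using lam K by (simp flip: ennreal_mult)
    also have "\<dots> \<le> ennreal (K / lam * 2 powi (- k)) * dyadic_avg k n F"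
      using p by (intro mult_left_mono) auto
    also have "\<dots> = ennreal (K / lam) * (\<integral>\<^sup>+ x. F x * indicator (?D p) x \<partial>lborel)"
    proof -
      have "ennreal (K / lam * 2 powi (- k)) * ennreal (2 powi k) = ennreal (K / lam)"
        using lam K by (simp add: power_int_minus flip: ennreal_mult)
      then show ?thesis by (simp add: dyadic_avg_def p flip: mult.assoc)
    qed
    also have "\<dots> = (\<integral>\<^sup>+ x. ennreal (K / lam) * (F x * indicator (?D p) x) \<partial>lborel)"
      by (rule nn_integral_cmult[symmetric]) measurable
    finally show "(\<integral>\<^sup>+ x. indicator (?T p) x \<partial>lborel)
      \<le> (\<integral>\<^sup>+ x. ennreal (K / lam) * (F x * indicator (?D p) x) \<partial>lborel)" .
  qed
  also have "\<dots> = (\<integral>\<^sup>+ x. (\<integral>\<^sup>+ p. ennreal (K / lam) * (F x * indicator (?D p) x)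
      \<partial>count_space Bmax) \<partial>lborel)"
    by (rule nn_integral_count_space_nn_integral[symmetric]) auto
  also have "\<dots> \<le> (\<integral>\<^sup>+ x. ennreal (K / lam) * F x \<partial>lborel)"
  proof (intro nn_integral_mono)
    fix x :: real
    have "(\<integral>\<^sup>+ p. ennreal (K / lam) * (F x * indicator (?D p) x) \<partial>count_space Bmax)
      = ennreal (K / lam) * F x * (\<integral>\<^sup>+ p. indicator (?D p) x \<partial>count_space Bmax)"
      by (simp add: nn_integral_cmult flip: mult.assoc)
    also have "(\<integral>\<^sup>+ p. indicator (?D p) x \<partial>count_space Bmax) \<le> (1::ennreal)"
    proof (cases "\<exists>p\<in>Bmax. x \<in> ?D p")
      case True
      then obtain p where p: "p \<in> Bmax" "x \<in> ?D p" by blast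
      have "(\<integral>\<^sup>+ p. indicator (?D p) x \<partial>count_space Bmax)
        \<le> (\<integral>\<^sup>+ q. indicator {p} q \<partial>count_space Bmax :: ennreal)"
        using disj[OF _ p(1) _ p(2)] by (intro nn_integral_mono) (auto simp: indicator_def)
      also have "\<dots> = 1" using p by simp
      finally show ?thesis .
    next
      case False
      then have "(\<integral>\<^sup>+ p. indicator (?D p) x \<partial>count_space Bmax)
        = (\<integral>\<^sup>+ p. 0 \<partial>count_space Bmax :: ennreal)"
        by (intro nn_integral_cong) auto
      then show ?thesis by simp
    qed
    finally show "(\<integral>\<^sup>+ p. ennreal (K / lam) * (F x * indicator (?D p) x) \<partial>count_space Bmax)
      \<le> ennreal (K / lam) * F x" by (simp add: mult_left_mono)
  qed
  also have "\<dots> = ennreal (K / lam) * (\<integral>\<^sup>+ x. F x \<partial>lborel)"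
    by (rule nn_integral_cmult) measurable
  finally show ?thesis by (simp add: B_def)
qed

text \<open>
  The restriction on the length of the intervals disappears by monotone convergence.
\<close>

lemma tent_max_weak_type:
  assumes A: "tent_bound A K" and lam: "0 < lam" and F: "F \<in> borel_measurable borel"
  shows "emeasure lborel {x. ennreal lam < tent_max A F x}
    \<le> ennreal (K / lam) * (\<integral>\<^sup>+ x. F x \<partial>lborel)"
proof -
  define V where
    "V m = (\<Union>(k, n) \<in> {(k, n). - int m \<le> k \<and> ennreal lam < dyadic_avg k n F}. A k n)" for m
  have [measurable]: "\<And>k n. A k n \<in> sets borel" using A by (auto simp: tent_bound_def)
  have V: "V m \<in> sets borel" for m
    unfolding V_def by (intro sets.countable_UN') auto
  have "{x. ennreal lam < tent_max A F x} = (\<Union>m. V m)"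
  proof (intro set_eqI iffI)
    fix x assume "x \<in> {x. ennreal lam < tent_max A F x}"
    then obtain k n where "ennreal lam < dyadic_avg k n F * indicator (A k n) x"
      by (auto simp: tent_max_def less_SUP_iff)
    then have "x \<in> A k n" "ennreal lam < dyadic_avg k n F"
      by (cases "x \<in> A k n"; simp)+
    moreover have "- int (nat (- k)) \<le> k" by simp
    ultimately have "x \<in> V (nat (- k))" unfolding V_def by blast
    then show "x \<in> (\<Union>m. V m)" by blast
  next
    fix x assume "x \<in> (\<Union>m. V m)"
    then obtain k n where "x \<in> A k n" "ennreal lam < dyadic_avg k n F"
      by (auto simp: V_def)
    then show "x \<in> {x. ennreal lam < tent_max A F x}"
      using tent_max_upper[of x A k n F] by auto
  qed
  also have "emeasure lborel (\<Union>m. V m) = (SUP m. emeasure lborel (V m))"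
  proof (intro SUP_emeasure_incseq[symmetric])
    show "incseq V"
      unfolding incseq_def V_def by (intro allI impI UN_mono) auto
  qed (use V in auto)
  also have "\<dots> \<le> ennreal (K / lam) * (\<integral>\<^sup>+ x. F x \<partial>lborel)"
    unfolding V_def by (intro SUP_least tent_max_weak_type_aux[OF A lam F])
  finally show ?thesis .
qed

lemma ennreal_top_if_ge_all:
  assumes "\<And>b. 0 \<le> b \<Longrightarrow> ennreal b \<le> x"
  shows "x = top"
proof (cases x)
  case (real a)
  then have "ennreal (a + 1) \<le> ennreal a" using assms[of "a + 1"] by simp
  then show ?thesis using real by (subst (asm) ennreal_le_iff) auto
qed

text \<open>
  The layer cake formula at one point. Maximal functions may be infinite, so the value \<open>G = \<infinity>\<close> is included.
\<close>

lemma layer_cake_powr: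
  assumes q: "0 < q"
  shows "(\<integral>\<^sup>+ s. ennreal (q * s powr (q - 1)) * indicator {s. 0 < s \<and> ennreal s < G} s \<partial>lborel)
    = ennreal_powr G q" (is "?L = _")
proof -
  have fin: "(\<integral>\<^sup>+ s. ennreal (q * s powr (q - 1)) * indicator {0<..<a} s \<partial>lborel) = ennreal (a powr q)"
    if a: "0 \<le> a" for a
  proof -
    have "((\<lambda>x. q * x powr (q - 1)) has_integral (q * (a powr (q - 1 + 1) / (q - 1 + 1)))) {0..a}"
      using q a by (intro has_integral_mult_right has_integral_powr_from_0) auto
    then have "((\<lambda>x. q * x powr (q - 1)) has_integral (a powr q)) {0..a}"
      using q by simp
    then have "(\<integral>\<^sup>+ s. ennreal (q * s powr (q - 1)) * indicator {0..a} s \<partial>lborel) = ennreal (a powr q)"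
      using q by (intro nn_integral_has_integral_lebesgue') auto
    moreover have "(\<integral>\<^sup>+ s. ennreal (q * s powr (q - 1)) * indicator {0..a} s \<partial>lborel)
      = (\<integral>\<^sup>+ s. ennreal (q * s powr (q - 1)) * indicator {0<..<a} s \<partial>lborel)"
      using AE_lborel_singleton[of 0] AE_lborel_singleton[of a]
      by (intro nn_integral_cong_AE) (auto simp: indicator_def)
    ultimately show ?thesis by simp
  qed
  show ?thesis
  proof (cases G)
    case (real a)
    then have "{s. 0 < s \<and> ennreal s < G} = {0<..<a}"
      by (auto simp: ennreal_less_iff)
    then show ?thesis using fin[of a] real by (simp add: ennreal_powr_ennreal)
  next
    case top
    have "ennreal b \<le> ?L"
      if "0 \<le> b" for b
    proof -
      have "ennreal b = (\<integral>\<^sup>+ s. ennreal (q * s powr (q - 1)) * indicator {0<..<b powr (1/q)} s \<partial>lborel)"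
        using q that by (subst fin) (auto simp: powr_powr)
      also have "\<dots> \<le> ?L"
        using top by (intro nn_integral_mono) (auto simp: indicator_def)
      finally show ?thesis .
    qed
    then have "?L = top"
      by (intro ennreal_top_if_ge_all)
    then show ?thesis using top by simp
  qed
qed

text \<open>
  Marcinkiewicz interpolation with the trivial bound by the supremum: at height \<open>s\<close> only the part of \<open>F\<close>
  above \<open>s / 2\<close> is relevant. The constant is linear in \<open>K\<close>; a worse dependence would spoil the balance
  between the number of translates and the decay of the arcs.
\<close>

theorem tent_max_strong_type:
  assumes A: "tent_bound A K" and q: "1 < q" and [measurable]: "F \<in> borel_measurable borel"
  shows "power_integral q (tent_max A F)
    \<le> ennreal (2 powr q * q / (q - 1) * K) * power_integral q F"
proof -
  have K: "0 \<le> K" using A by (simp add: tent_bound_def)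
  define G where "G = tent_max A F"
  have [measurable]: "G \<in> borel_measurable borel"
    unfolding G_def by (rule borel_measurable_tent_max[OF A])
  let ?k = "\<lambda>s x. ennreal (2 * K * q / (q - 1)) * (ennreal ((q - 1) * s powr (q - 1 - 1)) *
           indicator {s. 0 < s \<and> ennreal s < 2 * F x} s) * F x"
  let ?j = "\<lambda>s x. ennreal (q * s powr (q - 1)) * indicator {s. 0 < s \<and> ennreal s < G x} s"
  have weak: "ennreal (q * s powr (q - 1)) * indicator {0<..} s * emeasure lborel {x. ennreal s < G x}
     \<le> (\<integral>\<^sup>+ x. ?k s x \<partial>lborel)" for s
  proof (cases "0 < s")
    case s: True
    define F' where "F' x = F x * indicator {x. ennreal (s / 2) < F x} x" for x
    have [measurable]: "F' \<in> borel_measurable borel"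
      unfolding F'_def by measurable
    have le: "G x \<le> tent_max A F' x + ennreal (s / 2)" for x
      unfolding G_def
    proof (rule tent_max_least)
      fix k n assume x: "x \<in> A k n"
      have "dyadic_avg k n F \<le> dyadic_avg k n (\<lambda>x. F' x + ennreal (s / 2))"
        by (intro dyadic_avg_mono) (auto simp: F'_def indicator_def)
      also have "\<dots> = dyadic_avg k n F' + ennreal (s / 2)"
        by (simp add: dyadic_avg_add dyadic_avg_const)
      also have "\<dots> \<le> tent_max A F' x + ennreal (s / 2)"
        using x by (intro add_right_mono tent_max_upper)
      finally show "dyadic_avg k n F \<le> \<dots>" .
    qed
    have sub: "{x. ennreal s < G x} \<subseteq> {x. ennreal (s / 2) < tent_max A F' x}"
    proof safe
      fix x assume "ennreal s < G x"
      also note le[of x]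
      also have "ennreal s = ennreal (s / 2) + ennreal (s / 2)"
        using s by (simp flip: ennreal_plus)
      finally show "ennreal (s / 2) < tent_max A F' x"
        by (metis add_right_mono not_less)
    qed
    have [measurable]: "tent_max A F' \<in> borel_measurable borel"
      by (rule borel_measurable_tent_max[OF A])
    have "emeasure lborel {x. ennreal s < G x} \<le> emeasure lborel {x. ennreal (s / 2) < tent_max A F' x}"
      by (intro emeasure_mono sub) measurable
    also have "\<dots> \<le> ennreal (K / (s / 2)) * (\<integral>\<^sup>+ x. F' x \<partial>lborel)"
      using s by (intro tent_max_weak_type[OF A]) auto
    finally have "ennreal (q * s powr (q - 1)) * emeasure lborel {x. ennreal s < G x}
      \<le> ennreal (q * s powr (q - 1)) * (ennreal (K / (s / 2)) * (\<integral>\<^sup>+ x. F' x \<partial>lborel))"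
      by (intro mult_left_mono) auto
    also have "\<dots> = ennreal (2 * K * q / (q - 1)) * ennreal ((q - 1) * s powr (q - 1 - 1)) *
        (\<integral>\<^sup>+ x. F' x \<partial>lborel)"
    proof -
      have "q * s powr (q - 1) * (K / (s / 2)) = 2 * K * q / (q - 1) * ((q - 1) * s powr (q - 1 - 1))"
        using q s by (simp add: powr_diff field_simps power2_eq_square)
      then show ?thesis
        using q s K by (simp flip: mult.assoc ennreal_mult)
    qed
    also have "\<dots> = (\<integral>\<^sup>+ x. ?k s x \<partial>lborel)"
    proof (subst nn_integral_cmult[symmetric], measurable, rule nn_integral_cong)
      fix x
      have "ennreal (s / 2) < F x \<longleftrightarrow> ennreal s < 2 * F x"
      proof (cases "F x")
        case (real a)
        then have "2 * F x = ennreal (2 * a)" using ennreal_mult[of 2 a] by simp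
        then show ?thesis using real s by (simp add: ennreal_less_iff field_simps)
      qed (auto simp: ennreal_mult_top)
      then show "ennreal (2 * K * q / (q - 1)) * ennreal ((q - 1) * s powr (q - 1 - 1)) * F' x
        = ?k s x"
        using s by (simp add: F'_def indicator_def)
    qed
    finally show ?thesis using s by simp
  qed simp
  have "power_integral q G
    = (\<integral>\<^sup>+ x. \<integral>\<^sup>+ s. ?j s x \<partial>lborel \<partial>lborel)"
    using q by (subst layer_cake_powr) auto
  also have "\<dots> = (\<integral>\<^sup>+ s. \<integral>\<^sup>+ x. ?j s x \<partial>lborel \<partial>lborel)"
    by (rule lborel_pair.Fubini') measurable
  also have "\<dots> = (\<integral>\<^sup>+ s. ennreal (q * s powr (q - 1)) * indicator {0<..} s * emeasure lborel {x. ennreal s < G x} \<partial>lborel)"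
  proof (rule nn_integral_cong)
    fix s :: real
    have "(\<integral>\<^sup>+ x. ?j s x \<partial>lborel)
      = (\<integral>\<^sup>+ x. (ennreal (q * s powr (q - 1)) * indicator {0<..} s) * indicator {x. ennreal s < G x} x \<partial>lborel)"
      by (intro nn_integral_cong) (auto simp: indicator_def)
    then show "(\<integral>\<^sup>+ x. ?j s x \<partial>lborel) =
       ennreal (q * s powr (q - 1)) * indicator {0<..} s * emeasure lborel {x. ennreal s < G x}"
      by (simp add: nn_integral_cmult_indicator)
  qed
  also have "\<dots> \<le> (\<integral>\<^sup>+ s. \<integral>\<^sup>+ x. ?k s x \<partial>lborel \<partial>lborel)"
    by (intro nn_integral_mono weak)
  also have "\<dots> = (\<integral>\<^sup>+ x. \<integral>\<^sup>+ s. ?k s x \<partial>lborel \<partial>lborel)"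
    by (rule lborel_pair.Fubini') measurable
  also have "\<dots> = (\<integral>\<^sup>+ x. ennreal (2 * K * q / (q - 1)) * ennreal_powr (2 * F x) (q - 1) * F x \<partial>lborel)"
  proof (rule nn_integral_cong)
    fix x
    show "(\<integral>\<^sup>+ s. ?k s x \<partial>lborel)
      = ennreal (2 * K * q / (q - 1)) * ennreal_powr (2 * F x) (q - 1) * F x"
      using q by (subst layer_cake_powr[symmetric])
        (simp_all add: nn_integral_cmult nn_integral_multc)
  qed
  also have "\<dots> = (\<integral>\<^sup>+ x. ennreal (2 powr q * q / (q - 1) * K) * ennreal_powr (F x) q \<partial>lborel)"
  proof (rule nn_integral_cong)
    fix x
    have "ennreal_powr (F x) q = ennreal_powr (F x) (q - 1) * F x"
      using ennreal_powr_add[of "q - 1" 1 "F x"] q by simp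
    moreover have "ennreal_powr (2 * F x) (q - 1) = ennreal (2 powr (q - 1)) * ennreal_powr (F x) (q - 1)"
      using ennreal_powr_ennreal[of 2] by (simp add: ennreal_powr_mult)
    moreover have "ennreal (2 * K * q / (q - 1)) * ennreal (2 powr (q - 1)) = ennreal (2 powr q * q / (q - 1) * K)"
    proof -
      have "2 * K * q / (q - 1) * 2 powr (q - 1) = 2 powr q * q / (q - 1) * K"
        using q by (simp add: powr_diff field_simps)
      then show ?thesis using q K by (simp flip: ennreal_mult)
    qed
    ultimately show "ennreal (2 * K * q / (q - 1)) * ennreal_powr (2 * F x) (q - 1) * F x
      = ennreal (2 powr q * q / (q - 1) * K) * ennreal_powr (F x) q"
      by (metis mult.assoc)
  qed
  also have "\<dots> = ennreal (2 powr q * q / (q - 1) * K) * power_integral q F"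
    by (rule nn_integral_cmult) measurable
  finally show ?thesis by (simp add: G_def)
qed

section \<open>Maximal functions shifted along a covering of the dilation set\<close>

text \<open>
  Level \<open>i\<close> relates intervals of length \<open>2\<^sup>-\<^sup>k\<close> to dilations \<open>t\<close> of size about \<open>4\<^sup>i 2\<^sup>-\<^sup>k\<close>. The first condition
  says that \<open>x\<close> is close to a translate of the interval by a shift in \<open>T k\<close>, where closeness is measured by
  the length of the interval; the second one bounds the effective shifts by the size of the dilations.
\<close>

definition shifted :: "nat \<Rightarrow> (int \<Rightarrow> real set) \<Rightarrow> int \<Rightarrow> int \<Rightarrow> real set" where
  "shifted i T k n = {x. (\<exists>a\<in>T k. \<bar>x - a - of_int n * 2 powi (- k)\<bar> \<le> 3 * 2 powi (- k)) \<and>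
     \<bar>x - of_int n * 2 powi (- k)\<bar> \<le> 4 * 4 ^ i * 2 powi (- k)}"

definition weighted_max :: "real \<Rightarrow> (nat \<Rightarrow> int \<Rightarrow> real set) \<Rightarrow> (real \<Rightarrow> ennreal) \<Rightarrow> real \<Rightarrow> ennreal" where
  "weighted_max c U F x = (SUP i. ennreal (c ^ i) * tent_max (shifted i (U i)) F x)"

text \<open>
  Descendants in the first \<open>2 i\<close> generations contribute translates of the whole interval, at most one for
  each shift and generation. In later generations the shifts, at most about \<open>4\<^sup>i\<close> lengths of the
  descendant, no longer exceed the length of the whole interval, so the contribution stays near it.
\<close>

lemma tent_shifted_subset:
  fixes k n :: int
  defines "L \<equiv> 2 powi (- k) :: real"
  shows "tent (shifted i T) k n \<subseteq>
    (\<Union>m<2 * i. \<Union>a\<in>T (k + int m). {a + of_int n * L - 3 * L..a + of_int n * L + 4 * L}) \<union>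
    {of_int n * L - 5 * L..of_int n * L + 5 * L}"
proof
  fix x assume "x \<in> tent (shifted i T) k n"
  then obtain k' n' where k': "k \<le> k'" "ancestor k' n' k = n" and x: "x \<in> shifted i T k' n'"
    by (auto simp: tent_def)
  define m where "m = nat (k' - k)"
  define l where "l = (2::real) powi (- k')"
  have km: "k' = k + int m" using k' by (simp add: m_def)
  have L: "L > 0" and l: "l > 0" by (auto simp: L_def l_def)
  have Ll: "L = 2 ^ m * l"
    by (simp add: L_def l_def km power_int_add power_int_diff)
  have "n = n' div 2 ^ m" using k'(2) by (simp add: ancestor_def m_def)
  then have n': "n * 2 ^ m \<le> n'" "n' < n * 2 ^ m + 2 ^ m"
    using div_mult_mod_eq[of n' "2 ^ m"] pos_mod_bound[of "2 ^ m" n'] pos_mod_sign[of "2 ^ m" n']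
    by (smt (verit) zero_less_power)+
  have "real_of_int (n * 2 ^ m) \<le> of_int n'" "real_of_int n' \<le> of_int (n * 2 ^ m + 2 ^ m)"
    using n' by linarith+
  then have "of_int n * 2 ^ m \<le> real_of_int n'" "real_of_int n' \<le> of_int n * 2 ^ m + 2 ^ m"
    by simp_all
  then have "of_int n * 2 ^ m * l \<le> real_of_int n' * l" "real_of_int n' * l \<le> (of_int n * 2 ^ m + 2 ^ m) * l"
    using l by (simp_all only: mult_right_mono)
  then have nl: "of_int n * L \<le> real_of_int n' * l" "real_of_int n' * l \<le> of_int n * L + L"
    by (simp_all add: Ll algebra_simps)
  have "1 * l \<le> 2 ^ m * l" using l by (intro mult_right_mono) auto
  then have lL: "l \<le> L" by (simp add: Ll)
  obtain a where a: "a \<in> T k'" "\<bar>x - a - of_int n' * l\<bar> \<le> 3 * l"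
      and x2: "\<bar>x - of_int n' * l\<bar> \<le> 4 * 4 ^ i * l"
    using x by (auto simp: shifted_def l_def)
  show "x \<in> (\<Union>m<2 * i. \<Union>a\<in>T (k + int m). {a + of_int n * L - 3 * L..a + of_int n * L + 4 * L}) \<union>
    {of_int n * L - 5 * L..of_int n * L + 5 * L}"
  proof (cases "m < 2 * i")
    case True
    have "x \<in> {a + of_int n * L - 3 * L..a + of_int n * L + 4 * L}"
      using a(2) nl lL unfolding abs_le_iff by auto
    then show ?thesis using a(1) True by (auto simp: km)
  next
    case False
    have "(4::real) ^ i = 2 ^ (2 * i)" by (simp add: power_mult)
    also have "\<dots> \<le> 2 ^ m" using False by (intro power_increasing) auto
    finally have "4 ^ i * l \<le> L" unfolding Ll using l by (intro mult_right_mono) auto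
    then have "x \<in> {of_int n * L - 5 * L..of_int n * L + 5 * L}"
      using x2 nl unfolding abs_le_iff by auto
    then show ?thesis by blast
  qed
qed

lemma tent_bound_shifted:
  assumes T: "\<And>k. finite (T k)" "\<And>k. real (card (T k)) \<le> N"
  shows "tent_bound (shifted i T) (14 * real i * N + 10)"
  unfolding tent_bound_def
proof (intro conjI allI)
  have N: "0 \<le> N" using T(2)[of 0] by linarith
  show "0 \<le> 14 * real i * N + 10" using N by simp
  show "shifted i T k n \<in> sets borel" for k n
  proof -
    have "shifted i T k n = (\<Union>a\<in>T k. {x. \<bar>x - a - of_int n * 2 powi (- k)\<bar> \<le> 3 * 2 powi (- k)}) \<inter>
       {x. \<bar>x - of_int n * 2 powi (- k)\<bar> \<le> 4 * 4 ^ i * 2 powi (- k)}"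
      by (auto simp: shifted_def)
    moreover have "{x::real. \<bar>x - a - of_int n * 2 powi (- k)\<bar> \<le> 3 * 2 powi (- k)} \<in> sets borel" for a
      by measurable
    moreover have "{x::real. \<bar>x - of_int n * 2 powi (- k)\<bar> \<le> 4 * 4 ^ i * 2 powi (- k)} \<in> sets borel"
      by measurable
    ultimately show ?thesis using T(1) by (auto intro!: sets.finite_UN)
  qed
  fix k n
  define L where "L = (2::real) powi (- k)"
  have L: "L > 0" by (simp add: L_def)
  let ?I = "\<lambda>a. {a + of_int n * L - 3 * L..a + of_int n * L + 4 * L}"
  let ?J = "{of_int n * L - 5 * L..of_int n * L + 5 * L}"
  have one: "emeasure lborel (\<Union>a\<in>T j. ?I a) \<le> ennreal (7 * N * L)" for j
  proof -
    have "emeasure lborel (\<Union>a\<in>T j. ?I a) \<le> (\<Sum>a\<in>T j. emeasure lborel (?I a))"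
      using T(1) by (intro emeasure_subadditive_finite) auto
    also have "\<dots> = (\<Sum>a\<in>T j. ennreal (7 * L))"
      using L by (intro sum.cong) auto
    also have "\<dots> = ennreal (real (card (T j)) * (7 * L))"
      using L by (subst sum_ennreal) auto
    also have "\<dots> \<le> ennreal (N * (7 * L))"
      using T(2) L by (intro ennreal_leI mult_right_mono) auto
    finally show ?thesis by (simp add: ac_simps)
  qed
  have "emeasure lborel (tent (shifted i T) k n)
    \<le> emeasure lborel ((\<Union>m<2 * i. \<Union>a\<in>T (k + int m). ?I a) \<union> ?J)"
    using tent_shifted_subset[of i T k n] T(1) unfolding L_def
    by (intro emeasure_mono) (auto intro!: sets.finite_UN)
  also have "\<dots> \<le> emeasure lborel (\<Union>m<2 * i. \<Union>a\<in>T (k + int m). ?I a) + emeasure lborel ?J"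
    using T(1) by (intro emeasure_subadditive) (auto intro!: sets.finite_UN)
  also have "emeasure lborel (\<Union>m<2 * i. \<Union>a\<in>T (k + int m). ?I a)
     \<le> (\<Sum>m<2 * i. emeasure lborel (\<Union>a\<in>T (k + int m). ?I a))"
    using T(1) by (intro emeasure_subadditive_finite) (auto intro!: sets.finite_UN)
  also have "\<dots> \<le> (\<Sum>m<2 * i. ennreal (7 * N * L))"
    by (intro sum_mono one)
  also have "\<dots> = ennreal (14 * real i * N * L)"
    using L N by (subst sum_ennreal) (auto simp: ac_simps)
  also have "emeasure lborel ?J = ennreal (10 * L)"
    using L by simp
  also have "ennreal (14 * real i * N * L) + ennreal (10 * L) = ennreal ((14 * real i * N + 10) * L)"
    using L N by (subst ennreal_plus[symmetric]) (auto simp: algebra_simps)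
  finally show "emeasure lborel (tent (shifted i T) k n) \<le> ennreal ((14 * real i * N + 10) * 2 powi (- k))"
    by (simp add: L_def add_right_mono)
qed

definition strong_type :: "((real \<Rightarrow> ennreal) \<Rightarrow> real \<Rightarrow> ennreal) \<Rightarrow> real \<Rightarrow> bool" where
  "strong_type S q \<longleftrightarrow> (\<exists>C\<ge>0. \<forall>F \<in> borel_measurable borel.
     power_integral q (S F) \<le> ennreal C * power_integral q F)"

text \<open>
  The shift \<open>0\<close> puts a Hardy--Littlewood maximal function into level \<open>0\<close>; it controls the function whose
  coordinate moves freely near the pole.
\<close>

locale shift_system =
  fixes U :: "nat \<Rightarrow> int \<Rightarrow> real set" and N :: "nat \<Rightarrow> real"
  assumes finite_shifts: "finite (U i k)" and card_shifts: "real (card (U i k)) \<le> N i"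
    and zero_shift: "0 \<in> U i k"
begin

lemma N_ge_1: "1 \<le> N i"
proof -
  have "card (U i 0) \<noteq> 0" using zero_shift[of i 0] finite_shifts[of i 0] by auto
  then show ?thesis using card_shifts[of i 0] by linarith
qed

lemmas tent_bound_level = tent_bound_shifted[OF finite_shifts card_shifts]

lemma borel_measurable_weighted_max [measurable]: "weighted_max c U F \<in> borel_measurable borel"
proof -
  have [measurable]: "tent_max (shifted i (U i)) F \<in> borel_measurable borel" for i
    by (rule borel_measurable_tent_max[OF tent_bound_level])
  show ?thesis unfolding weighted_max_def by measurable
qed

text \<open>
  Level \<open>i\<close> has constant about \<open>i N\<^sub>i\<close> and weight \<open>c\<^bsup>iq\<^esup>\<close>. Since the \<open>q\<close>-th power of a supremum is at most
  the sum of the \<open>q\<close>-th powers, the series of \<open>i (c\<^sup>q R)\<^sup>i\<close> decides.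
\<close>

lemma weighted_max_strong_type:
  assumes c: "0 < c" and q: "1 < q"
    and N: "\<And>i. N i \<le> B * R ^ i" and R: "1 \<le> R" "c powr q * R < 1"
  shows "strong_type (weighted_max c U) q"
proof -
  define d where "d i = (c powr q) ^ i * (2 powr q * q / (q - 1) * (14 * real i * N i + 10))" for i
  have B: "1 \<le> B" using N[of 0] N_ge_1[of 0] by simp
  have N0: "0 \<le> N i" for i using N_ge_1[of i] by simp
  have d0: "0 \<le> d i" for i
    unfolding d_def using q N0[of i] by (intro mult_nonneg_nonneg) auto
  have dle: "d i \<le> 2 powr q * q / (q - 1) * (14 * B + 10) * (of_nat (Suc i) * (c powr q * R) ^ i)" for i
  proof -
    have "14 * real i * N i + 10 \<le> 14 * real i * (B * R ^ i) + 10 * R ^ i"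
      using N[of i] R(1) by (intro add_mono mult_left_mono) (auto simp: one_le_power)
    also have "\<dots> \<le> (14 * B + 10) * (of_nat (Suc i) * R ^ i)"
      using B R(1) by (simp add: algebra_simps)
    finally have "d i \<le> (c powr q) ^ i * (2 powr q * q / (q - 1) * ((14 * B + 10) * (of_nat (Suc i) * R ^ i)))"
      unfolding d_def using q by (intro mult_left_mono) auto
    then show ?thesis by (simp add: power_mult_distrib ac_simps)
  qed
  have "summable (\<lambda>i. of_nat (Suc i) * (c powr q * R) ^ i)"
    using geometric_deriv_sums[of "c powr q * R"] R c by (auto simp: sums_iff)
  then have "summable (\<lambda>i. 2 powr q * q / (q - 1) * (14 * B + 10) * (of_nat (Suc i) * (c powr q * R) ^ i))"
    by (rule summable_mult)
  then have sd: "summable d"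
    by (rule summable_comparison_test[rotated]) (use d0 dle in auto)
  show ?thesis
    unfolding strong_type_def
  proof (intro exI[of _ "suminf d"] conjI ballI)
    show "0 \<le> suminf d" using d0 sd by (intro suminf_nonneg)
    fix F :: "real \<Rightarrow> ennreal" assume [measurable]: "F \<in> borel_measurable borel"
    let ?M = "\<lambda>i. tent_max (shifted i (U i)) F"
    have [measurable]: "?M i \<in> borel_measurable borel" for i
      by (rule borel_measurable_tent_max[OF tent_bound_level])
    have "ennreal_powr (weighted_max c U F x) q \<le> (\<Sum>i. ennreal ((c powr q) ^ i) * ennreal_powr (?M i x) q)"
      (is "_ \<le> ?S x") for x
    proof -
      have "weighted_max c U F x \<le> ennreal_powr (?S x) (1 / q)"
        unfolding weighted_max_def
      proof (rule SUP_least)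
        fix i
        have "ennreal_powr (ennreal (c ^ i) * ?M i x) q = ennreal ((c powr q) ^ i) * ennreal_powr (?M i x) q"
          using c by (simp add: ennreal_powr_mult ennreal_powr_ennreal powr_powr ac_simps
             flip: powr_realpow)
        also have "\<dots> \<le> ?S x"
          by (rule term_le_suminf_ennreal)
        finally show "ennreal (c ^ i) * ?M i x \<le> ennreal_powr (?S x) (1 / q)"
          using q by (subst (asm) ennreal_powr_le_iff) auto
      qed
      then show ?thesis using q by (simp add: ennreal_powr_le_iff)
    qed
    then have "power_integral q (weighted_max c U F) \<le> (\<integral>\<^sup>+ x. ?S x \<partial>lborel)"
      by (intro nn_integral_mono)
    also have "\<dots> = (\<Sum>i. \<integral>\<^sup>+ x. ennreal ((c powr q) ^ i) * ennreal_powr (?M i x) q \<partial>lborel)"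
      by (intro nn_integral_suminf) measurable
    also have "\<dots> \<le> (\<Sum>i. ennreal (d i) * power_integral q F)"
    proof (intro suminf_le)
      fix i
      have "(\<integral>\<^sup>+ x. ennreal ((c powr q) ^ i) * ennreal_powr (?M i x) q \<partial>lborel)
        = ennreal ((c powr q) ^ i) * power_integral q (?M i)"
        by (rule nn_integral_cmult) measurable
      also have "\<dots> \<le> ennreal ((c powr q) ^ i) *
          (ennreal (2 powr q * q / (q - 1) * (14 * real i * N i + 10)) * power_integral q F)"
        by (intro mult_left_mono tent_max_strong_type[OF tent_bound_level q]) auto
      also have "\<dots> = ennreal (d i) * power_integral q F"
        unfolding d_def using q N0[of i]
        by (subst ennreal_mult) (auto simp: mult.assoc intro!: mult_nonneg_nonneg divide_nonneg_nonneg)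
      finally show "(\<integral>\<^sup>+ x. ennreal ((c powr q) ^ i) * ennreal_powr (?M i x) q \<partial>lborel)
         \<le> ennreal (d i) * power_integral q F" .
    qed auto
    also have "\<dots> = ennreal (suminf d) * power_integral q F"
      using d0 sd by (simp add: ennreal_suminf_multc suminf_ennreal2)
    finally show "power_integral q (weighted_max c U F)
      \<le> ennreal (suminf d) * power_integral q F" .
  qed
qed

lemma weighted_max_le_AE_bound:
  assumes c: "0 < c" "c \<le> 1" and M: "AE x in lborel. F x \<le> M"
  shows "weighted_max c U F x \<le> M"
  unfolding weighted_max_def
proof (rule SUP_least)
  fix i
  have "dyadic_avg k n F \<le> dyadic_avg k n (\<lambda>_. M)" for k n
    unfolding dyadic_avg_def using M by (intro mult_left_mono nn_integral_mono_AE) (auto elim!: eventually_mono intro: mult_right_mono)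
  then have "tent_max (shifted i (U i)) F x \<le> M"
    by (intro tent_max_least) (simp add: dyadic_avg_const)
  moreover have "ennreal (c ^ i) \<le> 1"
    using c by (simp add: power_le_one)
  ultimately have "ennreal (c ^ i) * tent_max (shifted i (U i)) F x \<le> 1 * M"
    by (intro mult_mono) auto
  then show "ennreal (c ^ i) * tent_max (shifted i (U i)) F x \<le> M" by simp
qed

lemma tent_max_le_weighted_max:
  assumes c: "0 < c"
  shows "tent_max (shifted i (U i)) F x \<le> ennreal ((1 / c) ^ i) * weighted_max c U F x"
proof -
  have "tent_max (shifted i (U i)) F x = ennreal ((1 / c) ^ i) * (ennreal (c ^ i) * tent_max (shifted i (U i)) F x)"
    using c by (simp add: power_divide flip: mult.assoc ennreal_mult)
  also have "\<dots> \<le> ennreal ((1 / c) ^ i) * weighted_max c U F x"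
    unfolding weighted_max_def by (intro mult_left_mono SUP_upper) auto
  finally show ?thesis .
qed

end

section \<open>Coverings from the Minkowski dimension\<close>

text \<open>
  An interval of length \<open>2\<^sup>-\<^sup>k\<close> is covered by about \<open>1 / d\<close> pieces of length \<open>2\<^sup>-\<^sup>k d\<close>. In particular the
  minimum that defines the covering number is attained.
\<close>

lemma dyadic_part_finite_cover:
  assumes "0 < d"
  shows "\<exists>S. finite S \<and> card S \<le> nat \<lceil>1 / d\<rceil> + 1 \<and>
    dyadic_part E k \<subseteq> (\<Union>a\<in>S. {a..a + 2 powi (- k) * d})"
proof -
  define l where "l = (2::real) powi (- k)"
  have l: "0 < l" "(2::real) powi (- k + 1) = 2 * l" by (auto simp: l_def power_int_diff power_int_minus divide_inverse)
  \<comment> \<open>left end points of consecutive pieces, starting from \<open>l = 2\<^sup>-\<^sup>k\<close>\<close>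
  define S where "S = (\<lambda>j::nat. l + real j * (l * d)) ` {..nat \<lceil>1 / d\<rceil>}"
  have "finite S" "card S \<le> nat \<lceil>1 / d\<rceil> + 1"
    unfolding S_def using card_image_le[of "{..nat \<lceil>1 / d\<rceil>}"] by auto
  moreover have "dyadic_part E k \<subseteq> (\<Union>a\<in>S. {a..a + l * d})"
  proof
    fix t assume "t \<in> dyadic_part E k"
    then have t: "l \<le> t" "t \<le> 2 * l" using l by (auto simp: dyadic_part_def l_def)
    define j where "j = nat \<lfloor>(t - l) / (l * d)\<rfloor>"
    have pos: "0 < l * d" using l assms by simp
    have "0 \<le> (t - l) / (l * d)" using t pos by simp
    then have j: "real j \<le> (t - l) / (l * d)" "(t - l) / (l * d) \<le> real j + 1"
      unfolding j_def by linarith+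
    have "(t - l) / (l * d) \<le> 1 / d"
      using t l assms by (simp add: field_simps)
    then have "j \<le> nat \<lceil>1 / d\<rceil>"
      using j(1) by linarith
    moreover have "t \<in> {l + real j * (l * d)..l + real j * (l * d) + l * d}"
      using j pos by (simp add: field_simps)
    ultimately show "t \<in> (\<Union>a\<in>S. {a..a + l * d})" unfolding S_def by blast
  qed
  ultimately show ?thesis by (auto simp: l_def)
qed

lemma covering_number_attained:
  assumes "\<exists>S. finite S \<and> card S \<le> m \<and> T \<subseteq> (\<Union>a\<in>S. {a..a + d})"
  shows "\<exists>S. finite S \<and> card S = covering_number T d \<and> T \<subseteq> (\<Union>a\<in>S. {a..a + d})"
    and "covering_number T d \<le> m"
proof -
  obtain S where S: "finite S" "card S \<le> m" "T \<subseteq> (\<Union>a\<in>S. {a..a + d})" using assms by blast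
  then have ex: "\<exists>n S. finite S \<and> card S = n \<and> T \<subseteq> (\<Union>a\<in>S. {a..a + d})" by blast
  show "\<exists>S. finite S \<and> card S = covering_number T d \<and> T \<subseteq> (\<Union>a\<in>S. {a..a + d})"
    unfolding covering_number_def by (rule LeastI_ex[OF ex])
  have "covering_number T d \<le> card S"
    unfolding covering_number_def using S by (intro Least_le) blast
  then show "covering_number T d \<le> m" using S by simp
qed

abbreviation covers_level :: "real set \<Rightarrow> nat \<Rightarrow> int \<Rightarrow> real set \<Rightarrow> bool" where
  "covers_level E i k S \<equiv> dyadic_part E k \<subseteq> (\<Union>a\<in>S. {a..a + 2 powi (- k) * (1 / 4 ^ i)})"

text \<open>
  The dimension controls the covering numbers from some level \<open>i0\<close> on, uniformly in \<open>k\<close>. The finitely many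
  coarser levels are covered crudely.
\<close>

lemma upper_minkowski_dim_cover:
  assumes dim: "upper_minkowski_dim E = ereal \<beta>" and b: "\<beta> < b" "0 \<le> b"
  shows "\<exists>B. \<forall>i k. \<exists>S. finite S \<and> real (card S) \<le> B * (4 powr b) ^ i \<and>
    covers_level E i k S"
proof -
  let ?N = "\<lambda>k d. real (covering_number (dyadic_part E k) (2 powi (- k) * d))"
  have "Limsup (at_right 0) (\<lambda>\<delta>::real. SUP k::int.
       ereal (ln (1 + ?N k \<delta>) / ln (1 + inverse \<delta>))) < ereal b"
    using dim b by (simp add: upper_minkowski_dim_def)
  then have "\<forall>\<^sub>F \<delta> in at_right 0. (SUP k::int. ereal (ln (1 + ?N k \<delta>) / ln (1 + inverse \<delta>))) < ereal b"
    by (rule Limsup_lessD)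
  then obtain d0 where d0: "0 < d0" and
    small: "\<And>\<delta>. 0 < \<delta> \<Longrightarrow> \<delta> < d0 \<Longrightarrow> (SUP k::int. ereal (ln (1 + ?N k \<delta>) / ln (1 + inverse \<delta>))) < ereal b"
    unfolding eventually_at_right_field by blast
  obtain i0 :: nat where i0: "(1 / 4) ^ i0 < d0"
    using real_arch_pow_inv[of d0 "1 / 4"] d0 by auto
  have fin: "\<exists>S. finite S \<and> card S \<le> 4 ^ i + 1 \<and>
      covers_level E i k S" for i k
    using dyadic_part_finite_cover[of "1 / 4 ^ i" E k] by (simp add: nat_power_eq)
  define B where "B = 4 ^ i0 + 2 powr b + 1"
  have pw: "1 \<le> (4 powr b) ^ i" for i
    using b by (simp add: one_le_power ge_one_powr_ge_zero)
  have bound: "?N k (1 / 4 ^ i) \<le> B * (4 powr b) ^ i" for i k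
  proof (cases "i < i0")
    case True
    have "?N k (1 / 4 ^ i) \<le> real (4 ^ i + 1)"
      using covering_number_attained(2)[OF fin[of i k]] by (rule of_nat_mono)
    also have "\<dots> \<le> 4 ^ i0 + 1" using True by (simp add: power_increasing)
    also have "\<dots> \<le> B * 1" by (simp add: B_def)
    also have "\<dots> \<le> B * (4 powr b) ^ i" by (intro mult_left_mono pw) (simp add: B_def add_nonneg_nonneg)
    finally show ?thesis .
  next
    case False
    define \<delta> where "\<delta> = 1 / (4::real) ^ i"
    have "\<delta> \<le> (1 / 4) ^ i0"
      unfolding \<delta>_def power_one_over[symmetric] using False by (intro power_decreasing) auto
    then have d: "0 < \<delta>" "\<delta> < d0" using i0 by (auto simp: \<delta>_def)
    have "ereal (ln (1 + ?N k \<delta>) / ln (1 + inverse \<delta>))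
        \<le> (SUP k::int. ereal (ln (1 + ?N k \<delta>) / ln (1 + inverse \<delta>)))"
      by (rule SUP_upper) simp
    also note small[OF d]
    finally have "ereal (ln (1 + ?N k \<delta>) / ln (1 + inverse \<delta>)) < ereal b" .
    then have "ln (1 + ?N k \<delta>) \<le> b * ln (1 + inverse \<delta>)"
      using d by (simp add: divide_less_eq ln_gt_zero)
    moreover have "1 + inverse \<delta> \<noteq> 0" using d positive_imp_inverse_positive[of \<delta>] by linarith
    ultimately have "1 + ?N k \<delta> \<le> (1 + inverse \<delta>) powr b"
      using d by (subst ln_le_cancel_iff[symmetric]) (auto simp: ln_powr add_pos_pos)
    also have "\<dots> \<le> (2 * 4 ^ i) powr b"
      using b by (intro powr_mono2) (auto simp: \<delta>_def)
    also have "\<dots> = 2 powr b * (4 powr b) ^ i"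
      by (simp add: powr_mult powr_powr mult.commute flip: powr_realpow)
    also have "\<dots> \<le> B * (4 powr b) ^ i"
      by (intro mult_right_mono) (auto simp: B_def)
    finally show ?thesis by (simp add: \<delta>_def)
  qed
  show ?thesis
  proof (intro exI[of _ B] allI)
    fix i k
    obtain S where "finite S" "card S = covering_number (dyadic_part E k) (2 powi (- k) * (1 / 4 ^ i))"
        "covers_level E i k S"
      using covering_number_attained(1)[OF fin[of i k]] by blast
    then show "\<exists>S. finite S \<and> real (card S) \<le> B * (4 powr b) ^ i \<and>
        covers_level E i k S"
      using bound[of k i] by auto
  qed
qed

section \<open>The pointwise bound\<close>

lemma cos_ge_half: "0 \<le> \<phi> \<Longrightarrow> \<phi> \<le> 1 \<Longrightarrow> 1 / 2 \<le> cos (\<phi>::real)"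
  using cos_monotone_0_pi_le[of \<phi> "pi / 3"] pi_gt3 by (simp add: cos_60)

lemma sin_ge_half_arg:
  assumes "0 \<le> \<phi>" "\<phi> \<le> 1"
  shows "\<phi> / 2 \<le> sin (\<phi>::real)"
proof -
  have "sin 0 - 0 / 2 \<le> sin \<phi> - \<phi> / 2"
  proof (rule DERIV_nonneg_imp_nondecreasing[OF assms(1)])
    fix z :: real assume "0 \<le> z" "z \<le> \<phi>"
    then show "\<exists>y. ((\<lambda>z. sin z - z / 2) has_real_derivative y) (at z) \<and> 0 \<le> y"
      using cos_ge_half[of z] assms
      by (intro exI[of _ "cos z - 1 / 2"]) (auto intro!: derivative_eq_intros)
  qed
  then show ?thesis by simp
qed

lemma one_minus_cos_le: "1 - cos (\<phi>::real) \<le> \<phi>\<^sup>2 / 2"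
proof -
  have "1 - cos \<phi> = 2 * \<bar>sin (\<phi> / 2)\<bar>\<^sup>2"
    using cos_double_sin[of "\<phi> / 2"] by simp
  also have "\<dots> \<le> 2 * \<bar>\<phi> / 2\<bar>\<^sup>2"
    by (intro mult_left_mono power_mono abs_sin_x_le_abs_x) auto
  finally show ?thesis by (simp add: power_divide)
qed

text \<open>
  Substitution along an arc on which the coordinate has speed at least \<open>m \<bar>A\<bar>\<close> and stays in a window
  around \<open>y\<close>.
\<close>

lemma nn_integral_arc_le_window:
  fixes g g' :: "real \<Rightarrow> real" and x y \<rho> A m a b :: real
  assumes [measurable]: "F \<in> borel_measurable borel" and ab: "a < b" and A: "A \<noteq> 0" and m: "0 < m"
    and g: "\<And>\<phi>. (g has_real_derivative g' \<phi>) (at \<phi>)" and g': "continuous_on UNIV g'"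
    and m_le: "\<And>\<phi>. \<phi> \<in> {a..b} \<Longrightarrow> m \<le> g' \<phi>"
    and window: "\<And>\<phi>. \<phi> \<in> {a..b} \<Longrightarrow> \<bar>y - (x + A * g \<phi>)\<bar> \<le> \<rho>"
  shows "(\<integral>\<^sup>+ \<phi>. F (x + A * g \<phi>) * indicator {a..b} \<phi> \<partial>lborel)
    \<le> ennreal (1 / (m * \<bar>A\<bar>)) * (\<integral>\<^sup>+ z. F z * indicator {z. \<bar>y - z\<bar> \<le> \<rho>} z \<partial>lborel)"
proof -
  define G where "G z = F z * indicator {z. \<bar>y - z\<bar> \<le> \<rho>} z" for z
  have [measurable]: "G \<in> borel_measurable borel" unfolding G_def by measurable
  have "continuous_on UNIV g"
    using g by (intro continuous_at_imp_continuous_on ballI DERIV_isCont)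
  then have [measurable]: "g \<in> borel_measurable borel" "g' \<in> borel_measurable borel"
    using g' by (auto intro: borel_measurable_continuous_onI)
  have "(\<integral>\<^sup>+ \<phi>. F (x + A * g \<phi>) * indicator {a..b} \<phi> \<partial>lborel)
    \<le> (\<integral>\<^sup>+ \<phi>. ennreal (1 / m) * (G (x + A * g \<phi>) * ennreal (g' \<phi>) * indicator {a..b} \<phi>) \<partial>lborel)"
  proof (intro nn_integral_mono)
    fix \<phi> :: real
    show "F (x + A * g \<phi>) * indicator {a..b} \<phi>
      \<le> ennreal (1 / m) * (G (x + A * g \<phi>) * ennreal (g' \<phi>) * indicator {a..b} \<phi>)"
    proof (cases "\<phi> \<in> {a..b}")
      case True
      have "1 \<le> 1 / m * g' \<phi>" using m_le[OF True] m by (simp add: field_simps)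
      then have "1 \<le> ennreal (1 / m) * ennreal (g' \<phi>)" using m by (simp flip: ennreal_mult')
      then have "G (x + A * g \<phi>) * 1 \<le> G (x + A * g \<phi>) * (ennreal (1 / m) * ennreal (g' \<phi>))"
        by (intro mult_left_mono) auto
      then show ?thesis using True window[OF True] by (simp add: G_def ac_simps)
    qed simp
  qed
  also have "\<dots> = ennreal (1 / m) *
      (\<integral>\<^sup>+ \<phi>. G (x + A * g \<phi>) * ennreal (g' \<phi>) * indicator {a..b} \<phi> \<partial>lborel)"
    by (rule nn_integral_cmult) measurable
  also have "(\<integral>\<^sup>+ \<phi>. G (x + A * g \<phi>) * ennreal (g' \<phi>) * indicator {a..b} \<phi> \<partial>lborel)
    = (\<integral>\<^sup>+ u. G (x + A * u) * indicator {g a..g b} u \<partial>lborel)"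
    using m_le m g' by (intro nn_integral_substitution_aux[symmetric, OF _ _ g _ _ ab])
      (auto intro: continuous_on_subset less_imp_le[OF less_le_trans])
  also have "\<dots> \<le> (\<integral>\<^sup>+ u. G (x + A * u) \<partial>lborel)"
    by (intro nn_integral_mono) (auto simp: indicator_def)
  also have "\<dots> = ennreal (1 / \<bar>A\<bar>) * (\<integral>\<^sup>+ z. G z \<partial>lborel)"
    using A nn_integral_real_affine[of G A x] by (simp flip: mult.assoc ennreal_mult)
  finally have "(\<integral>\<^sup>+ \<phi>. F (x + A * g \<phi>) * indicator {a..b} \<phi> \<partial>lborel)
    \<le> ennreal (1 / m) * (ennreal (1 / \<bar>A\<bar>) * (\<integral>\<^sup>+ z. G z \<partial>lborel))"
    by (simp add: mult_left_mono)
  also have "\<dots> = ennreal (1 / (m * \<bar>A\<bar>)) * (\<integral>\<^sup>+ z. G z \<partial>lborel)"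
    using m A by (simp flip: mult.assoc ennreal_mult)
  finally show ?thesis by (simp add: G_def)
qed

text \<open>
  On \<open>[\<delta>/2, \<delta>]\<close> the derivative \<open>sin \<phi>\<close> of \<open>- cos \<phi>\<close> is at least \<open>\<delta>/4\<close>, so the substitution costs
  \<open>4 / (\<delta> t)\<close>; and \<open>cos \<phi>\<close> differs from \<open>1\<close> by at most \<open>\<delta>\<^sup>2/2\<close>, which gives the length of the window.
\<close>

lemma nn_integral_cos_arc_le:
  fixes s t x \<rho> \<delta> :: real
  assumes F: "F \<in> borel_measurable borel" and s: "s = 1 \<or> s = -1"
    and t: "0 < t" and d: "0 < \<delta>" "\<delta> \<le> 1" and \<rho>: "t * \<delta>\<^sup>2 / 2 \<le> \<rho>"
  shows "(\<integral>\<^sup>+ \<phi>. F (x - s * t * cos \<phi>) * indicator {\<delta> / 2..\<delta>} \<phi> \<partial>lborel)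
    \<le> ennreal (4 / (\<delta> * t)) * (\<integral>\<^sup>+ z. F z * indicator {z. \<bar>(x - s * t) - z\<bar> \<le> \<rho>} z \<partial>lborel)"
proof -
  have window: "\<bar>(x - s * t) - (x + s * t * - cos \<phi>)\<bar> \<le> \<rho>" if "\<phi> \<in> {\<delta> / 2..\<delta>}" for \<phi>
  proof -
    have "\<phi>\<^sup>2 \<le> \<delta>\<^sup>2" using that d by (intro power_mono) auto
    then have "t * (1 - cos \<phi>) \<le> t * (\<delta>\<^sup>2 / 2)"
      using one_minus_cos_le[of \<phi>] t by (intro mult_left_mono) linarith+
    then have "t * (1 - cos \<phi>) \<le> \<rho>" using \<rho> by simp
    then have "\<bar>s * t * (1 - cos \<phi>)\<bar> \<le> \<rho>"
      using s t cos_le_one[of \<phi>] by (auto simp: abs_mult)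
    moreover have "(x - s * t) - (x + s * t * - cos \<phi>) = - (s * t * (1 - cos \<phi>))"
      by (simp add: algebra_simps)
    ultimately show ?thesis by simp
  qed
  have "\<delta> / 4 \<le> sin \<phi>" if "\<phi> \<in> {\<delta> / 2..\<delta>}" for \<phi>
    using sin_ge_half_arg[of \<phi>] that d by auto
  then have "(\<integral>\<^sup>+ \<phi>. F (x + s * t * - cos \<phi>) * indicator {\<delta> / 2..\<delta>} \<phi> \<partial>lborel)
    \<le> ennreal (1 / (\<delta> / 4 * \<bar>s * t\<bar>)) * (\<integral>\<^sup>+ z. F z * indicator {z. \<bar>(x - s * t) - z\<bar> \<le> \<rho>} z \<partial>lborel)"
    using s t d window by (intro nn_integral_arc_le_window[OF F, where g' = sin])
      (auto intro!: derivative_eq_intros continuous_intros)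
  moreover have "\<bar>s * t\<bar> = t" using s t by auto
  ultimately show ?thesis by simp
qed

text \<open>
  Here the derivative \<open>cos \<phi>\<close> is at least \<open>1/2\<close>, and a window of half-length \<open>\<delta> t\<close> suffices.
\<close>

lemma nn_integral_sin_arc_le:
  fixes s t x \<rho> \<delta> :: real
  assumes F: "F \<in> borel_measurable borel" and s: "s = 1 \<or> s = -1"
    and t: "0 < t" and d: "0 < \<delta>" "\<delta> \<le> 1" and \<rho>: "t * \<delta> \<le> \<rho>"
  shows "(\<integral>\<^sup>+ \<phi>. F (x - s * t * sin \<phi>) * indicator {\<delta> / 2..\<delta>} \<phi> \<partial>lborel)
    \<le> ennreal (2 / t) * (\<integral>\<^sup>+ z. F z * indicator {z. \<bar>x - z\<bar> \<le> \<rho>} z \<partial>lborel)"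
proof -
  have st: "\<bar>- s * t\<bar> = t" using s t by auto
  have window: "\<bar>x - (x + - s * t * sin \<phi>)\<bar> \<le> \<rho>" if "\<phi> \<in> {\<delta> / 2..\<delta>}" for \<phi>
  proof -
    have "t * \<bar>sin \<phi>\<bar> \<le> t * \<delta>"
      using abs_sin_x_le_abs_x[of \<phi>] that d t by (intro mult_left_mono) auto
    then have "t * \<bar>sin \<phi>\<bar> \<le> \<rho>" using \<rho> by linarith
    then show ?thesis using s t by (auto simp: abs_mult)
  qed
  have "1 / 2 \<le> cos \<phi>" if "\<phi> \<in> {\<delta> / 2..\<delta>}" for \<phi>
    using cos_ge_half[of \<phi>] that d by auto
  then have "(\<integral>\<^sup>+ \<phi>. F (x + - s * t * sin \<phi>) * indicator {\<delta> / 2..\<delta>} \<phi> \<partial>lborel)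
    \<le> ennreal (1 / (1 / 2 * \<bar>- s * t\<bar>)) * (\<integral>\<^sup>+ z. F z * indicator {z. \<bar>x - z\<bar> \<le> \<rho>} z \<partial>lborel)"
    using s t d window by (intro nn_integral_arc_le_window[OF F, where g' = cos])
      (auto intro!: derivative_eq_intros continuous_intros)
  then show ?thesis unfolding st by simp
qed

text \<open>
  Three consecutive dyadic intervals cover the window, and the left end points of all three are within
  two lengths of its centre \<open>y\<close>.
\<close>

lemma nn_integral_window_le:
  assumes [measurable]: "F \<in> borel_measurable borel"
    and M: "\<And>n. \<bar>y - of_int n * 2 powi (- k)\<bar> \<le> 2 * 2 powi (- k) \<Longrightarrow> dyadic_avg k n F \<le> M"
  shows "(\<integral>\<^sup>+ z. F z * indicator {z. \<bar>y - z\<bar> \<le> 2 powi (- k)} z \<partial>lborel) \<le> ennreal (3 * 2 powi (- k)) * M"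
proof -
  define l where "l = (2::real) powi (- k)"
  have l: "0 < l" by (simp add: l_def)
  \<comment> \<open>the index of the dyadic interval that contains \<open>y\<close>\<close>
  define m where "m = \<lfloor>y / l\<rfloor>"
  have "of_int m \<le> y / l" "y / l < of_int m + 1" unfolding m_def by linarith+
  then have m: "of_int m * l \<le> y" "y < of_int m * l + l"
    using l by (simp_all add: field_simps)
  let ?D = "\<lambda>n. \<integral>\<^sup>+ z. F z * indicator (dyadic k n) z \<partial>lborel"
  have D: "?D n \<le> ennreal l * M" if "\<bar>y - of_int n * l\<bar> \<le> 2 * l" for n
  proof -
    have "?D n = ennreal l * dyadic_avg k n F"
      by (simp add: dyadic_avg_def l_def power_int_minus flip: mult.assoc ennreal_mult)
    then show ?thesis using M[of n] that by (simp add: l_def mult_left_mono)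
  qed
  have "(\<integral>\<^sup>+ z. F z * indicator {z. \<bar>y - z\<bar> \<le> l} z \<partial>lborel)
    \<le> (\<integral>\<^sup>+ z. F z * indicator (dyadic k (m - 1)) z + (F z * indicator (dyadic k m) z
         + F z * indicator (dyadic k (m + 1)) z) \<partial>lborel)"
  proof (intro nn_integral_mono)
    fix z
    have "z \<in> dyadic k (m - 1) \<or> z \<in> dyadic k m \<or> z \<in> dyadic k (m + 1)" if "\<bar>y - z\<bar> \<le> l"
      using that m unfolding dyadic_eq_interval l_def[symmetric] by (auto simp: algebra_simps)
    then show "F z * indicator {z. \<bar>y - z\<bar> \<le> l} z \<le> F z * indicator (dyadic k (m - 1)) z +
        (F z * indicator (dyadic k m) z + F z * indicator (dyadic k (m + 1)) z)"
      by (auto simp: indicator_def)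
  qed
  also have "\<dots> = ?D (m - 1) + (?D m + ?D (m + 1))"
    by (simp add: nn_integral_add)
  also have "\<dots> \<le> ennreal l * M + (ennreal l * M + ennreal l * M)"
    using m l by (intro add_mono D) (auto simp: algebra_simps abs_le_iff)
  also have "\<dots> = ennreal (3 * l) * M"
  proof -
    have "ennreal (3 * l) = ennreal l + (ennreal l + ennreal l)"
      using l by (simp flip: ennreal_plus)
    then show ?thesis by (simp add: distrib_right)
  qed
  finally show ?thesis by (simp add: l_def)
qed

text \<open>
  Dyadic intervals of length \<open>4\<^sup>-\<^sup>i 2\<^sup>-\<^sup>k\<close> have scale \<open>k + 2i\<close>; at that scale the shifts must reach every
  dilation of size about \<open>2\<^sup>-\<^sup>k\<close>, on either side of \<open>x\<close>.
\<close>

locale dilation_shifts = shift_system +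
  fixes E :: "real set"
  assumes covers: "t \<in> dyadic_part E k \<Longrightarrow> s = 1 \<or> s = -1 \<Longrightarrow>
      \<exists>a\<in>U i (k + 2 * int i). \<bar>s * t - a\<bar> \<le> 2 powi (- (k + 2 * int i))"
begin

text \<open>
  The window around \<open>x - s t\<close> has half-length \<open>l = 4\<^sup>-\<^sup>i 2\<^sup>-\<^sup>k\<close>. Some shift \<open>a\<close> differs from \<open>s t\<close> by at
  most \<open>l\<close>, which turns the factor \<open>2\<close> of the window estimate into the \<open>3\<close> in \<open>shifted\<close>. The substitution
  cost \<open>1 / (\<delta> t)\<close> times the length \<open>l\<close> is comparable to \<open>\<delta>\<close>, the length of the arc.
\<close>

lemma cos_arc_le_tent_max:
  assumes F [measurable]: "F \<in> borel_measurable borel" and s: "s = 1 \<or> s = -1" and t: "t \<in> dyadic_part E k"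
  shows "(\<integral>\<^sup>+ \<phi>. F (x - s * t * cos \<phi>) * indicator {(1/2)^i / 2..(1/2)^i} \<phi> \<partial>lborel)
    \<le> ennreal (12 * (1/2)^i) * tent_max (shifted i (U i)) F x"
proof -
  define \<delta> where "\<delta> = (1 / 2 :: real) ^ i"
  define \<kappa> where "\<kappa> = k + 2 * int i"
  define l where "l = (2::real) powi (- \<kappa>)"
  define h where "h = (2::real) powi (- k)"
  have h: "0 < h" and d: "0 < \<delta>" "\<delta> \<le> 1" by (auto simp: h_def \<delta>_def power_le_one)
  have l: "l = h * \<delta>\<^sup>2"
  proof -
    have "(2::real) powi (2 * int i) = (2 ^ i)\<^sup>2"
      by (metis of_nat_mult of_nat_numeral power_int_of_nat power_mult mult.commute)
    moreover have "l = h / 2 powi (2 * int i)"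
      by (simp add: l_def h_def \<kappa>_def power_int_diff)
    ultimately show ?thesis by (simp add: \<delta>_def power_one_over)
  qed
  have "(2::real) powi (- k + 1) = 2 * h" by (simp add: h_def power_int_diff power_int_minus divide_inverse)
  then have tb: "h \<le> t" "t \<le> 2 * h" using t by (auto simp: dyadic_part_def h_def)
  have l0: "0 < l" by (simp add: l_def)
  have hl: "h = 4 ^ i * l"
  proof -
    have "4 ^ i * \<delta>\<^sup>2 = 1"
      by (simp add: \<delta>_def power_one_over power2_eq_square flip: power_mult_distrib)
    then show ?thesis by (simp add: l)
  qed
  have "(\<integral>\<^sup>+ \<phi>. F (x - s * t * cos \<phi>) * indicator {\<delta> / 2..\<delta>} \<phi> \<partial>lborel)
    \<le> ennreal (4 / (\<delta> * t)) * (\<integral>\<^sup>+ z. F z * indicator {z. \<bar>(x - s * t) - z\<bar> \<le> l} z \<partial>lborel)"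
  proof (rule nn_integral_cos_arc_le[OF F s])
    have "t * \<delta>\<^sup>2 \<le> 2 * h * \<delta>\<^sup>2" using tb by (intro mult_right_mono) auto
    then show "t * \<delta>\<^sup>2 / 2 \<le> l" by (simp add: l)
  qed (use tb h d in auto)
  also have "\<dots> \<le> ennreal (4 / (\<delta> * t)) * (ennreal (3 * l) * tent_max (shifted i (U i)) F x)"
    unfolding l_def
  proof (intro mult_left_mono nn_integral_window_le[OF F] tent_max_upper)
    fix n assume n: "\<bar>x - s * t - of_int n * 2 powi (- \<kappa>)\<bar> \<le> 2 * 2 powi (- \<kappa>)"
    obtain a where a: "a \<in> U i \<kappa>" "\<bar>s * t - a\<bar> \<le> l"
      using covers[OF t s, of i] by (auto simp: \<kappa>_def l_def)
    have st: "\<bar>s * t\<bar> \<le> 2 * (4 ^ i * l)" using s tb h by (auto simp: hl)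
    have "1 * l \<le> 4 ^ i * l" using l0 by (intro mult_right_mono) auto
    then have "\<bar>x - of_int n * l\<bar> \<le> 4 * (4 ^ i * l)"
      using n st unfolding l_def[symmetric] by linarith
    moreover have "\<bar>x - a - of_int n * l\<bar> \<le> 3 * l"
      using n a(2) unfolding l_def[symmetric] by linarith
    ultimately show "x \<in> shifted i (U i) \<kappa> n"
      unfolding shifted_def l_def[symmetric] using a(1) by (auto simp: mult.assoc)
  qed auto
  also have "\<dots> = ennreal (12 * l / (\<delta> * t)) * tent_max (shifted i (U i)) F x"
    using d h tb l0 by (simp flip: mult.assoc ennreal_mult)
  also have "\<dots> \<le> ennreal (12 * \<delta>) * tent_max (shifted i (U i)) F x"
  proof (intro mult_right_mono ennreal_leI)
    have "12 * l \<le> 12 * \<delta> * (\<delta> * t)"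
      using tb d by (simp add: l power2_eq_square)
    then show "12 * l / (\<delta> * t) \<le> 12 * \<delta>"
      using d h tb by (simp add: divide_le_eq)
  qed auto
  finally show ?thesis by (simp add: \<delta>_def)
qed

text \<open>
  The window is centred at \<open>x\<close>, so that the shift \<open>0\<close> of level \<open>0\<close> suffices. Its half-length is
  \<open>2 \<cdot> 2\<^sup>-\<^sup>i 2\<^sup>-\<^sup>k\<close>, which is the scale \<open>k + i - 1\<close>.
\<close>

lemma sin_arc_le_tent_max:
  assumes F [measurable]: "F \<in> borel_measurable borel" and s: "s = 1 \<or> s = -1" and t: "t \<in> dyadic_part E k"
  shows "(\<integral>\<^sup>+ \<phi>. F (x - s * t * sin \<phi>) * indicator {(1/2)^i / 2..(1/2)^i} \<phi> \<partial>lborel)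
    \<le> ennreal (12 * (1/2)^i) * tent_max (shifted 0 (U 0)) F x"
proof -
  define \<delta> where "\<delta> = (1 / 2 :: real) ^ i"
  define \<kappa> where "\<kappa> = k + int i - 1"
  define l where "l = (2::real) powi (- \<kappa>)"
  define h where "h = (2::real) powi (- k)"
  have h: "0 < h" and d: "0 < \<delta>" "\<delta> \<le> 1" by (auto simp: h_def \<delta>_def power_le_one)
  have h2: "(2::real) powi (- k + 1) = 2 * h"
    by (simp add: h_def power_int_diff power_int_minus divide_inverse)
  have "- \<kappa> = (- k + 1) - int i" by (simp add: \<kappa>_def)
  then have "l = 2 powi (- k + 1) / 2 powi (int i)"
    unfolding l_def by (subst power_int_diff[symmetric]) simp_all
  then have l: "l = 2 * h * \<delta>"
    unfolding h2 by (simp add: \<delta>_def power_one_over)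
  from h2 have tb: "h \<le> t" "t \<le> 2 * h" using t by (auto simp: dyadic_part_def h_def)
  have l0: "0 < l" by (simp add: l_def)
  have "(\<integral>\<^sup>+ \<phi>. F (x - s * t * sin \<phi>) * indicator {\<delta> / 2..\<delta>} \<phi> \<partial>lborel)
    \<le> ennreal (2 / t) * (\<integral>\<^sup>+ z. F z * indicator {z. \<bar>x - z\<bar> \<le> l} z \<partial>lborel)"
    by (rule nn_integral_sin_arc_le[OF F s]) (use tb h d in \<open>auto simp: l\<close>)
  also have "\<dots> \<le> ennreal (2 / t) * (ennreal (3 * l) * tent_max (shifted 0 (U 0)) F x)"
    unfolding l_def
  proof (intro mult_left_mono nn_integral_window_le[OF F] tent_max_upper)
    fix n assume n: "\<bar>x - of_int n * 2 powi (- \<kappa>)\<bar> \<le> 2 * 2 powi (- \<kappa>)"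
    show "x \<in> shifted 0 (U 0) \<kappa> n"
      using n l0 unfolding shifted_def l_def[symmetric]
      by (intro CollectI conjI bexI[OF _ zero_shift[of 0 \<kappa>]]) auto
  qed auto
  also have "\<dots> = ennreal (6 * l / t) * tent_max (shifted 0 (U 0)) F x"
    using d h tb l0 by (simp flip: mult.assoc ennreal_mult)
  also have "\<dots> \<le> ennreal (12 * \<delta>) * tent_max (shifted 0 (U 0)) F x"
  proof (intro mult_right_mono ennreal_leI)
    show "6 * l / t \<le> 12 * \<delta>"
      using d h tb by (simp add: divide_le_eq l)
  qed auto
  finally show ?thesis by (simp add: \<delta>_def)
qed

text \<open>
  The arc \<open>\<phi> \<approx> 2\<^sup>-\<^sup>i\<close> contributes \<open>2\<^sup>-\<^sup>i\<close> from its length and \<open>c\<^bsup>-iw\<^esup>\<close> from replacing level \<open>i\<close> by the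
  weighted supremum over all levels; the condition on \<open>c\<close> makes the resulting geometric series converge.
\<close>

lemma half_arc_bound:
  fixes w c c' :: real
  assumes X [measurable]: "X \<in> borel_measurable borel" and Y [measurable]: "Y \<in> borel_measurable borel"
    and w: "0 < w" "w < 1" and c: "0 < c" "c powr (- w) < 2" and c': "0 < c'"
    and s: "s = 1 \<or> s = -1" "s' = 1 \<or> s' = -1" and t: "t \<in> dyadic_part E k"
  shows "(\<integral>\<^sup>+ \<phi>. ennreal_powr (X (x - s * t * cos \<phi>)) w * ennreal_powr (Y (x - s' * t * sin \<phi>)) (1 - w)
        * indicator {0<..1} \<phi> \<partial>lborel)
    \<le> ennreal (24 / (2 - c powr (- w))) *
       (ennreal_powr (weighted_max c U X x) w * ennreal_powr (weighted_max c' U Y x) (1 - w))"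
proof -
  let ?f = "\<lambda>\<phi>. ennreal_powr (X (x - s * t * cos \<phi>)) w * ennreal_powr (Y (x - s' * t * sin \<phi>)) (1 - w)"
  let ?I = "\<lambda>i::nat. {(1/2)^i / 2..(1/2::real)^i}"
  let ?P = "ennreal_powr (weighted_max c U X x) w * ennreal_powr (weighted_max c' U Y x) (1 - w)"
  define \<rho> where "\<rho> = c powr (- w) / 2"
  have \<rho>: "0 < \<rho>" "\<rho> < 1" using c by (auto simp: \<rho>_def)
  have piece: "(\<integral>\<^sup>+ \<phi>. ?f \<phi> * indicator (?I i) \<phi> \<partial>lborel) \<le> ennreal (12 * \<rho> ^ i) * ?P" for i
  proof -
    define d where "d = (1 / 2 :: real) ^ i"
    have d: "0 < d" by (simp add: d_def)
    have "(\<integral>\<^sup>+ \<phi>. ?f \<phi> * indicator (?I i) \<phi> \<partial>lborel)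
      = (\<integral>\<^sup>+ \<phi>. ennreal_powr (X (x - s * t * cos \<phi>) * indicator (?I i) \<phi>) w *
           ennreal_powr (Y (x - s' * t * sin \<phi>) * indicator (?I i) \<phi>) (1 - w) \<partial>lborel)"
      by (intro nn_integral_cong) (auto simp: indicator_def)
    also have "\<dots> \<le> ennreal_powr (\<integral>\<^sup>+ \<phi>. X (x - s * t * cos \<phi>) * indicator (?I i) \<phi> \<partial>lborel) w *
       ennreal_powr (\<integral>\<^sup>+ \<phi>. Y (x - s' * t * sin \<phi>) * indicator (?I i) \<phi> \<partial>lborel) (1 - w)"
      by (intro Holder_ennreal w) measurable
    also have "\<dots> \<le> ennreal_powr (ennreal (12 * d) * tent_max (shifted i (U i)) X x) w *
       ennreal_powr (ennreal (12 * d) * tent_max (shifted 0 (U 0)) Y x) (1 - w)"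
      unfolding d_def using w
      by (intro mult_mono ennreal_powr_mono cos_arc_le_tent_max[OF X s(1) t]
            sin_arc_le_tent_max[OF Y s(2) t]) auto
    also have "\<dots> \<le> ennreal_powr (ennreal (12 * d) * (ennreal ((1 / c) ^ i) * weighted_max c U X x)) w *
       ennreal_powr (ennreal (12 * d) * (ennreal ((1 / c') ^ 0) * weighted_max c' U Y x)) (1 - w)"
      using w c c' by (intro mult_mono ennreal_powr_mono tent_max_le_weighted_max) auto
    also have "\<dots> = (ennreal_powr (ennreal (12 * d)) w * ennreal_powr (ennreal (12 * d)) (1 - w) *
        ennreal_powr (ennreal ((1 / c) ^ i)) w) * ?P"
      by (simp add: ennreal_powr_mult ac_simps)
    also have "ennreal_powr (ennreal (12 * d)) w * ennreal_powr (ennreal (12 * d)) (1 - w) = ennreal (12 * d)"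
      using ennreal_powr_add[of w "1 - w" "ennreal (12 * d)"] w by simp
    also have "ennreal_powr (ennreal ((1 / c) ^ i)) w = ennreal ((c powr (- w)) ^ i)"
      using c by (simp add: ennreal_powr_ennreal power_powr_eq powr_divide powr_minus_divide)
    also have "ennreal (12 * d) * ennreal ((c powr (- w)) ^ i) = ennreal (12 * \<rho> ^ i)"
      using d by (subst ennreal_mult[symmetric]) (auto simp: d_def \<rho>_def power_divide power_one_over field_simps)
    finally show ?thesis .
  qed
  have "(\<integral>\<^sup>+ \<phi>. ?f \<phi> * indicator {0<..1} \<phi> \<partial>lborel) \<le> (\<integral>\<^sup>+ \<phi>. (\<Sum>i. ?f \<phi> * indicator (?I i) \<phi>) \<partial>lborel)"
  proof (intro nn_integral_mono)
    fix \<phi> :: real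
    show "?f \<phi> * indicator {0<..1} \<phi> \<le> (\<Sum>i. ?f \<phi> * indicator (?I i) \<phi>)"
    proof (cases "\<phi> \<in> {0<..1}")
      case True
      \<comment> \<open>the index of the dyadic arc that contains \<open>\<phi>\<close>\<close>
      define i where "i = (LEAST i. (1/2) ^ Suc i < \<phi>)"
      have ex: "\<exists>i. (1/2) ^ Suc i < \<phi>"
      proof -
        obtain n where "(1/2) ^ n < \<phi>" using real_arch_pow_inv[of \<phi> "1/2"] True by auto
        moreover have "(1/2::real) ^ Suc n \<le> (1/2) ^ n" by simp
        ultimately show ?thesis by (intro exI[of _ n]) linarith
      qed
      have "(1/2) ^ Suc i < \<phi>" unfolding i_def by (rule LeastI_ex[OF ex])
      moreover have "\<phi> \<le> (1/2) ^ i"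
      proof (cases i)
        case (Suc j)
        have "\<not> (1/2) ^ Suc j < \<phi>" using not_less_Least[of j "\<lambda>i. (1/2) ^ Suc i < \<phi>"] Suc
          by (simp add: i_def)
        then show ?thesis using Suc by simp
      qed (use True in auto)
      ultimately have "\<phi> \<in> ?I i" by simp
      then have "?f \<phi> * indicator {0<..1} \<phi> = ?f \<phi> * indicator (?I i) \<phi>" using True by simp
      also have "\<dots> \<le> (\<Sum>i. ?f \<phi> * indicator (?I i) \<phi>)"
        by (rule term_le_suminf_ennreal)
      finally show ?thesis .
    qed simp
  qed
  also have "\<dots> = (\<Sum>i. \<integral>\<^sup>+ \<phi>. ?f \<phi> * indicator (?I i) \<phi> \<partial>lborel)"
    by (intro nn_integral_suminf) measurable
  also have "\<dots> \<le> (\<Sum>i. ennreal (12 * \<rho> ^ i) * ?P)"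
    by (intro suminf_le piece) auto
  also have "\<dots> = ennreal (\<Sum>i. 12 * \<rho> ^ i) * ?P"
    using \<rho> by (simp add: ennreal_suminf_multc suminf_ennreal2 summable_mult summable_geometric)
  also have "(\<Sum>i. 12 * \<rho> ^ i) = 12 * (1 / (1 - \<rho>))"
    using \<rho> by (simp add: suminf_mult summable_geometric suminf_geometric)
  also have "12 * (1 / (1 - \<rho>)) = 24 / (2 - c powr (- w))"
    using c by (simp add: \<rho>_def field_simps)
  finally show ?thesis .
qed

end

lemma measurable_fst_snd_borel [measurable]:
  "(fst :: real \<times> real \<Rightarrow> real) \<in> borel_measurable borel"
  "(snd :: real \<times> real \<Rightarrow> real) \<in> borel_measurable borel"
  by (intro borel_measurable_continuous_onI continuous_intros)+

lemma nn_integral_circle_measure: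
  assumes [measurable]: "H \<in> borel_measurable borel"
  shows "(\<integral>\<^sup>+ y. H y \<partial>circle_measure)
    = ennreal (1 / (2 * pi)) * (\<integral>\<^sup>+ \<theta>. H (cos \<theta>, sin \<theta>) * indicator {0..2 * pi} \<theta> \<partial>lborel)"
proof -
  have [measurable]: "(\<lambda>\<theta>::real. (cos \<theta>, sin \<theta>)) \<in> borel_measurable borel"
    by (intro borel_measurable_continuous_onI continuous_intros)
  have "(\<integral>\<^sup>+ y. H y \<partial>circle_measure)
     = (\<integral>\<^sup>+ \<theta>. H (cos \<theta>, sin \<theta>) \<partial>uniform_measure lborel {0..2 * pi})"
    unfolding circle_measure_def by (subst nn_integral_completion) (simp add: nn_integral_distr)
  also have "\<dots> = (\<integral>\<^sup>+ \<theta>. H (cos \<theta>, sin \<theta>) * indicator {0..2 * pi} \<theta> \<partial>lborel) / ennreal (2 * pi)"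
    by (subst nn_integral_uniform_measure) auto
  also have "\<dots> = ennreal (1 / (2 * pi)) * (\<integral>\<^sup>+ \<theta>. H (cos \<theta>, sin \<theta>) * indicator {0..2 * pi} \<theta> \<partial>lborel)"
    unfolding divide_ennreal_def by (subst inverse_ennreal) (simp_all add: mult.commute inverse_eq_divide)
  finally show ?thesis .
qed

lemma quarter_turn:
  assumes "j < (5::nat)"
  shows "\<exists>\<sigma>. (\<sigma> = 1 \<or> \<sigma> = -1) \<and>
    ((\<forall>\<phi>. cos (real j * (pi / 2) + \<phi>) = \<sigma> * cos \<phi> \<and> sin (real j * (pi / 2) + \<phi>) = \<sigma> * sin \<phi>) \<or>
     (\<forall>\<phi>. cos (real j * (pi / 2) + \<phi>) = - \<sigma> * sin \<phi> \<and> sin (real j * (pi / 2) + \<phi>) = \<sigma> * cos \<phi>))"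
proof -
  have "j = 0 \<or> j = 1 \<or> j = 2 \<or> j = 3 \<or> j = 4" using assms by auto
  moreover have "cos (3 * (pi / 2)) = 0" "sin (3 * (pi / 2)) = -1"
    using cos_3over2_pi sin_3over2_pi by (simp_all add: ac_simps)
  moreover have "cos (4 * (pi / 2)) = 1" "sin (4 * (pi / 2)) = 0"
    using cos_two_pi sin_two_pi by (simp_all add: ac_simps)
  ultimately show ?thesis
    by (elim disjE) (auto simp: cos_add sin_add intro: exI[of _ 1] exI[of _ "-1"])
qed

text \<open>
  Arcs of half-length \<open>1 > \<pi>/4\<close> around the multiples of \<open>\<pi>/2\<close> cover the circle. Their overlaps do no harm
  in an upper bound.
\<close>

lemma nn_integral_circle_le_arcs:
  assumes [measurable]: "h \<in> borel_measurable borel"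
  shows "(\<integral>\<^sup>+ \<theta>. h \<theta> * indicator {0..2 * pi} \<theta> \<partial>lborel)
    \<le> (\<Sum>j<5::nat. \<integral>\<^sup>+ \<phi>. h (real j * (pi / 2) + \<phi>) * indicator {-1..1} \<phi> \<partial>lborel)"
proof -
  have "(\<integral>\<^sup>+ \<theta>. h \<theta> * indicator {0..2 * pi} \<theta> \<partial>lborel)
    \<le> (\<integral>\<^sup>+ \<theta>. (\<Sum>j<5::nat. h \<theta> * indicator {-1..1} (\<theta> - real j * (pi / 2))) \<partial>lborel)"
  proof (intro nn_integral_mono)
    fix \<theta> :: real
    show "h \<theta> * indicator {0..2 * pi} \<theta> \<le> (\<Sum>j<5::nat. h \<theta> * indicator {-1..1} (\<theta> - real j * (pi / 2)))"
    proof (cases "\<theta> \<in> {0..2 * pi}")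
      case True
      \<comment> \<open>\<open>j\<close> is the multiple of \<open>\<pi>/2\<close> closest to \<open>\<theta>\<close>; it ranges up to \<open>4\<close> because \<open>\<theta> = 2 \<pi>\<close> is included\<close>
      define r where "r = \<theta> / (pi / 2) + 1 / 2"
      define j where "j = nat \<lfloor>r\<rfloor>"
      have r: "0 \<le> r" "r \<le> 4 + 1 / 2" using True by (auto simp: r_def field_simps)
      then have j: "real j \<le> r" "r < real j + 1" "j < 5" unfolding j_def by linarith+
      have "real j - 1 / 2 \<le> \<theta> / (pi / 2)" "\<theta> / (pi / 2) \<le> real j + 1 / 2"
        using j by (auto simp: r_def)
      then have "real j * (pi / 2) - pi / 4 \<le> \<theta>" "\<theta> \<le> real j * (pi / 2) + pi / 4"
        by (simp_all add: field_simps)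
      then have "\<theta> - real j * (pi / 2) \<in> {-1..1}" using pi_less_4 by auto
      then have "h \<theta> * indicator {0..2 * pi} \<theta> = h \<theta> * indicator {-1..1} (\<theta> - real j * (pi / 2))"
        using True by simp
      also have "\<dots> \<le> (\<Sum>j<5::nat. h \<theta> * indicator {-1..1} (\<theta> - real j * (pi / 2)))"
        using j(3) by (intro member_le_sum) auto
      finally show ?thesis .
    qed simp
  qed
  also have "\<dots> = (\<Sum>j<5::nat. \<integral>\<^sup>+ \<theta>. h \<theta> * indicator {-1..1} (\<theta> - real j * (pi / 2)) \<partial>lborel)"
    by (rule nn_integral_sum) measurable
  also have "\<dots> = (\<Sum>j<5::nat. \<integral>\<^sup>+ \<phi>. h (real j * (pi / 2) + \<phi>) * indicator {-1..1} \<phi> \<partial>lborel)"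
  proof (rule sum.cong[OF refl])
    fix j :: nat
    show "(\<integral>\<^sup>+ \<theta>. h \<theta> * indicator {-1..1} (\<theta> - real j * (pi / 2)) \<partial>lborel)
      = (\<integral>\<^sup>+ \<phi>. h (real j * (pi / 2) + \<phi>) * indicator {-1..1} \<phi> \<partial>lborel)"
      using nn_integral_real_affine[of "\<lambda>\<theta>. h \<theta> * indicator {-1..1} (\<theta> - real j * (pi / 2))" 1 "real j * (pi / 2)"]
      by simp
  qed
  finally show ?thesis .
qed

context dilation_shifts
begin

lemma arc_bound:
  fixes w c c' :: real
  assumes X [measurable]: "X \<in> borel_measurable borel" and Y [measurable]: "Y \<in> borel_measurable borel"
    and w: "0 < w" "w < 1" and c: "0 < c" "c powr (- w) < 2" and c': "0 < c'"
    and s: "s = 1 \<or> s = -1" "s' = 1 \<or> s' = -1" and t: "t \<in> dyadic_part E k"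
  shows "(\<integral>\<^sup>+ \<phi>. ennreal_powr (X (x - t * (s * cos \<phi>))) w * ennreal_powr (Y (x - t * (s' * sin \<phi>))) (1 - w)
        * indicator {-1..1} \<phi> \<partial>lborel)
    \<le> ennreal (48 / (2 - c powr (- w))) *
       (ennreal_powr (weighted_max c U X x) w * ennreal_powr (weighted_max c' U Y x) (1 - w))"
proof -
  let ?f = "\<lambda>s' \<phi>. ennreal_powr (X (x - s * t * cos \<phi>)) w * ennreal_powr (Y (x - s' * t * sin \<phi>)) (1 - w)"
  let ?P = "ennreal_powr (weighted_max c U X x) w * ennreal_powr (weighted_max c' U Y x) (1 - w)"
  have "(\<integral>\<^sup>+ \<phi>. ennreal_powr (X (x - t * (s * cos \<phi>))) w * ennreal_powr (Y (x - t * (s' * sin \<phi>))) (1 - w)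
        * indicator {-1..1} \<phi> \<partial>lborel)
    = (\<integral>\<^sup>+ \<phi>. ?f s' \<phi> * indicator {-1..1} \<phi> \<partial>lborel)"
    by (simp add: ac_simps)
  also have "\<dots> \<le> (\<integral>\<^sup>+ \<phi>. ?f s' \<phi> * indicator {0<..1} \<phi> + ?f s' \<phi> * indicator {0<..1} (- \<phi>) \<partial>lborel)"
  proof (intro nn_integral_mono_AE)
    show "AE \<phi> in lborel. ?f s' \<phi> * indicator {-1..1} \<phi>
       \<le> ?f s' \<phi> * indicator {0<..1} \<phi> + ?f s' \<phi> * indicator {0<..1} (- \<phi>)"
      using AE_lborel_singleton[of 0] by eventually_elim (auto simp: indicator_def)
  qed
  also have "\<dots> = (\<integral>\<^sup>+ \<phi>. ?f s' \<phi> * indicator {0<..1} \<phi> \<partial>lborel)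
      + (\<integral>\<^sup>+ \<phi>. ?f s' \<phi> * indicator {0<..1} (- \<phi>) \<partial>lborel)"
    by (rule nn_integral_add) measurable
  also have "(\<integral>\<^sup>+ \<phi>. ?f s' \<phi> * indicator {0<..1} (- \<phi>) \<partial>lborel) = (\<integral>\<^sup>+ \<phi>. ?f (- s') \<phi> * indicator {0<..1} \<phi> \<partial>lborel)"
    using nn_integral_real_affine[of "\<lambda>\<phi>. ?f s' \<phi> * indicator {0<..1} (- \<phi>)" "-1" 0] by simp
  also have "(\<integral>\<^sup>+ \<phi>. ?f s' \<phi> * indicator {0<..1} \<phi> \<partial>lborel) + (\<integral>\<^sup>+ \<phi>. ?f (- s') \<phi> * indicator {0<..1} \<phi> \<partial>lborel)
    \<le> ennreal (24 / (2 - c powr (- w))) * ?P + ennreal (24 / (2 - c powr (- w))) * ?P"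
    using s(2) by (intro add_mono half_arc_bound[OF X Y w c c' s(1) _ t]) auto
  also have "\<dots> = ennreal (48 / (2 - c powr (- w))) * ?P"
    using c by (subst distrib_right[symmetric], subst ennreal_plus[symmetric]) auto
  finally show ?thesis .
qed

text \<open>
  The functions exchange roles between the poles \<open>(\<plusminus>1, 0)\<close> and \<open>(0, \<plusminus>1)\<close>. This is why both weights are
  restricted although each pole restricts only one of them.
\<close>

theorem circle_average_bound:
  fixes w c c' :: real
  assumes w: "0 < w" "w < 1" and c: "0 < c" "c powr (- w) < 2"
    and c': "0 < c'" "c' powr (- (1 - w)) < 2"
  shows "\<exists>C\<ge>0. \<forall>X \<in> borel_measurable borel. \<forall>Y \<in> borel_measurable borel. \<forall>k. \<forall>t \<in> dyadic_part E k. \<forall>x.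
     (\<integral>\<^sup>+ y. ennreal_powr (X (x - t * fst y)) w * ennreal_powr (Y (x - t * snd y)) (1 - w) \<partial>circle_measure)
     \<le> ennreal C * (ennreal_powr (weighted_max c U X x) w * ennreal_powr (weighted_max c' U Y x) (1 - w))"
proof -
  \<comment> \<open>each of the five arcs is bounded by one of these two constants\<close>
  define D where "D = max (48 / (2 - c powr (- w))) (48 / (2 - c' powr (- (1 - w))))"
  have D: "0 \<le> D" using c unfolding D_def by (simp add: le_max_iff_disj)
  show ?thesis
  proof (intro exI[of _ "1 / (2 * pi) * (5 * D)"] conjI ballI allI)
    show "0 \<le> 1 / (2 * pi) * (5 * D)" using D by simp
    fix X Y :: "real \<Rightarrow> ennreal" and k t x
    assume X [measurable]: "X \<in> borel_measurable borel" and Y [measurable]: "Y \<in> borel_measurable borel"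
      and t: "t \<in> dyadic_part E k"
    let ?P = "ennreal_powr (weighted_max c U X x) w * ennreal_powr (weighted_max c' U Y x) (1 - w)"
    let ?H = "\<lambda>y. ennreal_powr (X (x - t * fst y)) w * ennreal_powr (Y (x - t * snd y)) (1 - w)"
    let ?h = "\<lambda>j \<phi>. ?H (cos (real j * (pi / 2) + \<phi>), sin (real j * (pi / 2) + \<phi>))"
    have D1: "ennreal (48 / (2 - c powr (- w))) * ?P \<le> ennreal D * ?P"
      "ennreal (48 / (2 - c' powr (- (1 - w)))) * ?P \<le> ennreal D * ?P"
      unfolding D_def by (intro mult_right_mono ennreal_leI; simp)+
    have arc: "(\<integral>\<^sup>+ \<phi>. ?h j \<phi> * indicator {-1..1} \<phi> \<partial>lborel)
      \<le> ennreal D * ?P" if j: "j < 5" for j :: nat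
    proof -
      obtain \<sigma> :: real where \<sigma>: "\<sigma> = 1 \<or> \<sigma> = -1" and
        or: "(\<forall>\<phi>. cos (real j * (pi / 2) + \<phi>) = \<sigma> * cos \<phi> \<and> sin (real j * (pi / 2) + \<phi>) = \<sigma> * sin \<phi>) \<or>
         (\<forall>\<phi>. cos (real j * (pi / 2) + \<phi>) = - \<sigma> * sin \<phi> \<and> sin (real j * (pi / 2) + \<phi>) = \<sigma> * cos \<phi>)"
        using quarter_turn[OF j] by blast
      from or show ?thesis
      proof
        assume *: "\<forall>\<phi>. cos (real j * (pi / 2) + \<phi>) = \<sigma> * cos \<phi> \<and> sin (real j * (pi / 2) + \<phi>) = \<sigma> * sin \<phi>"
        have "(\<integral>\<^sup>+ \<phi>. ?h j \<phi> * indicator {-1..1} \<phi> \<partial>lborel)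
          = (\<integral>\<^sup>+ \<phi>. ennreal_powr (X (x - t * (\<sigma> * cos \<phi>))) w * ennreal_powr (Y (x - t * (\<sigma> * sin \<phi>))) (1 - w)
              * indicator {-1..1} \<phi> \<partial>lborel)"
          using * by simp
        also have "\<dots> \<le> ennreal (48 / (2 - c powr (- w))) * ?P"
          by (rule arc_bound[OF X Y w c c'(1) \<sigma> \<sigma> t])
        finally show ?thesis using D1(1) by (rule order_trans)
      next
        assume *: "\<forall>\<phi>. cos (real j * (pi / 2) + \<phi>) = - \<sigma> * sin \<phi> \<and> sin (real j * (pi / 2) + \<phi>) = \<sigma> * cos \<phi>"
        have \<sigma>': "- \<sigma> = 1 \<or> - \<sigma> = -1" using \<sigma> by auto
        have w': "0 < 1 - w" "1 - w < 1" using w by auto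
        have "(\<integral>\<^sup>+ \<phi>. ?h j \<phi> * indicator {-1..1} \<phi> \<partial>lborel)
          = (\<integral>\<^sup>+ \<phi>. ennreal_powr (Y (x - t * (\<sigma> * cos \<phi>))) (1 - w) * ennreal_powr (X (x - t * (- \<sigma> * sin \<phi>))) (1 - (1 - w))
              * indicator {-1..1} \<phi> \<partial>lborel)"
          using * by (simp add: ac_simps)
        also have "\<dots> \<le> ennreal (48 / (2 - c' powr (- (1 - w)))) *
            (ennreal_powr (weighted_max c' U Y x) (1 - w) * ennreal_powr (weighted_max c U X x) (1 - (1 - w)))"
          by (rule arc_bound[OF Y X w' c' c(1) \<sigma> \<sigma>' t])
        also have "\<dots> = ennreal (48 / (2 - c' powr (- (1 - w)))) * ?P" by (simp add: ac_simps)
        finally show ?thesis using D1(2) by (rule order_trans)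
      qed
    qed
    have "(\<integral>\<^sup>+ y. ?H y \<partial>circle_measure)
      = ennreal (1 / (2 * pi)) * (\<integral>\<^sup>+ \<theta>. ?H (cos \<theta>, sin \<theta>) * indicator {0..2 * pi} \<theta> \<partial>lborel)"
      by (rule nn_integral_circle_measure) measurable
    also have "\<dots> \<le> ennreal (1 / (2 * pi)) * (\<Sum>j<5::nat. \<integral>\<^sup>+ \<phi>.
        ?h j \<phi> * indicator {-1..1} \<phi> \<partial>lborel)"
      by (intro mult_left_mono nn_integral_circle_le_arcs) auto
    also have "\<dots> \<le> ennreal (1 / (2 * pi)) * (\<Sum>j<5::nat. ennreal D * ?P)"
      by (intro mult_left_mono sum_mono arc) auto
    also have "\<dots> = ennreal (1 / (2 * pi) * (5 * D)) * ?P"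
    proof -
      have "ennreal (5 * D) = 5 * ennreal D"
        using D by (subst ennreal_mult) auto
      then have "ennreal (1 / (2 * pi) * (5 * D)) = ennreal (1 / (2 * pi)) * (5 * ennreal D)"
        using D by (subst ennreal_mult) auto
      then show ?thesis by (simp add: mult.assoc)
    qed
    finally show "(\<integral>\<^sup>+ y. ?H y \<partial>circle_measure) \<le> ennreal (1 / (2 * pi) * (5 * D)) * ?P" .
  qed
qed

end

section \<open>Majorants of the bilinear averages\<close>

text \<open>
  In a complete measure space a change on a null set preserves measurability.
\<close>

lemma borel_measurable_completion_cong_AE:
  assumes f: "f \<in> borel_measurable (completion M)" and eq: "AE x in completion M. f x = g x"
  shows "g \<in> borel_measurable (completion M)"
proof (rule measurableI)
  fix A :: "'b set" assume A: "A \<in> sets borel"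
  have m: "f -` A \<inter> space (completion M) \<in> sets (completion M)"
    using f A by (rule measurable_sets)
  have ae: "AE x in completion M. x \<in> f -` A \<inter> space (completion M) \<longleftrightarrow> x \<in> g -` A \<inter> space (completion M)"
    using eq by eventually_elim auto
  show "g -` A \<inter> space (completion M) \<in> sets (completion M)"
    by (rule completion.in_sets_AE[OF ae m]) auto
qed auto

lemma measurable_circle_measure:
  "f \<in> borel_measurable borel \<Longrightarrow> f \<in> borel_measurable circle_measure"
  unfolding circle_measure_def by (rule measurable_completion) simp

lemma measurable_avg_integrand [measurable]:
  assumes [measurable]: "f1 \<in> borel_measurable borel" "f2 \<in> borel_measurable borel"
  shows "avg_integrand t f1 f2 x \<in> borel_measurable borel"
  unfolding avg_integrand_def by measurable

lemma bilinear_avg_abs_le: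
  assumes [measurable]: "f1 \<in> borel_measurable borel" "f2 \<in> borel_measurable borel"
  shows "bilinear_avg_abs t f1 f2 x
    \<le> (\<integral>\<^sup>+ y. ennreal (norm (f1 (x - t * fst y))) * ennreal (norm (f2 (x - t * snd y))) \<partial>circle_measure)"
proof -
  have m: "avg_integrand t f1 f2 x \<in> borel_measurable circle_measure"
    by (rule measurable_circle_measure) measurable
  have eq: "(\<integral>\<^sup>+ y. ennreal (norm (f1 (x - t * fst y))) * ennreal (norm (f2 (x - t * snd y))) \<partial>circle_measure)
    = (\<integral>\<^sup>+ y. ennreal (norm (avg_integrand t f1 f2 x y)) \<partial>circle_measure)"
    by (simp add: avg_integrand_def norm_mult ennreal_mult)
  show ?thesis
  proof (cases "integrable circle_measure (avg_integrand t f1 f2 x)")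
    case True
    have "ennreal (norm (bilinear_avg t f1 f2 x)) \<le> (\<integral>\<^sup>+ y. ennreal (norm (avg_integrand t f1 f2 x y)) \<partial>circle_measure)"
      unfolding bilinear_avg_def using True by (rule integral_norm_bound_ennreal)
    then show ?thesis using True by (simp add: bilinear_avg_abs_def eq)
  next
    case False
    then have "(\<integral>\<^sup>+ y. ennreal (norm (avg_integrand t f1 f2 x y)) \<partial>circle_measure) = \<infinity>"
      using m by (auto simp: integrable_iff_bounded not_less top_unique)
    then show ?thesis by (simp add: eq)
  qed
qed

text \<open>
  From here on the maximal function is seen only through a pointwise bound by a product of two operators.
  Their bounds by the essential supremum hold at \<^emph>\<open>every\<close> point, so that they annihilate
  functions that vanish almost everywhere.
\<close>

locale bilinear_majorant =
  fixes E :: "real set" and S1 S2 :: "(real \<Rightarrow> ennreal) \<Rightarrow> real \<Rightarrow> ennreal" and D :: real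
  assumes E_pos: "E \<subseteq> {0<..}"
    and measurable_S1 [measurable]: "F \<in> borel_measurable borel \<Longrightarrow> S1 F \<in> borel_measurable borel"
    and measurable_S2 [measurable]: "F \<in> borel_measurable borel \<Longrightarrow> S2 F \<in> borel_measurable borel"
    and S1_sup: "(AE x in lborel. F x \<le> M) \<Longrightarrow> S1 F x \<le> ennreal D * M"
    and S2_sup: "(AE x in lborel. F x \<le> M) \<Longrightarrow> S2 F x \<le> ennreal D * M"
    and majorant: "F \<in> borel_measurable borel \<Longrightarrow> G \<in> borel_measurable borel \<Longrightarrow> t \<in> E \<Longrightarrow>
      (\<integral>\<^sup>+ y. F (x - t * fst y) * G (x - t * snd y) \<partial>circle_measure) \<le> S1 F x * S2 G x"
begin

text \<open>
  The majorant of the indicator function of a null set vanishes identically. Hence the set of points of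
  the circle that a coordinate sends into a given null set of the line is itself null.
\<close>

lemma AE_circle_avoids_null_set:
  assumes t: "t \<in> E" and N: "AE x in lborel. P x"
  shows "AE y in circle_measure. P (x - t * fst y) \<and> P (x - t * snd y)"
proof -
  obtain Z where Z: "Z \<in> null_sets lborel" "{x. \<not> P x} \<subseteq> Z"
    using N unfolding eventually_ae_filter by auto
  have Zb [measurable]: "Z \<in> sets borel" using Z by auto
  have ae: "AE x in lborel. indicator Z x \<le> (0::ennreal)"
    using AE_not_in[OF Z(1)] by eventually_elim auto
  have null: "S1 (indicator Z) x = 0" "S2 (indicator Z) x = 0"
    using S1_sup[OF ae, of x] S2_sup[OF ae, of x] by simp_all
  have AE0: "AE y in circle_measure. f y = 0"
    if f: "f \<in> borel_measurable borel" and "(\<integral>\<^sup>+ y. f y \<partial>circle_measure) \<le> 0" for f :: "real \<times> real \<Rightarrow> ennreal"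
    using that measurable_circle_measure[OF f] by (simp add: nn_integral_0_iff_AE)
  have 1: "AE y in circle_measure. indicator Z (x - t * fst y) = (0::ennreal)"
    using majorant[of "indicator Z" "\<lambda>_. 1" t x] t null by (intro AE0) simp_all
  have 2: "AE y in circle_measure. indicator Z (x - t * snd y) = (0::ennreal)"
    using majorant[of "\<lambda>_. 1" "indicator Z" t x] t null by (intro AE0) simp_all
  show ?thesis using 1 2
    by eventually_elim (use Z(2) in \<open>auto simp: indicator_def split: if_splits\<close>)
qed

text \<open>
  Averages do not see a change of the functions on null sets, at any point \<open>x\<close>; Lebesgue
  measurable functions may therefore be replaced by Borel functions.
\<close>

lemma bilinear_avg_abs_cong_AE:
  assumes t: "t \<in> E"
    and g1 [measurable]: "g1 \<in> borel_measurable borel" and g2 [measurable]: "g2 \<in> borel_measurable borel"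
    and eq: "AE x in lborel. f1 x = g1 x" "AE x in lborel. f2 x = g2 x"
  shows "bilinear_avg_abs t f1 f2 x = bilinear_avg_abs t g1 g2 x"
proof -
  have "AE x in lborel. f1 x = g1 x \<and> f2 x = g2 x" using eq by eventually_elim simp
  from AE_circle_avoids_null_set[OF t this, of x]
  have ae: "AE y in circle_measure. avg_integrand t f1 f2 x y = avg_integrand t g1 g2 x y"
    by eventually_elim (simp add: avg_integrand_def)
  have mg: "avg_integrand t g1 g2 x \<in> borel_measurable circle_measure"
    by (rule measurable_circle_measure) measurable
  have mf: "avg_integrand t f1 f2 x \<in> borel_measurable circle_measure"
    using mg ae unfolding circle_measure_def
    by (rule borel_measurable_completion_cong_AE[OF _ eventually_mono]) auto
  have "bilinear_avg t f1 f2 x = bilinear_avg t g1 g2 x"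
    unfolding bilinear_avg_def by (rule integral_cong_AE[OF mf mg ae])
  moreover have "integrable circle_measure (avg_integrand t f1 f2 x) \<longleftrightarrow> integrable circle_measure (avg_integrand t g1 g2 x)"
    by (rule integrable_cong_AE[OF mf mg ae])
  ultimately show ?thesis by (simp add: bilinear_avg_abs_def)
qed

lemma bilinear_maximal_cong_AE:
  assumes "g1 \<in> borel_measurable borel" "g2 \<in> borel_measurable borel"
    and "AE x in lborel. f1 x = g1 x" "AE x in lborel. f2 x = g2 x"
  shows "bilinear_maximal E f1 f2 = bilinear_maximal E g1 g2"
  unfolding bilinear_maximal_def
  by (intro ext SUP_cong refl bilinear_avg_abs_cong_AE assms)

lemma bilinear_maximal_le:
  assumes "f1 \<in> borel_measurable borel" "f2 \<in> borel_measurable borel"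
  shows "bilinear_maximal E f1 f2 x \<le> S1 (\<lambda>x. ennreal (norm (f1 x))) x * S2 (\<lambda>x. ennreal (norm (f2 x))) x"
  unfolding bilinear_maximal_def
proof (rule SUP_least)
  fix t assume t: "t \<in> E"
  show "bilinear_avg_abs t f1 f2 x \<le> S1 (\<lambda>x. ennreal (norm (f1 x))) x * S2 (\<lambda>x. ennreal (norm (f2 x))) x"
    using bilinear_avg_abs_le[OF assms, of t x] 
      majorant[of "\<lambda>x. ennreal (norm (f1 x))" "\<lambda>x. ennreal (norm (f2 x))" t x] t assms
    by (auto intro: order_trans)
qed

end

section \<open>Lebesgue norms\<close>

lemma nn_integral_lebesgue_eq: "(\<integral>\<^sup>+ x. f x \<partial>lebesgue) = (\<integral>\<^sup>+ x. f x \<partial>lborel)"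
  by (rule nn_integral_completion)

lemma Lp_norm_finite:
  "0 < r \<Longrightarrow> Lp_norm (ennreal r) g = ennreal_powr (power_integral r g) (1 / r)"
  by (simp add: Lp_norm_def nn_integral_lebesgue_eq)

lemma Lp_norm_top: "Lp_norm top g = esssup lebesgue g"
  by (simp add: Lp_norm_def)

lemma borel_measurable_lebesgue: "f \<in> borel_measurable borel \<Longrightarrow> f \<in> borel_measurable lebesgue"
  by (rule measurable_completion) simp

lemma Lp_norm_mono:
  assumes "f \<in> borel_measurable lebesgue" "\<And>x. f x \<le> g x"
  shows "Lp_norm p f \<le> Lp_norm p g"
proof (cases "p = \<infinity>")
  case True
  then show ?thesis using assms by (simp add: Lp_norm_def esssup_mono)
next
  case False
  then show ?thesis using assms
    by (auto simp: Lp_norm_def intro!: ennreal_powr_mono nn_integral_mono)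
qed

lemma Lp_norm_cong_AE:
  assumes "f \<in> borel_measurable lebesgue" "g \<in> borel_measurable lebesgue" "AE x in lborel. f x = g x"
  shows "Lp_norm p f = Lp_norm p g"
proof -
  have ae: "AE x in lebesgue. f x = g x" using assms(3) by (rule AE_completion)
  have "(\<integral>\<^sup>+ x. ennreal_powr (f x) (enn2real p) \<partial>lebesgue) = (\<integral>\<^sup>+ x. ennreal_powr (g x) (enn2real p) \<partial>lebesgue)"
    using ae by (intro nn_integral_cong_AE) (auto elim: eventually_mono)
  moreover have "esssup lebesgue f = esssup lebesgue g"
    by (rule esssup_AE_cong[OF assms(1,2) ae])
  ultimately show ?thesis by (simp add: Lp_norm_def)
qed

lemma AE_le_Lp_norm_top: "AE x in lborel. f x \<le> Lp_norm top f"
  using esssup_AE[of f lebesgue] by (simp add: Lp_norm_top AE_completion_iff)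

lemma one_divide_ennreal: "0 < r \<Longrightarrow> 1 / ennreal r = ennreal (1 / r)"
  using divide_ennreal[of 1 r] by simp

lemma Holder_exponent_cases:
  assumes p: "0 < p1" "0 < p2" "0 < p" and eq: "1 / p1 + 1 / p2 = 1 / (p::ennreal)"
  obtains (top) "p1 = top" "p2 = top" "p = top"
    | (left) r where "p1 = ennreal r" "p2 = top" "p = ennreal r" "0 < r"
    | (right) r where "p1 = top" "p2 = ennreal r" "p = ennreal r" "0 < r"
    | (both) r1 r2 where "p1 = ennreal r1" "p2 = ennreal r2" "p = ennreal (r1 * r2 / (r1 + r2))" "0 < r1" "0 < r2"
proof -
  have fin: "\<exists>r>0. q = ennreal r" if "0 < q" "q \<noteq> top" for q :: ennreal
    using that by (cases q) (auto simp: ennreal_less_zero_iff)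
  have sol: "p = ennreal (1 / a)" if "1 / p = ennreal a" "0 < a" for a
  proof (cases "p = top")
    case True
    then show ?thesis using that by (simp add: ennreal_less_zero_iff less_le_not_le)
  next
    case False
    then obtain r where r: "0 < r" "p = ennreal r" using fin p by blast
    then have "1 / r = a" using that by (simp add: one_divide_ennreal)
    then show ?thesis using r(2) by auto
  qed
  consider "p1 = top" "p2 = top" | "p1 \<noteq> top" "p2 = top" | "p1 = top" "p2 \<noteq> top" | "p1 \<noteq> top" "p2 \<noteq> top"
    by blast
  then show thesis
  proof cases
    case 1
    then have "1 / p = 0" using eq by simp
    then have "p = top" using fin[OF p(3)] by (cases "p = top") (auto simp: one_divide_ennreal)
    then show thesis using 1 top by blast
  next
    case 2
    then obtain r where r: "0 < r" "p1 = ennreal r" using fin p by blast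
    then have "p = ennreal (1 / (1 / r))" using eq 2 by (intro sol) (auto simp: one_divide_ennreal)
    then show thesis using left r 2 by simp
  next
    case 3
    then obtain r where r: "0 < r" "p2 = ennreal r" using fin p by blast
    then have "p = ennreal (1 / (1 / r))" using eq 3 by (intro sol) (auto simp: one_divide_ennreal)
    then show thesis using right r 3 by simp
  next
    case 4
    then obtain r1 r2 where r: "0 < r1" "p1 = ennreal r1" "0 < r2" "p2 = ennreal r2" using fin p by blast
    have "1 / p = ennreal (1 / r1 + 1 / r2)"
      using eq r by (simp add: one_divide_ennreal ennreal_plus)
    then have "p = ennreal (1 / (1 / r1 + 1 / r2))" using r by (intro sol add_pos_pos) auto
    also have "1 / (1 / r1 + 1 / r2) = r1 * r2 / (r1 + r2)" using r by (simp add: field_simps)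
    finally show thesis using both r by blast
  qed
qed

lemma Lp_norm_mult_top:
  assumes [measurable]: "G \<in> borel_measurable borel" "H \<in> borel_measurable borel" and r: "0 < r"
  shows "Lp_norm (ennreal r) (\<lambda>x. G x * H x) \<le> Lp_norm (ennreal r) G * Lp_norm top H"
proof -
  have "(\<integral>\<^sup>+ x. ennreal_powr (G x * H x) r \<partial>lborel)
    \<le> (\<integral>\<^sup>+ x. ennreal_powr (Lp_norm top H) r * ennreal_powr (G x) r \<partial>lborel)"
  proof (intro nn_integral_mono_AE, use AE_le_Lp_norm_top[of H] in eventually_elim)
    fix x assume "H x \<le> Lp_norm top H"
    then show "ennreal_powr (G x * H x) r \<le> ennreal_powr (Lp_norm top H) r * ennreal_powr (G x) r"
      using r unfolding ennreal_powr_mult[symmetric]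
      by (intro ennreal_powr_mono) (auto simp: mult.commute intro: mult_left_mono)
  qed
  also have "\<dots> = ennreal_powr (Lp_norm top H) r * power_integral r G"
    by (rule nn_integral_cmult) measurable
  finally have "ennreal_powr (\<integral>\<^sup>+ x. ennreal_powr (G x * H x) r \<partial>lborel) (1 / r)
    \<le> ennreal_powr (ennreal_powr (Lp_norm top H) r * power_integral r G) (1 / r)"
    using r by (intro ennreal_powr_mono) auto
  then show ?thesis
    using r by (simp add: Lp_norm_finite ennreal_powr_mult ennreal_powr_powr mult.commute)
qed

lemma Lp_norm_Holder:
  assumes p: "0 < p1" "0 < p2" "0 < p" and eq: "1 / p1 + 1 / p2 = 1 / p"
    and [measurable]: "G \<in> borel_measurable borel" "H \<in> borel_measurable borel"
  shows "Lp_norm p (\<lambda>x. G x * H x) \<le> Lp_norm p1 G * Lp_norm p2 H"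
  using p eq
proof (cases rule: Holder_exponent_cases)
  case top
  have "AE x in lborel. G x * H x \<le> Lp_norm top G * Lp_norm top H"
    using AE_le_Lp_norm_top[of G] AE_le_Lp_norm_top[of H]
    by eventually_elim (rule mult_mono, auto)
  then show ?thesis
    unfolding top by (subst Lp_norm_top, intro esssup_I borel_measurable_lebesgue AE_completion) auto
next
  case (left r)
  then show ?thesis using Lp_norm_mult_top[of G H r] by simp
next
  case (right r)
  then show ?thesis using Lp_norm_mult_top[of H G r] by (simp add: mult.commute)
next
  case (both r1 r2)
  define r where "r = r1 * r2 / (r1 + r2)"
  define w where "w = r2 / (r1 + r2)"
  have r: "0 < r" using both by (simp add: r_def)
  have w: "0 < w" "w < 1" using both by (auto simp: w_def)
  have rw: "r1 * w = r" "r2 * (1 - w) = r" using both by (auto simp: r_def w_def field_simps)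
  have "(\<integral>\<^sup>+ x. ennreal_powr (G x * H x) r \<partial>lborel)
    = (\<integral>\<^sup>+ x. ennreal_powr (ennreal_powr (G x) r1) w * ennreal_powr (ennreal_powr (H x) r2) (1 - w) \<partial>lborel)"
    by (simp add: ennreal_powr_mult ennreal_powr_powr rw)
  also have "\<dots> \<le> ennreal_powr (power_integral r1 G) w *
     ennreal_powr (power_integral r2 H) (1 - w)"
    by (intro Holder_ennreal w) measurable
  finally have "ennreal_powr (\<integral>\<^sup>+ x. ennreal_powr (G x * H x) r \<partial>lborel) (1 / r)
    \<le> ennreal_powr (\<dots>) (1 / r)"
    using r by (intro ennreal_powr_mono) auto
  moreover have "w * (1 / r) = 1 / r1" using rw(1) r both by (simp add: field_simps)
  moreover have "(1 - w) * (1 / r) = 1 / r2" using rw(2) r both by (simp add: field_simps)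
  ultimately show ?thesis
    using both r by (simp add: Lp_norm_finite r_def[symmetric] ennreal_powr_mult ennreal_powr_powr)
qed

section \<open>Approximation by bounded continuous functions\<close>

lemma measurable_norm_ennreal: "f \<in> borel_measurable M \<Longrightarrow> (\<lambda>x. ennreal (norm (f x :: complex))) \<in> borel_measurable M"
  by measurable

abbreviation local_power_integral :: "real \<Rightarrow> real \<Rightarrow> (real \<Rightarrow> complex) \<Rightarrow> ennreal" where
  "local_power_integral P R f \<equiv> \<integral>\<^sup>+ x. ennreal_powr (ennreal (norm (f x))) P * indicator {-R..R} x \<partial>lborel"

lemma tendsto_ennreal_powr_zero:
  assumes "(\<lambda>n. ennreal_powr (u n) q) \<longlonglongrightarrow> 0" and q: "0 < q"
  shows "u \<longlonglongrightarrow> 0"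
proof (rule order_tendstoI)
  fix a :: ennreal assume "0 < a"
  then have "0 < ennreal_powr a q" by (simp add: zero_less_iff_neq_zero)
  then have "\<forall>\<^sub>F n in sequentially. ennreal_powr (u n) q < ennreal_powr a q"
    using assms(1) by (rule order_tendstoD(2)[rotated])
  then show "\<forall>\<^sub>F n in sequentially. u n < a"
  proof eventually_elim
    case (elim n)
    then show ?case using ennreal_powr_mono[of q a "u n"] q by (metis not_less order.strict_implies_order)
  qed
qed auto

lemma tendsto_ennreal_powr_zeroI:
  assumes u: "u \<longlonglongrightarrow> (0::ennreal)" and q: "0 < q"
  shows "(\<lambda>n. ennreal_powr (u n) q) \<longlonglongrightarrow> 0"
proof (rule tendsto_ennreal_powr_zero[of _ "1 / q"])
  show "(\<lambda>n. ennreal_powr (ennreal_powr (u n) q) (1 / q)) \<longlonglongrightarrow> 0"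
    using u q by (simp add: ennreal_powr_powr)
qed (use q in simp)

lemma tendsto_zero_if_suminf_ennreal_finite:
  fixes a :: "nat \<Rightarrow> ennreal"
  assumes "(\<Sum>n. a n) \<noteq> top"
  shows "a \<longlonglongrightarrow> 0"
proof -
  have "a n \<noteq> top" for n
    using term_le_suminf_ennreal[of a n] assms by (auto simp: top_unique)
  then have a: "a n = ennreal (enn2real (a n))" for n by (simp add: less_top)
  then have "summable (\<lambda>n. enn2real (a n))"
    using assms by (intro summable_suminf_not_top) auto
  then have "(\<lambda>n. ennreal (enn2real (a n))) \<longlonglongrightarrow> ennreal 0"
    by (intro tendsto_ennrealI summable_LIMSEQ_zero)
  then show ?thesis using a by simp
qed

lemma approx_by_truncation:
  fixes f :: "real \<Rightarrow> complex"
  assumes [measurable]: "f \<in> borel_measurable borel" and P: "0 < P"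
    and fin: "local_power_integral P R f < top" and e: "0 < e"
  shows "\<exists>g \<in> borel_measurable borel. \<exists>m::nat. (\<forall>x. norm (g x) \<le> real m) \<and>
    local_power_integral P R (\<lambda>x. f x - g x) < ennreal e"
proof -
  define g where "g m x = f x * indicator {x. norm (f x) \<le> real m} x" for m :: nat and x
  have [measurable]: "g m \<in> borel_measurable borel" for m unfolding g_def by measurable
  have "(\<lambda>m. \<integral>\<^sup>+ x. ennreal_powr (ennreal (norm (f x - g m x))) P * indicator {-R..R} x \<partial>lborel)
    \<longlonglongrightarrow> (\<integral>\<^sup>+ x. 0 \<partial>(lborel :: real measure))"
  proof (rule nn_integral_dominated_convergence[where
        w = "\<lambda>x. ennreal_powr (ennreal (norm (f x))) P * indicator {-R..R} x"])
    show "AE x in lborel. ennreal_powr (ennreal (norm (f x - g m x))) P * indicator {-R..R} x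
        \<le> ennreal_powr (ennreal (norm (f x))) P * indicator {-R..R} x" for m
      using P by (intro AE_I2 mult_right_mono ennreal_powr_mono ennreal_leI) (auto simp: g_def indicator_def)
    show "AE x in lborel. (\<lambda>m. ennreal_powr (ennreal (norm (f x - g m x))) P * indicator {-R..R} x) \<longlonglongrightarrow> 0"
    proof (rule AE_I2)
      fix x
      have "\<forall>\<^sub>F m in sequentially. norm (f x) \<le> real m"
        using filterlim_at_top filterlim_real_sequentially by blast
      then show "(\<lambda>m. ennreal_powr (ennreal (norm (f x - g m x))) P * indicator {-R..R} x) \<longlonglongrightarrow> 0"
        by (intro tendsto_eventually) (auto elim!: eventually_mono simp: g_def)
    qed
    show "local_power_integral P R f < \<infinity>" using fin by simp
  qed measurable
  then have "\<forall>\<^sub>F m in sequentially. local_power_integral P R (\<lambda>x. f x - g m x) < ennreal e"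
    using e by (intro order_tendstoD(2)[of _ 0]) auto
  then obtain m where "local_power_integral P R (\<lambda>x. f x - g m x) < ennreal e"
    by (auto simp: eventually_sequentially)
  moreover have "norm (g m x) \<le> real m" for x by (auto simp: g_def indicator_def)
  ultimately show ?thesis by (intro bexI[of _ "g m"] exI[of _ m]) auto
qed

text \<open>
  Almost everywhere, a measurable function is a limit of continuous ones. Composed with the projection
  onto the ball of radius \<open>B\<close>, these become bounded and dominated convergence applies.
\<close>

lemma approx_bounded_by_continuous:
  fixes f :: "real \<Rightarrow> complex"
  assumes [measurable]: "f \<in> borel_measurable borel" and bd: "\<And>x. norm (f x) \<le> B"
    and P: "0 < P" and e: "0 < e"
  shows "\<exists>g. continuous_on UNIV g \<and> (\<forall>x. norm (g x) \<le> B) \<and>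
    local_power_integral P R (\<lambda>x. f x - g x) < ennreal e"
proof -
  have "f measurable_on UNIV"
    by (rule lebesgue_measurable_imp_measurable_on) (auto intro: borel_measurable_lebesgue)
  then obtain N g where N: "negligible N" and g: "\<And>n. continuous_on UNIV (g n)"
    and lim: "\<And>x. x \<notin> N \<Longrightarrow> (\<lambda>n. g n x) \<longlonglongrightarrow> f x"
    unfolding measurable_on_def by auto
  have B: "0 \<le> B" using bd[of 0] norm_ge_zero order_trans by blast
  define clip where "clip = closest_point (cball (0::complex) B)"
  have ne: "convex (cball (0::complex) B)" "closed (cball (0::complex) B)" "cball (0::complex) B \<noteq> {}"
    using B by auto
  have clip_cont: "continuous_on UNIV clip"
    unfolding clip_def by (rule continuous_on_closest_point[OF ne])
  have clip_bd: "norm (clip z) \<le> B" for z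
    using closest_point_in_set[OF ne(2,3), of z] by (simp add: clip_def)
  have clip_id: "clip (f x) = f x" for x
    using bd by (simp add: clip_def closest_point_self)
  define h where "h n x = clip (g n x)" for n x
  have h: "continuous_on UNIV (h n)" for n
    unfolding h_def by (rule continuous_on_compose2[OF clip_cont g]) auto
  then have [measurable]: "h n \<in> borel_measurable borel" for n
    by (rule borel_measurable_continuous_onI)
  have limh: "(\<lambda>n. h n x) \<longlonglongrightarrow> f x" if "x \<notin> N" for x
  proof -
    have "isCont clip (f x)" using clip_cont by (simp add: continuous_on_eq_continuous_at)
    then have "(\<lambda>n. clip (g n x)) \<longlonglongrightarrow> clip (f x)"
      using lim[OF that] by (rule isCont_tendsto_compose)
    then show ?thesis by (simp add: h_def clip_id)
  qed
  have "N \<in> null_sets lebesgue" using N by (simp add: negligible_iff_null_sets)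
  then have aeN: "AE x in lborel. x \<notin> N"
    using AE_not_in[of N lebesgue] by (simp add: AE_completion_iff)
  have "(\<lambda>n. \<integral>\<^sup>+ x. ennreal_powr (ennreal (norm (f x - h n x))) P * indicator {-R..R} x \<partial>lborel)
    \<longlonglongrightarrow> (\<integral>\<^sup>+ x. 0 \<partial>(lborel :: real measure))"
  proof (rule nn_integral_dominated_convergence[where
        w = "\<lambda>x. ennreal_powr (ennreal (2 * B)) P * indicator {-R..R} x"])
    show "AE x in lborel. ennreal_powr (ennreal (norm (f x - h n x))) P * indicator {-R..R} x
        \<le> ennreal_powr (ennreal (2 * B)) P * indicator {-R..R} x" for n
    proof (intro AE_I2 mult_right_mono ennreal_powr_mono ennreal_leI)
      fix x
      have "norm (f x - h n x) \<le> norm (f x) + norm (h n x)" by (rule norm_triangle_ineq4)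
      also have "\<dots> \<le> B + B" by (intro add_mono bd) (simp add: h_def clip_bd)
      finally show "norm (f x - h n x) \<le> 2 * B" by simp
    qed (use P in auto)
    show "AE x in lborel. (\<lambda>n. ennreal_powr (ennreal (norm (f x - h n x))) P * indicator {-R..R} x) \<longlonglongrightarrow> 0"
      using aeN
    proof eventually_elim
      case (elim x)
      have "(\<lambda>n. norm (f x - h n x)) \<longlonglongrightarrow> norm (f x - f x)"
        by (intro tendsto_intros limh elim)
      then have "(\<lambda>n. ennreal (norm (f x - h n x))) \<longlonglongrightarrow> ennreal 0"
        by (intro tendsto_ennrealI) simp
      then have "(\<lambda>n. ennreal_powr (ennreal (norm (f x - h n x))) P) \<longlonglongrightarrow> 0"
        using P by (intro tendsto_ennreal_powr_zeroI) simp_all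
      then show ?case by (cases "x \<in> {-R..R}") simp_all
    qed
    have "emeasure lborel {-R..R} < top" by (cases "-R \<le> R") auto
    then show "(\<integral>\<^sup>+ x. ennreal_powr (ennreal (2 * B)) P * indicator {-R..R} x \<partial>lborel) < \<infinity>"
      by (subst nn_integral_cmult_indicator) (auto simp: ennreal_mult_less_top)
  qed measurable
  then have "\<forall>\<^sub>F n in sequentially. local_power_integral P R (\<lambda>x. f x - h n x) < ennreal e"
    using e by (intro order_tendstoD(2)[of _ 0]) auto
  then obtain n where "local_power_integral P R (\<lambda>x. f x - h n x) < ennreal e"
    by (auto simp: eventually_sequentially)
  then show ?thesis using h[of n] by (intro exI[of _ "h n"]) (auto simp: h_def clip_bd)
qed

lemma approx_by_continuous:
  fixes f :: "real \<Rightarrow> complex"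
  assumes [measurable]: "f \<in> borel_measurable borel" and P: "0 < P"
    and fin: "local_power_integral P R f < top" and e: "0 < e"
  shows "\<exists>g B. continuous_on UNIV g \<and> (\<forall>x. norm (g x) \<le> B) \<and>
    (\<integral>\<^sup>+ x. ennreal_powr (ennreal (norm (f x - g x)) * indicator {-R..R} x) P \<partial>lborel) \<le> ennreal e"
proof -
  define d where "d = e / (2 * 2 powr P)"
  have d: "0 < d" using e by (simp add: d_def)
  obtain h m where h [measurable]: "h \<in> borel_measurable borel" and hb: "\<And>x. norm (h x) \<le> real m"
    and fh: "local_power_integral P R (\<lambda>x. f x - h x) < ennreal d"
    using approx_by_truncation[OF assms(1) P fin d] by blast
  obtain g where g: "continuous_on UNIV g" "\<And>x. norm (g x) \<le> real m"
    and hg: "local_power_integral P R (\<lambda>x. h x - g x) < ennreal d"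
    using approx_bounded_by_continuous[OF h hb P d] by blast
  have [measurable]: "g \<in> borel_measurable borel" using g(1) by (rule borel_measurable_continuous_onI)
  let ?u = "\<lambda>x. ennreal_powr (ennreal (norm (f x - h x))) P * indicator {-R..R} x"
  let ?v = "\<lambda>x. ennreal_powr (ennreal (norm (h x - g x))) P * indicator {-R..R} x"
  have "(\<integral>\<^sup>+ x. ennreal_powr (ennreal (norm (f x - g x)) * indicator {-R..R} x) P \<partial>lborel)
    \<le> (\<integral>\<^sup>+ x. ennreal (2 powr P) * (?u x + ?v x) \<partial>lborel)"
  proof (intro nn_integral_mono)
    fix x
    have "ennreal (norm (f x - g x)) \<le> ennreal (norm (f x - h x) + norm (h x - g x))"
      using norm_triangle_ineq[of "f x - h x" "h x - g x"] by (intro ennreal_leI) simp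
    then have "ennreal_powr (ennreal (norm (f x - g x))) P
       \<le> ennreal_powr (ennreal (norm (f x - h x)) + ennreal (norm (h x - g x))) P"
      using P by (intro ennreal_powr_mono) (auto simp: ennreal_plus)
    also have "\<dots> \<le> ennreal (2 powr P) * (ennreal_powr (ennreal (norm (f x - h x))) P + ennreal_powr (ennreal (norm (h x - g x))) P)"
      using P by (intro ennreal_powr_add_le) simp
    finally show "ennreal_powr (ennreal (norm (f x - g x)) * indicator {-R..R} x) P \<le> ennreal (2 powr P) * (?u x + ?v x)"
      by (cases "x \<in> {-R..R}") auto
  qed
  also have "\<dots> = ennreal (2 powr P) * ((\<integral>\<^sup>+ x. ?u x \<partial>lborel) + (\<integral>\<^sup>+ x. ?v x \<partial>lborel))"
    by (simp add: nn_integral_cmult nn_integral_add)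
  also have "\<dots> \<le> ennreal (2 powr P) * (ennreal d + ennreal d)"
    using fh hg by (intro mult_left_mono add_mono) auto
  also have "\<dots> = ennreal e"
    using d by (simp flip: ennreal_plus ennreal_mult add: d_def)
  finally show ?thesis using g by blast
qed

definition local_abs :: "real \<Rightarrow> (real \<Rightarrow> complex) \<Rightarrow> real \<Rightarrow> ennreal" where
  "local_abs R f z = ennreal (norm (f z)) * indicator {-R..R} z"

lemma measurable_local_abs [measurable]:
  assumes "f \<in> borel_measurable borel"
  shows "local_abs R f \<in> borel_measurable borel"
  unfolding local_abs_def[abs_def]
  by (intro borel_measurable_times_ennreal borel_measurable_indicator measurable_norm_ennreal assms) simp

text \<open>
  Errors that are summable over \<open>n\<close> turn convergence in \<open>L\<^sup>P\<close> into convergence almost everywhere.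
\<close>

lemma approx_AE_majorant:
  fixes f :: "real \<Rightarrow> complex"
  assumes f [measurable]: "f \<in> borel_measurable borel" and P: "0 < P"
    and fin: "local_power_integral P R f < top"
    and mS: "\<And>F. F \<in> borel_measurable borel \<Longrightarrow> S F \<in> borel_measurable borel"
    and strong: "strong_type S P"
  shows "\<exists>g. (\<forall>n::nat. continuous_on UNIV (g n) \<and> bounded (range (g n))) \<and>
    (AE x in lborel. (\<lambda>n. S (local_abs R (\<lambda>z. f z - g n z)) x) \<longlonglongrightarrow> 0)"
proof -
  obtain C where S: "\<And>F. F \<in> borel_measurable borel \<Longrightarrow>
      power_integral P (S F) \<le> ennreal C * power_integral P F"
    using strong unfolding strong_type_def by blast
  have "\<exists>g. continuous_on UNIV g \<and> bounded (range g) \<and>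
    (\<integral>\<^sup>+ x. ennreal_powr (ennreal (norm (f x - g x)) * indicator {-R..R} x) P \<partial>lborel) \<le> ennreal ((1 / 2) ^ n)" for n :: nat
    using approx_by_continuous[OF f P fin, of "(1 / 2) ^ n"] by (auto simp: bounded_iff)
  then have "\<forall>n. \<exists>g. continuous_on UNIV g \<and> bounded (range g) \<and>
    (\<integral>\<^sup>+ x. ennreal_powr (ennreal (norm (f x - g x)) * indicator {-R..R} x) P \<partial>lborel) \<le> ennreal ((1 / 2) ^ n)"
    by blast
  from choice[OF this] obtain g where g: "\<And>n. continuous_on UNIV (g n)" "\<And>n. bounded (range (g n))"
    and small: "\<And>n. (\<integral>\<^sup>+ x. ennreal_powr (ennreal (norm (f x - g n x)) * indicator {-R..R} x) P \<partial>lborel) \<le> ennreal ((1 / 2) ^ n)"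
    by auto
  have [measurable]: "g n \<in> borel_measurable borel" for n using g(1) by (rule borel_measurable_continuous_onI)
  let ?F = "\<lambda>n x. ennreal (norm (f x - g n x)) * indicator {-R..R} x"
  have mF [measurable]: "?F n \<in> borel_measurable borel" for n by measurable
  have [measurable]: "S (?F n) \<in> borel_measurable borel" for n by (rule mS) measurable
  have "(\<integral>\<^sup>+ x. (\<Sum>n. ennreal_powr (S (?F n) x) P) \<partial>lborel) = (\<Sum>n. \<integral>\<^sup>+ x. ennreal_powr (S (?F n) x) P \<partial>lborel)"
    by (rule nn_integral_suminf) measurable
  also have "\<dots> \<le> (\<Sum>n. ennreal C * ennreal ((1 / 2) ^ n))"
    by (intro suminf_le order_trans[OF S[OF mF]] mult_left_mono small) auto
  also have "\<dots> = ennreal C * ennreal (\<Sum>n. (1 / 2) ^ n)"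
    by (subst ennreal_suminf_cmult) (auto intro!: arg_cong2[where f = "(*)"] suminf_ennreal2 summable_geometric)
  also have "\<dots> < top" by (simp add: ennreal_mult_less_top)
  finally have "AE x in lborel. (\<Sum>n. ennreal_powr (S (?F n) x) P) \<noteq> \<infinity>"
    by (intro nn_integral_noteq_infinite) auto
  then have "AE x in lborel. (\<lambda>n. S (?F n) x) \<longlonglongrightarrow> 0"
  proof eventually_elim
    case (elim x)
    then show ?case
      using P tendsto_ennreal_powr_zero[OF tendsto_zero_if_suminf_ennreal_finite, of "\<lambda>n. S (?F n) x" P] by auto
  qed
  then show ?thesis using g unfolding local_abs_def[abs_def] by blast
qed

section \<open>Measurability of the maximal function\<close>

lemma strong_type_AE_finite:
  assumes "strong_type S q" and "F \<in> borel_measurable borel" and "S F \<in> borel_measurable borel"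
    and "power_integral q F < top"
  shows "AE x in lborel. S F x \<noteq> top"
proof -
  obtain C where "power_integral q (S F) \<le> ennreal C * power_integral q F"
    using assms unfolding strong_type_def by blast
  also have "\<dots> < top" using assms(4) by (simp add: ennreal_mult_less_top)
  finally have "AE x in lborel. ennreal_powr (S F x) q \<noteq> \<infinity>"
    using assms(3) by (intro nn_integral_noteq_infinite) auto
  then show ?thesis by simp
qed

text \<open>
  A supremum of continuous functions is lower semicontinuous, whatever the cardinality of the index set.
\<close>

lemma borel_measurable_SUP_continuous:
  fixes \<phi> :: "'a \<Rightarrow> real \<Rightarrow> real"
  assumes "\<And>t. t \<in> T \<Longrightarrow> continuous_on UNIV (\<phi> t)"
  shows "(\<lambda>x. SUP t\<in>T. ennreal (\<phi> t x)) \<in> borel_measurable borel"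
proof (rule borel_measurableI_greater)
  fix y :: ennreal
  have "{x \<in> space borel. y < (SUP t\<in>T. ennreal (\<phi> t x))} = (\<Union>t\<in>T. {x. y < ennreal (\<phi> t x)})"
    by (auto simp: less_SUP_iff)
  moreover have "open {x. y < ennreal (\<phi> t x)}" if "t \<in> T" for t
    by (intro open_Collect_less continuous_on_const continuous_on_ennreal assms that)
  ultimately show "{x \<in> space borel. y < (SUP t\<in>T. ennreal (\<phi> t x))} \<in> sets borel"
    by (auto intro!: borel_open open_UN)
qed

lemma emeasure_circle_measure: "emeasure circle_measure (space circle_measure) = 1"
proof -
  have "(\<integral>\<^sup>+ y. 1 \<partial>circle_measure) = ennreal (1 / (2 * pi)) * (\<integral>\<^sup>+ \<theta>. 1 * indicator {0..2 * pi} \<theta> \<partial>lborel)"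
    by (rule nn_integral_circle_measure) simp
  also have "\<dots> = ennreal (1 / (2 * pi)) * ennreal (2 * pi)" by simp
  also have "\<dots> = 1" by (simp flip: ennreal_mult)
  finally show ?thesis by simp
qed

interpretation circle: finite_measure circle_measure
  by (rule finite_measureI) (simp add: emeasure_circle_measure)

lemma AE_circle_le_1: "AE y in circle_measure. \<bar>fst y\<bar> \<le> 1 \<and> \<bar>snd y\<bar> \<le> 1"
proof -
  let ?B = "{y :: real \<times> real. \<not> (\<bar>fst y\<bar> \<le> 1 \<and> \<bar>snd y\<bar> \<le> 1)}"
  have B [measurable]: "?B \<in> sets borel" by measurable
  have "(\<integral>\<^sup>+ y. indicator ?B y \<partial>circle_measure)
    = ennreal (1 / (2 * pi)) * (\<integral>\<^sup>+ \<theta>. indicator ?B (cos \<theta>, sin \<theta>) * indicator {0..2 * pi} \<theta> \<partial>lborel)"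
    by (rule nn_integral_circle_measure) measurable
  also have "\<dots> = 0" by (simp add: indicator_def)
  finally have "AE y in circle_measure. indicator ?B y = (0::ennreal)"
    by (subst (asm) nn_integral_0_iff_AE) (auto intro: measurable_circle_measure)
  then show ?thesis by eventually_elim (auto simp: indicator_def split: if_splits)
qed

lemma integrable_avg_integrand_bounded:
  assumes g: "continuous_on UNIV g" "bounded (range g)" and h: "continuous_on UNIV h" "bounded (range h)"
  shows "integrable circle_measure (avg_integrand t g h x)"
proof -
  obtain B C where B: "\<And>x. norm (g x) \<le> B" and C: "\<And>x. norm (h x) \<le> C"
    using g h unfolding bounded_iff by auto
  have [measurable]: "g \<in> borel_measurable borel" "h \<in> borel_measurable borel"
    using g h by (auto intro: borel_measurable_continuous_onI)
  have "0 \<le> B" using B[of 0] norm_ge_zero order_trans by blast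
  then show ?thesis
    using B C by (intro circle.integrable_const_bound[of _ "B * C"] measurable_circle_measure)
      (auto simp: avg_integrand_def norm_mult intro!: AE_I2 mult_mono)
qed

lemma continuous_bilinear_avg:
  assumes g: "continuous_on UNIV g" "bounded (range g)" and h: "continuous_on UNIV h" "bounded (range h)"
  shows "continuous_on UNIV (bilinear_avg t g h)"
proof -
  obtain B C where B: "\<And>x. norm (g x) \<le> B" and C: "\<And>x. norm (h x) \<le> C"
    using g h unfolding bounded_iff by auto
  have B0: "0 \<le> B" using B[of 0] norm_ge_zero order_trans by blast
  have [measurable]: "g \<in> borel_measurable borel" "h \<in> borel_measurable borel"
    using g h by (auto intro: borel_measurable_continuous_onI)
  show ?thesis
    unfolding continuous_on_sequentially
  proof (safe, unfold o_def bilinear_avg_def)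
    fix u :: "nat \<Rightarrow> real" and a :: real assume u: "u \<longlonglongrightarrow> a"
    have cont: "isCont g z" "isCont h z" for z
      using g h by (simp_all add: continuous_on_eq_continuous_at)
    show "(\<lambda>n. integral\<^sup>L circle_measure (avg_integrand t g h (u n))) \<longlonglongrightarrow> integral\<^sup>L circle_measure (avg_integrand t g h a)"
    proof (rule integral_dominated_convergence[where w = "\<lambda>_. B * C"])
      show "AE y in circle_measure. (\<lambda>n. avg_integrand t g h (u n) y) \<longlonglongrightarrow> avg_integrand t g h a y"
        unfolding avg_integrand_def
        by (intro AE_I2 tendsto_mult isCont_tendsto_compose[OF cont(1)] isCont_tendsto_compose[OF cont(2)]
              tendsto_diff u tendsto_const)
      show "AE y in circle_measure. norm (avg_integrand t g h (u n) y) \<le> B * C" for n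
        using B C B0 by (auto simp: avg_integrand_def norm_mult intro!: AE_I2 mult_mono)
    qed (auto intro: measurable_circle_measure)
  qed
qed

lemma bilinear_avg_abs_perturb:
  assumes [measurable]: "f1 \<in> borel_measurable borel" "f2 \<in> borel_measurable borel"
      "g1 \<in> borel_measurable borel" "g2 \<in> borel_measurable borel"
    and d: "(\<integral>\<^sup>+ y. ennreal (norm (avg_integrand t f1 f2 x y - avg_integrand t g1 g2 x y)) \<partial>circle_measure) \<le> \<delta>"
  shows "bilinear_avg_abs t f1 f2 x \<le> bilinear_avg_abs t g1 g2 x + \<delta>"
proof (cases "integrable circle_measure (avg_integrand t g1 g2 x) \<and> \<delta> < top")
  case False
  then show ?thesis by (auto simp: bilinear_avg_abs_def less_top[symmetric])
next
  case True
  let ?F = "avg_integrand t f1 f2 x" and ?G = "avg_integrand t g1 g2 x"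
  have [measurable]: "?F \<in> borel_measurable circle_measure" "?G \<in> borel_measurable circle_measure"
    by (rule measurable_circle_measure; measurable)+
  have FG: "integrable circle_measure (\<lambda>y. ?F y - ?G y)"
    using d True by (auto simp: integrable_iff_bounded intro: le_less_trans)
  have G: "integrable circle_measure ?G" using True by simp
  have F: "integrable circle_measure ?F"
    using Bochner_Integration.integrable_add[OF FG G] by simp
  have "norm (integral\<^sup>L circle_measure ?F)
     \<le> norm (integral\<^sup>L circle_measure ?G) + norm (integral\<^sup>L circle_measure ?F - integral\<^sup>L circle_measure ?G)"
    by (metis add.commute norm_triangle_sub)
  also have "integral\<^sup>L circle_measure ?F - integral\<^sup>L circle_measure ?G = (\<integral>y. ?F y - ?G y \<partial>circle_measure)"
    using F G by simp
  finally have "ennreal (norm (integral\<^sup>L circle_measure ?F))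
    \<le> ennreal (norm (integral\<^sup>L circle_measure ?G) + norm (\<integral>y. ?F y - ?G y \<partial>circle_measure))"
    by (rule ennreal_leI)
  also have "\<dots> = ennreal (norm (integral\<^sup>L circle_measure ?G)) + ennreal (norm (\<integral>y. ?F y - ?G y \<partial>circle_measure))"
    by (rule ennreal_plus) auto
  also have "ennreal (norm (\<integral>y. ?F y - ?G y \<partial>circle_measure)) \<le> \<delta>"
    using integral_norm_bound_ennreal[OF FG] d by (rule order_trans)
  finally show ?thesis
    using F G by (simp add: bilinear_avg_abs_def bilinear_avg_def add_left_mono)
qed

context bilinear_majorant
begin

definition approx_error ::
  "real \<Rightarrow> (real \<Rightarrow> complex) \<Rightarrow> (real \<Rightarrow> complex) \<Rightarrow> (real \<Rightarrow> complex) \<Rightarrow> (real \<Rightarrow> complex) \<Rightarrow> real \<Rightarrow> ennreal" where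
  "approx_error R f1 f2 g1 g2 x =
     S1 (local_abs R (\<lambda>z. f1 z - g1 z)) x * S2 (local_abs R f2) x
   + S1 (local_abs R f1) x * S2 (local_abs R (\<lambda>z. f2 z - g2 z)) x
   + S1 (local_abs R (\<lambda>z. f1 z - g1 z)) x * S2 (local_abs R (\<lambda>z. f2 z - g2 z)) x"

text \<open>
  The product is expanded as
  \<open>f\<^sub>1 f\<^sub>2 - g\<^sub>1 g\<^sub>2 = (f\<^sub>1 - g\<^sub>1) f\<^sub>2 + f\<^sub>1 (f\<^sub>2 - g\<^sub>2) - (f\<^sub>1 - g\<^sub>1) (f\<^sub>2 - g\<^sub>2)\<close>,
  so that only majorants of \<open>f\<^sub>j\<close> and of \<open>f\<^sub>j - g\<^sub>j\<close> occur, and none of \<open>g\<^sub>j\<close>. For \<open>\<bar>x\<bar> \<le> R\<close> and \<open>t \<le> R\<close> the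
  averages involve values on \<open>[-2R, 2R]\<close> only.
\<close>

lemma avg_integrand_diff_le:
  assumes t: "t \<in> E" "t \<le> R" and x: "\<bar>x\<bar> \<le> R"
    and [measurable]: "f1 \<in> borel_measurable borel" "f2 \<in> borel_measurable borel"
      "g1 \<in> borel_measurable borel" "g2 \<in> borel_measurable borel"
  shows "(\<integral>\<^sup>+ y. ennreal (norm (avg_integrand t f1 f2 x y - avg_integrand t g1 g2 x y)) \<partial>circle_measure)
    \<le> approx_error (2 * R) f1 f2 g1 g2 x"
proof -
  let ?a = "local_abs (2 * R) (\<lambda>z. f1 z - g1 z)" and ?A = "local_abs (2 * R) f1"
  let ?b = "local_abs (2 * R) (\<lambda>z. f2 z - g2 z)" and ?B = "local_abs (2 * R) f2"
  have t0: "0 < t" using t E_pos by auto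
  have ae: "AE y in circle_measure. ennreal (norm (avg_integrand t f1 f2 x y - avg_integrand t g1 g2 x y))
    \<le> ?a (x - t * fst y) * ?B (x - t * snd y) + ?A (x - t * fst y) * ?b (x - t * snd y)
       + ?a (x - t * fst y) * ?b (x - t * snd y)"
    using AE_circle_le_1
  proof eventually_elim
    case (elim y)
    define z1 z2 where "z1 = x - t * fst y" and "z2 = x - t * snd y"
    have le_t: "\<bar>t * r\<bar> \<le> t" if "\<bar>r\<bar> \<le> 1" for r
      using that t0 by (simp add: abs_mult)
    have "\<bar>t * fst y\<bar> \<le> R" "\<bar>t * snd y\<bar> \<le> R"
      using le_t[of "fst y"] le_t[of "snd y"] elim t by linarith+
    then have z: "z1 \<in> {-(2 * R)..2 * R}" "z2 \<in> {-(2 * R)..2 * R}"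
      using x unfolding z1_def z2_def by (auto simp: abs_le_iff)
    have "f1 z1 * f2 z2 - g1 z1 * g2 z2
       = ((f1 z1 - g1 z1) * f2 z2 + f1 z1 * (f2 z2 - g2 z2)) - (f1 z1 - g1 z1) * (f2 z2 - g2 z2)"
      by (simp add: algebra_simps)
    also have "norm \<dots> \<le> norm ((f1 z1 - g1 z1) * f2 z2 + f1 z1 * (f2 z2 - g2 z2)) + norm ((f1 z1 - g1 z1) * (f2 z2 - g2 z2))"
      by (rule norm_triangle_ineq4)
    also have "\<dots> \<le> norm ((f1 z1 - g1 z1) * f2 z2) + norm (f1 z1 * (f2 z2 - g2 z2)) + norm ((f1 z1 - g1 z1) * (f2 z2 - g2 z2))"
      by (intro add_right_mono norm_triangle_ineq)
    finally have "ennreal (norm (f1 z1 * f2 z2 - g1 z1 * g2 z2)) \<le> ennreal \<dots>"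
      by (rule ennreal_leI)
    then show ?case
      using z by (simp add: avg_integrand_def local_abs_def norm_mult ennreal_mult ennreal_plus
         flip: z1_def z2_def)
  qed
  have m: "(\<lambda>y. F (x - t * fst y) * G (x - t * snd y)) \<in> borel_measurable circle_measure"
    if [measurable]: "F \<in> borel_measurable borel" "G \<in> borel_measurable borel" for F G :: "real \<Rightarrow> ennreal"
    by (rule measurable_circle_measure) measurable
  have "(\<integral>\<^sup>+ y. ennreal (norm (avg_integrand t f1 f2 x y - avg_integrand t g1 g2 x y)) \<partial>circle_measure)
    \<le> (\<integral>\<^sup>+ y. ?a (x - t * fst y) * ?B (x - t * snd y) + ?A (x - t * fst y) * ?b (x - t * snd y)
       + ?a (x - t * fst y) * ?b (x - t * snd y) \<partial>circle_measure)"
    using ae by (rule nn_integral_mono_AE)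
  also have "\<dots> = (\<integral>\<^sup>+ y. ?a (x - t * fst y) * ?B (x - t * snd y) \<partial>circle_measure)
      + (\<integral>\<^sup>+ y. ?A (x - t * fst y) * ?b (x - t * snd y) \<partial>circle_measure)
      + (\<integral>\<^sup>+ y. ?a (x - t * fst y) * ?b (x - t * snd y) \<partial>circle_measure)"
  proof -
    have "(\<lambda>y. ?a (x - t * fst y) * ?B (x - t * snd y)) \<in> borel_measurable circle_measure"
      "(\<lambda>y. ?A (x - t * fst y) * ?b (x - t * snd y)) \<in> borel_measurable circle_measure"
      "(\<lambda>y. ?a (x - t * fst y) * ?b (x - t * snd y)) \<in> borel_measurable circle_measure"
      by (rule m; measurable)+
    then show ?thesis by (simp add: nn_integral_add)
  qed
  also have "\<dots> \<le> approx_error (2 * R) f1 f2 g1 g2 x"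
    unfolding approx_error_def using t by (intro add_mono majorant) measurable
  finally show ?thesis .
qed

text \<open>
  For almost every \<open>x\<close> the difference between the averages of \<open>f\<^sub>1, f\<^sub>2\<close> and those of their approximations is
  at most \<open>\<epsilon> n x\<close>, uniformly in \<open>t\<close>, and \<open>\<epsilon> n x\<close> tends to \<open>0\<close>. So the supremum for \<open>f\<^sub>1, f\<^sub>2\<close> equals the
  infimum over \<open>n\<close> of the supremum for the approximations plus \<open>\<epsilon> n\<close>.
\<close>

lemma local_maximal_measurable:
  assumes f1 [measurable]: "f1 \<in> borel_measurable borel" and f2 [measurable]: "f2 \<in> borel_measurable borel"
    and P: "0 < P1" "0 < P2"
    and S1: "strong_type S1 P1"
    and S2: "strong_type S2 P2"
    and fin1: "local_power_integral P1 (2*R) f1 < top"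
    and fin2: "local_power_integral P2 (2*R) f2 < top"
  shows "(\<lambda>x. (SUP t\<in>{t\<in>E. t \<le> R}. bilinear_avg_abs t f1 f2 x) * indicator {-R..R} x) \<in> borel_measurable lebesgue"
proof -
  let ?E = "{t\<in>E. t \<le> R}"
  obtain g1 where g1: "\<And>n::nat. continuous_on UNIV (g1 n)" "\<And>n. bounded (range (g1 n))"
    and lim1: "AE x in lborel. (\<lambda>n. S1 (local_abs (2*R) (\<lambda>z. f1 z - g1 n z)) x) \<longlonglongrightarrow> 0"
    using approx_AE_majorant[OF f1 P(1) fin1 measurable_S1 S1] by auto
  obtain g2 where g2: "\<And>n::nat. continuous_on UNIV (g2 n)" "\<And>n. bounded (range (g2 n))"
    and lim2: "AE x in lborel. (\<lambda>n. S2 (local_abs (2*R) (\<lambda>z. f2 z - g2 n z)) x) \<longlonglongrightarrow> 0"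
    using approx_AE_majorant[OF f2 P(2) fin2 measurable_S2 S2] by auto
  have [measurable]: "g1 n \<in> borel_measurable borel" "g2 n \<in> borel_measurable borel" for n
    using g1 g2 by (auto intro: borel_measurable_continuous_onI)
  have pw_local: "ennreal_powr (local_abs (2*R) f z) P = ennreal_powr (ennreal (norm (f z))) P * indicator {-(2*R)..2*R} z"
    for f z P by (cases "z \<in> {-(2*R)..2*R}") (auto simp: local_abs_def)
  have A1: "AE x in lborel. S1 (local_abs (2*R) f1) x \<noteq> top"
    using fin1 by (intro strong_type_AE_finite[OF S1]) (auto simp: pw_local)
  have A2: "AE x in lborel. S2 (local_abs (2*R) f2) x \<noteq> top"
    using fin2 by (intro strong_type_AE_finite[OF S2]) (auto simp: pw_local)
  define \<epsilon> where "\<epsilon> n x = approx_error (2 * R) f1 f2 (g1 n) (g2 n) x" for n x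
  have [measurable]: "\<epsilon> n \<in> borel_measurable borel" for n
    unfolding \<epsilon>_def approx_error_def by measurable
  have lim: "AE x in lborel. (\<lambda>n. \<epsilon> n x) \<longlonglongrightarrow> 0"
    using lim1 lim2 A1 A2
  proof eventually_elim
    case (elim x)
    have "(\<lambda>n. \<epsilon> n x) \<longlonglongrightarrow> 0 * S2 (local_abs (2*R) f2) x + S1 (local_abs (2*R) f1) x * 0 + 0 * 0"
      unfolding \<epsilon>_def approx_error_def
      by (intro tendsto_add tendsto_mult_ennreal tendsto_const elim) (use elim in auto)
    then show ?case by simp
  qed
  define a where "a x = (SUP t\<in>?E. bilinear_avg_abs t f1 f2 x)" for x
  define b where "b n x = (SUP t\<in>?E. ennreal (norm (bilinear_avg t (g1 n) (g2 n) x)))" for n x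
  have [measurable]: "b n \<in> borel_measurable borel" for n
    unfolding b_def by (intro borel_measurable_SUP_continuous continuous_on_norm continuous_bilinear_avg g1 g2)
  have avg_g: "bilinear_avg_abs t (g1 n) (g2 n) x = ennreal (norm (bilinear_avg t (g1 n) (g2 n) x))" for t n x
    using integrable_avg_integrand_bounded[OF g1 g2] by (simp add: bilinear_avg_abs_def)
  have ab: "a x \<le> b n x + \<epsilon> n x" if "\<bar>x\<bar> \<le> R" for n x
    unfolding a_def
  proof (rule SUP_least)
    fix t assume t: "t \<in> ?E"
    have "bilinear_avg_abs t f1 f2 x \<le> bilinear_avg_abs t (g1 n) (g2 n) x + \<epsilon> n x"
      unfolding \<epsilon>_def using t that by (intro bilinear_avg_abs_perturb avg_integrand_diff_le) auto
    also have "\<dots> \<le> b n x + \<epsilon> n x"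
      unfolding b_def avg_g using t by (intro add_right_mono SUP_upper)
    finally show "bilinear_avg_abs t f1 f2 x \<le> b n x + \<epsilon> n x" .
  qed
  have ba: "b n x \<le> a x + \<epsilon> n x" if "\<bar>x\<bar> \<le> R" for n x
    unfolding b_def
  proof (rule SUP_least)
    fix t assume t: "t \<in> ?E"
    have "(\<integral>\<^sup>+ y. ennreal (norm (avg_integrand t (g1 n) (g2 n) x y - avg_integrand t f1 f2 x y)) \<partial>circle_measure) \<le> \<epsilon> n x"
      unfolding \<epsilon>_def using t that by (subst norm_minus_commute, intro avg_integrand_diff_le) auto
    then have "bilinear_avg_abs t (g1 n) (g2 n) x \<le> bilinear_avg_abs t f1 f2 x + \<epsilon> n x"
      by (intro bilinear_avg_abs_perturb) auto
    also have "\<dots> \<le> a x + \<epsilon> n x"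
      unfolding a_def using t by (intro add_right_mono SUP_upper)
    finally show "ennreal (norm (bilinear_avg t (g1 n) (g2 n) x)) \<le> a x + \<epsilon> n x" by (simp add: avg_g)
  qed
  define L where "L x = (INF n. b n x + \<epsilon> n x) * indicator {-R..R} x" for x
  have "L \<in> borel_measurable borel" unfolding L_def by measurable
  then have "L \<in> borel_measurable lebesgue" by (rule borel_measurable_lebesgue)
  moreover have "AE x in lebesgue. L x = a x * indicator {-R..R} x"
    unfolding AE_completion_iff using lim
  proof eventually_elim
    case (elim x)
    show ?case
    proof (cases "x \<in> {-R..R}")
      case True
      then have x: "\<bar>x\<bar> \<le> R" by (auto simp: abs_le_iff)
      have "(INF n. b n x + \<epsilon> n x) \<le> a x"
      proof (rule ennreal_le_epsilon)
        fix e :: real assume e: "0 < e"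
        have "\<forall>\<^sub>F n in sequentially. \<epsilon> n x < ennreal (e / 2)"
          using elim e by (intro order_tendstoD(2)[of _ 0]) auto
        then obtain n where n: "\<epsilon> n x < ennreal (e / 2)" by (auto simp: eventually_sequentially)
        have "(INF n. b n x + \<epsilon> n x) \<le> b n x + \<epsilon> n x" by (rule INF_lower) simp
        also have "\<dots> \<le> (a x + ennreal (e / 2)) + ennreal (e / 2)"
          using ba[OF x, of n] n by (intro add_mono order_trans[OF ba[OF x, of n]]) auto
        also have "\<dots> = a x + ennreal e"
          using e by (simp add: add.assoc flip: ennreal_plus)
        finally show "(INF n. b n x + \<epsilon> n x) \<le> a x + ennreal e" .
      qed
      moreover have "a x \<le> (INF n. b n x + \<epsilon> n x)" by (intro INF_greatest ab x)
      ultimately show ?thesis by (simp add: L_def)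
    qed (simp add: L_def)
  qed
  ultimately show ?thesis
    unfolding a_def by (rule borel_measurable_completion_cong_AE)
qed

text \<open>
  Only local integrability of some finite powers is asked for; this covers essentially bounded
  functions, which are not limits of continuous functions in their own norm.
\<close>

theorem bilinear_maximal_measurable:
  assumes f1: "f1 \<in> borel_measurable borel" and f2: "f2 \<in> borel_measurable borel"
    and P: "0 < P1" "0 < P2"
    and S1: "strong_type S1 P1"
    and S2: "strong_type S2 P2"
    and fin1: "\<And>R. local_power_integral P1 R f1 < top"
    and fin2: "\<And>R. local_power_integral P2 R f2 < top"
  shows "bilinear_maximal E f1 f2 \<in> borel_measurable lebesgue"
proof -
  let ?a = "\<lambda>m x. (SUP t\<in>{t\<in>E. t \<le> real m}. bilinear_avg_abs t f1 f2 x) * indicator {-real m..real m} x"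
  have [measurable]: "?a m \<in> borel_measurable lebesgue" for m
    by (rule local_maximal_measurable[OF f1 f2 P S1 S2 fin1 fin2])
  have "bilinear_maximal E f1 f2 = (\<lambda>x. SUP m. ?a m x)"
  proof (intro ext antisym)
    fix x
    show "bilinear_maximal E f1 f2 x \<le> (SUP m. ?a m x)"
      unfolding bilinear_maximal_def
    proof (rule SUP_least)
      fix t assume t: "t \<in> E"
      obtain m where m: "max t \<bar>x\<bar> \<le> real m" using real_arch_simple by blast
      have "bilinear_avg_abs t f1 f2 x \<le> ?a m x"
        using t m by (simp add: abs_le_iff) (intro SUP_upper, auto)
      also have "\<dots> \<le> (SUP m. ?a m x)" by (rule SUP_upper) simp
      finally show "bilinear_avg_abs t f1 f2 x \<le> (SUP m. ?a m x)" .
    qed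
    show "(SUP m. ?a m x) \<le> bilinear_maximal E f1 f2 x"
      unfolding bilinear_maximal_def
      by (intro SUP_least) (auto simp: indicator_def intro!: SUP_subset_mono)
  qed
  then show ?thesis by simp
qed

end

section \<open>The majorant built from the shifted maximal functions\<close>

text \<open>
  An average of \<open>F\<^bsup>1/w\<^esup>\<close> followed by the \<open>w\<close>-th power, as Hoelder's inequality on an arc produces it.
\<close>

definition rooted_max ::
  "real \<Rightarrow> real \<Rightarrow> (nat \<Rightarrow> int \<Rightarrow> real set) \<Rightarrow> (real \<Rightarrow> ennreal) \<Rightarrow> real \<Rightarrow> ennreal" where
  "rooted_max w c U F x = ennreal_powr (weighted_max c U (\<lambda>x. ennreal_powr (F x) (1 / w)) x) w"

context dilation_shifts
begin

lemma borel_measurable_rooted_max [measurable]: "rooted_max w c U F \<in> borel_measurable borel"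
  unfolding rooted_max_def[abs_def] by measurable

lemma rooted_max_le_AE_bound:
  assumes c: "0 < c" "c \<le> 1" and w: "0 < w" and M: "AE x in lborel. F x \<le> M"
  shows "rooted_max w c U F x \<le> M"
proof -
  have "weighted_max c U (\<lambda>x. ennreal_powr (F x) (1 / w)) x \<le> ennreal_powr M (1 / w)"
    by (intro weighted_max_le_AE_bound c eventually_mono[OF M] ennreal_powr_mono) (use w in auto)
  then have "rooted_max w c U F x \<le> ennreal_powr (ennreal_powr M (1 / w)) w"
    unfolding rooted_max_def using w by (intro ennreal_powr_mono) auto
  then show ?thesis using w by (simp add: ennreal_powr_powr)
qed

lemma rooted_max_strong_type:
  assumes c: "0 < c" and w: "0 < w" and P: "1 < w * P"
    and N: "\<And>i. N i \<le> B * R ^ i" and R: "1 \<le> R" "c powr (w * P) * R < 1"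
  shows "strong_type (rooted_max w c U) P"
proof -
  obtain C where C: "0 \<le> C" and le: "\<And>F. F \<in> borel_measurable borel \<Longrightarrow>
    power_integral (w * P) (weighted_max c U F)
      \<le> ennreal C * power_integral (w * P) F"
    using weighted_max_strong_type[OF c P N R] unfolding strong_type_def by blast
  show ?thesis
    unfolding strong_type_def
  proof (intro exI[of _ C] conjI C ballI)
    fix F :: "real \<Rightarrow> ennreal" assume [measurable]: "F \<in> borel_measurable borel"
    show "power_integral P (rooted_max w c U F)
      \<le> ennreal C * power_integral P F"
      using le[of "\<lambda>x. ennreal_powr (F x) (1 / w)"] w
      by (simp add: rooted_max_def ennreal_powr_powr)
  qed
qed

lemma exists_dyadic_part:
  assumes "t \<in> E" "0 < t"
  shows "\<exists>k. t \<in> dyadic_part E k"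
proof -
  define m where "m = \<lfloor>log 2 t\<rfloor>"
  have "real_of_int m \<le> log 2 t" "log 2 t \<le> real_of_int m + 1"
    unfolding m_def by linarith+
  then have "2 powr real_of_int m \<le> t" "t \<le> 2 powr (real_of_int m + 1)"
    using assms by (auto simp: le_log_iff log_le_iff)
  moreover have "(2::real) powr real_of_int m = 2 powi m" "(2::real) powr (real_of_int m + 1) = 2 powi (m + 1)"
    using powr_real_of_int'[of 2 m] powr_real_of_int'[of 2 "m + 1"] by simp_all
  ultimately show ?thesis
    using assms by (intro exI[of _ "- m"]) (simp add: dyadic_part_def)
qed

end

text \<open>
  Dyadic pieces are always covered by \<open>4\<^sup>i + 1\<close> intervals, so any exponent above \<open>1\<close> is admissible too.
  Adding the reflected centres serves dilations on both sides of \<open>x\<close>.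
\<close>

lemma exists_dilation_shifts:
  assumes dim: "upper_minkowski_dim E = ereal \<beta>" and b: "min \<beta> 1 < b" "0 \<le> b"
  shows "\<exists>U B. dilation_shifts U (\<lambda>i. B * (4 powr b) ^ i) E"
proof -
  have "\<exists>B. \<forall>i k. \<exists>S. finite S \<and> real (card S) \<le> B * (4 powr b) ^ i \<and>
    covers_level E i k S"
  proof (cases "\<beta> < b")
    case True
    then show ?thesis using upper_minkowski_dim_cover[OF dim _ b(2)] by blast
  next
    case False
    then have b1: "1 < b" using b by simp
    show ?thesis
    proof (intro exI[of _ 2] allI)
      fix i k
      obtain S where S: "finite S" "card S \<le> nat \<lceil>1 / (1 / 4 ^ i :: real)\<rceil> + 1"
          "covers_level E i k S"
        using dyadic_part_finite_cover[of "1 / 4 ^ i" E k] by auto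
      have "(4::real) ^ i \<le> (4 powr b) ^ i"
        using b1 powr_mono[of 1 b 4] by (intro power_mono) auto
      moreover have "real (card S) \<le> 4 ^ i + 1"
        using of_nat_mono[OF S(2), where 'a = real] by (simp add: nat_power_eq)
      moreover have "(1::real) \<le> 4 ^ i" by simp
      ultimately have "real (card S) \<le> 2 * (4 powr b) ^ i" by linarith
      then show "\<exists>S. finite S \<and> real (card S) \<le> 2 * (4 powr b) ^ i \<and>
        covers_level E i k S" using S by blast
    qed
  qed
  then obtain B where "\<forall>i k. \<exists>S. finite S \<and> real (card S) \<le> B * (4 powr b) ^ i \<and>
    covers_level E i k S" by blast
  then obtain S where "\<forall>i k. finite (S i k) \<and> real (card (S i k)) \<le> B * (4 powr b) ^ i \<and>
    covers_level E i k (S i k)"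
    unfolding choice_iff by blast
  then have S: "\<And>i k. finite (S i k)" "\<And>i k. real (card (S i k)) \<le> B * (4 powr b) ^ i"
    "\<And>i k. covers_level E i k (S i k)"
    by blast+
  define U where "U i k = insert 0 (S i (k - 2 * int i) \<union> uminus ` S i (k - 2 * int i))" for i :: nat and k
  have "dilation_shifts U (\<lambda>i. (2 * B + 1) * (4 powr b) ^ i) E"
  proof
    fix i :: nat and k :: int
    show "finite (U i k)" using S(1) by (simp add: U_def)
    show "0 \<in> U i k" by (simp add: U_def)
    let ?S = "S i (k - 2 * int i)"
    have "card (U i k) \<le> 1 + (card ?S + card (uminus ` ?S))"
      unfolding U_def by (rule order_trans[OF card_insert_le_m1]) (use card_Un_le S(1) in auto)
    also have "card (uminus ` ?S) \<le> card ?S" using S(1) by (rule card_image_le)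
    finally have "real (card (U i k)) \<le> 1 + 2 * real (card ?S)" by linarith
    also have "\<dots> \<le> (4 powr b) ^ i + 2 * (B * (4 powr b) ^ i)"
      using S(2)[of i "k - 2 * int i"] b by (intro add_mono mult_left_mono one_le_power) (auto simp: ge_one_powr_ge_zero)
    finally show "real (card (U i k)) \<le> (2 * B + 1) * (4 powr b) ^ i" by (simp add: algebra_simps)
  next
    fix t s :: real and k :: int and i :: nat
    assume t: "t \<in> dyadic_part E k" and s: "s = 1 \<or> s = -1"
    obtain a where a: "a \<in> S i k" "a \<le> t" "t \<le> a + 2 powi (- k) * (1 / 4 ^ i)"
      using S(3)[where k = k and i = i] t by fastforce
    have "(2::real) powi (2 * int i) = 2 powi int (2 * i)" by simp
    also have "\<dots> = 2 ^ (2 * i)" by (rule power_int_of_nat)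
    also have "\<dots> = 4 ^ i" by (simp add: power_mult)
    finally have "(2::real) powi (2 * int i) = 4 ^ i" .
    moreover have "(2::real) powi (- (k + 2 * int i)) = 2 powi (- k) / 2 powi (2 * int i)"
      by (subst power_int_diff[symmetric]) simp_all
    ultimately have l: "(2::real) powi (- (k + 2 * int i)) = 2 powi (- k) * (1 / 4 ^ i)"
      by simp
    have "s * a \<in> U i (k + 2 * int i)" using s a(1) by (auto simp: U_def)
    moreover have "\<bar>s * t - s * a\<bar> \<le> 2 powi (- (k + 2 * int i))"
      using s a unfolding l by auto
    ultimately show "\<exists>a\<in>U i (k + 2 * int i). \<bar>s * t - a\<bar> \<le> 2 powi (- (k + 2 * int i))" by blast
  qed
  then show ?thesis by blast
qed

text \<open>
  With \<open>c v = 2\<^bsup>-\<gamma>/v\<^esup>\<close> the weight of level \<open>i\<close> is \<open>2\<^bsup>-\<gamma>i\<^esup>\<close> after taking the \<open>v\<close>-th power. The arcs can afford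
  it because \<open>\<gamma> < 1\<close>, and on \<open>L\<^sup>P\<close> it beats the \<open>4\<^bsup>ib\<^esup>\<close> shifts when \<open>2 b < \<gamma> P\<close>.
\<close>

lemma exists_majorant:
  assumes E: "E \<subseteq> {0<..}" and dim: "upper_minkowski_dim E = ereal \<beta>"
    and b: "min \<beta> 1 < b" "0 \<le> b" and w: "0 < w" "w < 1" and \<gamma>: "0 < \<gamma>" "\<gamma> < 1"
  shows "\<exists>S1 S2 D. bilinear_majorant E S1 S2 D \<and>
    (\<forall>P. 1 < w * P \<longrightarrow> 2 * b < \<gamma> * P \<longrightarrow> strong_type S1 P) \<and>
    (\<forall>P. 1 < (1 - w) * P \<longrightarrow> 2 * b < \<gamma> * P \<longrightarrow> strong_type S2 P)"
proof -
  obtain U B where "dilation_shifts U (\<lambda>i. B * (4 powr b) ^ i) E"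
    using exists_dilation_shifts[OF dim b] by blast
  then interpret dilation_shifts U "\<lambda>i. B * (4 powr b) ^ i" E .
  define c where "c v = 2 powr (- \<gamma> / v)" for v :: real
  have c0: "0 < c v" for v by (simp add: c_def)
  have c1: "c v \<le> 1" if "0 < v" for v
    using that \<gamma> powr_mono[of "- \<gamma> / v" 0 2] by (simp add: c_def)
  have c2: "c v powr (- v) < 2" if "0 < v" for v
    using that \<gamma> powr_less_mono[of \<gamma> 1 2] by (simp add: c_def powr_powr)
  have cP: "c v powr (v * P) * 4 powr b < 1" if "0 < v" "2 * b < \<gamma> * P" for v P
  proof -
    have "(4::real) powr b = 2 powr (2 * b)" using powr_powr[of 2 2 b] by simp
    then have "c v powr (v * P) * 4 powr b = 2 powr (- (\<gamma> * P) + 2 * b)"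
      using that by (simp add: c_def powr_powr flip: powr_add)
    also have "\<dots> < 2 powr 0" using that by (intro powr_less_mono) auto
    finally show ?thesis by simp
  qed
  have w': "0 < 1 - w" using w by simp
  have strong: "strong_type (rooted_max v (c v) U) P"
    if "0 < v" "1 < v * P" "2 * b < \<gamma> * P" for v P
    using that b by (intro rooted_max_strong_type[OF c0 that(1,2) order_refl _ cP]) (auto simp: ge_one_powr_ge_zero)
  obtain C0 where C0: "0 \<le> C0" and
    avg: "\<And>X Y k t x. X \<in> borel_measurable borel \<Longrightarrow> Y \<in> borel_measurable borel \<Longrightarrow> t \<in> dyadic_part E k \<Longrightarrow>
     (\<integral>\<^sup>+ y. ennreal_powr (X (x - t * fst y)) w * ennreal_powr (Y (x - t * snd y)) (1 - w) \<partial>circle_measure)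
     \<le> ennreal C0 * (ennreal_powr (weighted_max (c w) U X x) w * ennreal_powr (weighted_max (c (1 - w)) U Y x) (1 - w))"
    using circle_average_bound[OF w c0 c2[OF w(1)] c0 c2[OF w']] by blast
  define S1 where "S1 F x = ennreal C0 * rooted_max w (c w) U F x" for F x
  define S2 where "S2 = rooted_max (1 - w) (c (1 - w)) U"
  have "bilinear_majorant E S1 S2 (max C0 1)"
  proof
    show "E \<subseteq> {0<..}" by fact
    show "S1 F \<in> borel_measurable borel" for F unfolding S1_def by measurable
    show "S2 F \<in> borel_measurable borel" for F unfolding S2_def by measurable
    fix F :: "real \<Rightarrow> ennreal" and M x assume M: "AE x in lborel. F x \<le> M"
    show "S1 F x \<le> ennreal (max C0 1) * M"
      unfolding S1_def by (intro mult_mono rooted_max_le_AE_bound c0 c1 w M ennreal_leI) auto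
    have "S2 F x \<le> 1 * M"
      unfolding S2_def using rooted_max_le_AE_bound[OF c0 c1[OF w'] w' M] by simp
    also have "\<dots> \<le> ennreal (max C0 1) * M"
      by (intro mult_right_mono) (auto simp flip: ennreal_1 intro!: ennreal_leI)
    finally show "S2 F x \<le> ennreal (max C0 1) * M" .
  next
    fix F G :: "real \<Rightarrow> ennreal" and t x
    assume [measurable]: "F \<in> borel_measurable borel" "G \<in> borel_measurable borel" and t: "t \<in> E"
    obtain k where k: "t \<in> dyadic_part E k" using exists_dyadic_part t E by auto
    show "(\<integral>\<^sup>+ y. F (x - t * fst y) * G (x - t * snd y) \<partial>circle_measure) \<le> S1 F x * S2 G x"
      using avg[OF _ _ k, of "\<lambda>x. ennreal_powr (F x) (1 / w)" "\<lambda>x. ennreal_powr (G x) (1 / (1 - w))" x] w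
      by (simp add: ennreal_powr_powr S1_def S2_def rooted_max_def mult.assoc)
  qed
  moreover have "strong_type S1 P"
    if P: "1 < w * P" "2 * b < \<gamma> * P" for P
  proof -
    obtain C where C: "0 \<le> C" "\<And>F. F \<in> borel_measurable borel \<Longrightarrow>
      power_integral P (rooted_max w (c w) U F) \<le> ennreal C * power_integral P F"
      using strong[OF w(1) P] unfolding strong_type_def by blast
    show ?thesis
      unfolding strong_type_def
    proof (intro exI[of _ "C0 powr P * C"] conjI ballI)
      show "0 \<le> C0 powr P * C" using C by simp
      fix F :: "real \<Rightarrow> ennreal" assume F: "F \<in> borel_measurable borel"
      have "power_integral P (S1 F)
        = ennreal (C0 powr P) * power_integral P (rooted_max w (c w) U F)"
        unfolding S1_def ennreal_powr_mult using C0 by (simp add: ennreal_powr_ennreal nn_integral_cmult)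
      also have "\<dots> \<le> ennreal (C0 powr P) * (ennreal C * power_integral P F)"
        by (intro mult_left_mono C(2) F) auto
      also have "\<dots> = ennreal (C0 powr P * C) * power_integral P F"
        using C by (simp add: ennreal_mult mult.assoc)
      finally show "power_integral P (S1 F) \<le> ennreal (C0 powr P * C) * power_integral P F" .
    qed
  qed
  ultimately show ?thesis
    using strong[OF w'] unfolding S2_def by blast
qed

section \<open>The exponents and the theorem\<close>

text \<open>
  The line through \<open>(h, 0)\<close> and \<open>(1/2, 1/2)\<close> is \<open>u + (2h - 1) v = h\<close>. Below it and below the diagonal the
  strict inequalities hold; on it, the point belongs to the segment.
\<close>

lemma below_chord_or_on_it:
  fixes h u v :: real
  assumes h: "0 < h" "h \<le> 1" and uv: "0 \<le> v" "v \<le> u"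
    and le: "u + (2 * h - 1) * v \<le> h" "v + (2 * h - 1) * u \<le> h"
  shows "(u + v < 1 \<and> u < max h (1 / 2)) \<or>
    (u, v) \<in> closed_segment (h, 0) (1 / 2, 1 / 2)"
proof (cases "2 * h < 1")
  case True
  show ?thesis
  proof (cases "u < 1 / 2")
    case False
    have "(1 - 2 * h) * u \<le> (1 - 2 * h) * v"
    proof -
      have "u \<le> h + (1 - 2 * h) * v" using le(1) by (simp add: algebra_simps)
      moreover have "(1 - 2 * h) * v \<le> (1 - 2 * h) * u" using True uv by (intro mult_left_mono) auto
      ultimately have "u \<le> h + (1 - 2 * h) * u" by linarith
      then have "2 * h * u \<le> 2 * h * (1 / 2)" by (simp add: algebra_simps)
      then have "u = 1 / 2" using h False by (subst (asm) mult_le_cancel_left_pos) auto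
      then have "(1 - 2 * h) * (1 / 2) \<le> (1 - 2 * h) * v" using le(1) by (simp add: algebra_simps)
      then show ?thesis by (simp only: \<open>u = 1 / 2\<close>)
    qed
    then have "u \<le> v" using True by (simp add: mult_le_cancel_left_pos)
    then have "u = v" using uv by simp
    then have "2 * h * u \<le> 2 * h * (1 / 2)" using le(1) by (simp add: algebra_simps)
    then have "u = 1 / 2" using h False by (subst (asm) mult_le_cancel_left_pos) auto
    then have "(u, v) = (1 / 2, 1 / 2)" using \<open>u = v\<close> by simp
    then show ?thesis by (metis ends_in_segment(2))
  qed (use uv in auto)
next
  case False
  have "(1 - h) * (u - v) \<ge> 0" using h uv by (intro mult_nonneg_nonneg) auto
  then have sum: "h * (u + v) \<le> u + (2 * h - 1) * v" by (simp add: algebra_simps)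
  have pos: "0 \<le> (2 * h - 1) * v" using False uv by simp
  show ?thesis
  proof (cases "u + (2 * h - 1) * v < h")
    case True
    then have "h * (u + v) < h * 1" using sum by simp
    then have "u + v < 1" using h by (simp add: mult_less_cancel_left_pos)
    then show ?thesis using True pos by auto
  next
    case on: False
    then have u: "u = h - (2 * h - 1) * v" using le by simp
    have "2 * h * v \<le> 2 * h * (1 / 2)" using uv(2) unfolding u by (simp add: algebra_simps)
    then have "v \<le> 1 / 2" using h by (subst (asm) mult_le_cancel_left_pos) auto
    then have "(u, v) = (1 - 2 * v) *\<^sub>R (h, 0) + (2 * v) *\<^sub>R (1 / 2, 1 / 2)" "0 \<le> 2 * v" "2 * v \<le> 1"
      using uv by (auto simp: u algebra_simps)
    then show ?thesis unfolding closed_segment_def by blast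
  qed
qed

lemma swap_closed_segment:
  assumes "(v, u) \<in> closed_segment (a, b) (c, d)"
  shows "(u, v) \<in> closed_segment (b, a) (d, c :: real)"
  using assms unfolding closed_segment_def by auto

text \<open>
  The quadrilateral is cut out by the two coordinate axes and by the lines that carry the two removed
  sides; the diagonal splits it into two mirror images.
\<close>

lemma region_inequalities:
  fixes h u v :: real
  assumes h: "0 < h" "h \<le> 1"
    and uv: "(u, v) \<in> convex hull {(0, 0), (h, 0), (1 / 2, 1 / 2), (0, h)}
      - (closed_segment (h, 0) (1 / 2, 1 / 2) \<union> closed_segment (1 / 2, 1 / 2) (0, h))"
  shows "0 \<le> u" "0 \<le> v" "u + v < 1" "u < max h (1 / 2)" "v < max h (1 / 2)"
proof -
  define K where "K = {z :: real \<times> real. inner (-1, 0) z \<le> 0} \<inter> {z. inner (0, -1) z \<le> 0}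
     \<inter> {z. inner (1, 2 * h - 1) z \<le> h} \<inter> {z. inner (2 * h - 1, 1) z \<le> h}"
  have "convex K" unfolding K_def by (intro convex_Int convex_halfspace_le)
  moreover have "{(0, 0), (h, 0), (1 / 2, 1 / 2), (0, h)} \<subseteq> K"
  proof -
    have "(2 * h - 1) * h \<le> 1 * h" using h by (intro mult_right_mono) auto
    then show ?thesis using h unfolding K_def by (auto simp: field_simps)
  qed
  ultimately have "convex hull {(0, 0), (h, 0), (1 / 2, 1 / 2), (0, h)} \<subseteq> K"
    by (intro hull_minimal)
  then have K: "0 \<le> u" "0 \<le> v" "u + (2 * h - 1) * v \<le> h" "v + (2 * h - 1) * u \<le> h"
    using uv by (auto simp: K_def)
  have seg: "(u, v) \<notin> closed_segment (h, 0) (1 / 2, 1 / 2)" "(v, u) \<notin> closed_segment (h, 0) (1 / 2, 1 / 2)"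
    using uv swap_closed_segment[of v u h 0 "1 / 2" "1 / 2"] by (auto simp: closed_segment_commute)
  show "0 \<le> u" "0 \<le> v" by fact+
  have "u + v < 1 \<and> u < max h (1 / 2) \<and> v < max h (1 / 2)"
  proof (cases "v \<le> u")
    case True
    then show ?thesis using below_chord_or_on_it[OF h K(2) True K(3,4)] seg by auto
  next
    case False
    then have "u \<le> v" by simp
    then show ?thesis using below_chord_or_on_it[OF h K(1) _ K(4,3)] seg by auto
  qed
  then show "u + v < 1" "u < max h (1 / 2)" "v < max h (1 / 2)" by auto
qed

lemma exists_borel_representative:
  fixes f :: "real \<Rightarrow> complex"
  assumes f: "f \<in> borel_measurable lebesgue"
  shows "\<exists>g \<in> borel_measurable borel. AE x in lborel. f x = g x"
proof -
  have "(\<lambda>x. Re (f x)) \<in> borel_measurable lebesgue" "(\<lambda>x. Im (f x)) \<in> borel_measurable lebesgue"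
    using f by measurable
  from this[THEN completion_ex_borel_measurable_real]
  obtain a b where ab: "a \<in> borel_measurable lborel" "b \<in> borel_measurable lborel"
    and eq: "AE x in lborel. Re (f x) = a x" "AE x in lborel. Im (f x) = b x"
    by blast
  have [measurable]: "a \<in> borel_measurable borel" "b \<in> borel_measurable borel" using ab by simp_all
  show ?thesis
  proof (intro bexI[of _ "\<lambda>x. Complex (a x) (b x)"])
    show "AE x in lborel. f x = Complex (a x) (b x)"
      using eq by eventually_elim (simp add: complex_eq_iff)
    have "(\<lambda>x. complex_of_real (a x) + \<i> * complex_of_real (b x)) \<in> borel_measurable borel"
      by measurable
    then show "(\<lambda>x. Complex (a x) (b x)) \<in> borel_measurable borel"
      by (simp add: Complex_eq)
  qed
qed

lemma Lp_norm_bound_of_strong_type: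
  assumes P: "0 < P" and C: "0 \<le> C"
    and "power_integral P G \<le> ennreal C * power_integral P F"
  shows "Lp_norm (ennreal P) G \<le> ennreal (C powr (1 / P)) * Lp_norm (ennreal P) F"
proof -
  have "ennreal_powr (power_integral P G) (1 / P)
    \<le> ennreal_powr (ennreal C * power_integral P F) (1 / P)"
    using P assms(3) by (intro ennreal_powr_mono) auto
  then show ?thesis using P C by (simp add: Lp_norm_finite ennreal_powr_mult ennreal_powr_ennreal)
qed

lemma locally_integrable_power:
  fixes g :: "real \<Rightarrow> complex"
  assumes fin: "Lp_norm p (\<lambda>x. ennreal (norm (g x))) < \<infinity>"
    and P: "0 < P" and p: "p = top \<or> p = ennreal P"
  shows "local_power_integral P R g < top"
  using p
proof
  assume top: "p = top"
  define M where "M = Lp_norm top (\<lambda>x. ennreal (norm (g x)))"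
  have "local_power_integral P R g
    \<le> (\<integral>\<^sup>+ x. ennreal_powr M P * indicator {-R..R} x \<partial>lborel)"
    using AE_le_Lp_norm_top[of "\<lambda>x. ennreal (norm (g x))"]
    by (intro nn_integral_mono_AE)
      (auto simp: M_def[symmetric] elim!: eventually_mono intro!: mult_right_mono ennreal_powr_mono less_imp_le[OF P])
  also have "\<dots> = ennreal_powr M P * emeasure lborel {-R..R}"
    by (rule nn_integral_cmult_indicator) simp
  also have "\<dots> < top"
    using fin by (cases "-R \<le> R") (auto simp: top M_def ennreal_mult_less_top)
  finally show ?thesis .
next
  assume p: "p = ennreal P"
  have "local_power_integral P R g
     \<le> (\<integral>\<^sup>+ x. ennreal_powr (ennreal (norm (g x))) P \<partial>lborel)"
    by (intro nn_integral_mono) (auto simp: indicator_def)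
  also have "\<dots> < top" using fin P by (simp add: p Lp_norm_finite)
  finally show ?thesis .
qed

text \<open>
  For \<open>p = \<infinity>\<close> the norm bound comes from the essential supremum, while the approximation argument needs some finite
  exponent \<open>P\<close> as well; any large one will do.
\<close>

lemma Lp_bound_and_local_exponent:
  fixes p :: ennreal and w \<gamma> b :: real
  assumes p: "0 < p" and w: "0 < w" and \<gamma>: "0 < \<gamma>" and b: "0 \<le> b"
    and u: "enn2real (1 / p) < w" "2 * b * enn2real (1 / p) < \<gamma>"
    and mS: "\<And>F. F \<in> borel_measurable borel \<Longrightarrow> S F \<in> borel_measurable borel"
    and sup: "\<And>F M x. (AE x in lborel. F x \<le> M) \<Longrightarrow> S F x \<le> ennreal D * M"
    and strong: "\<And>P. 1 < w * P \<Longrightarrow> 2 * b < \<gamma> * P \<Longrightarrow> strong_type S P"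
  shows "\<exists>P A. 0 < P \<and> (p = top \<or> p = ennreal P) \<and> strong_type S P \<and>
    0 \<le> A \<and> (\<forall>F \<in> borel_measurable borel. Lp_norm p (S F) \<le> ennreal A * Lp_norm p F)"
proof (cases "p = top")
  case True
  define P where "P = 1 / w + 2 * b / \<gamma> + 1"
  have P: "0 < P" "1 < w * P" "2 * b < \<gamma> * P"
    using w \<gamma> b by (auto simp: P_def add_pos_nonneg algebra_simps intro!: add_pos_pos add_pos_nonneg)
  have "Lp_norm p (S F) \<le> ennreal (max D 0) * Lp_norm p F" if F: "F \<in> borel_measurable borel" for F
  proof -
    have "S F x \<le> ennreal (max D 0) * Lp_norm top F" for x
      using sup[OF AE_le_Lp_norm_top[of F], of x]
      by (rule order_trans) (intro mult_right_mono ennreal_leI; simp)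
    then show ?thesis
      unfolding True by (subst Lp_norm_top) (intro esssup_I borel_measurable_lebesgue mS F AE_I2)
  qed
  then show ?thesis
    using P True strong[OF P(2,3)] by (intro exI[of _ P] exI[of _ "max D 0"]) auto
next
  case False
  then obtain P where P: "0 < P" "p = ennreal P" using p by (cases p) (auto simp: ennreal_less_zero_iff)
  then have inv: "enn2real (1 / p) = 1 / P" by (simp add: one_divide_ennreal)
  have "1 < w * P" "2 * b < \<gamma> * P" using u P unfolding inv by (simp_all add: field_simps)
  then have S: "strong_type S P" by (rule strong)
  then obtain C where C: "0 \<le> C" "\<And>F. F \<in> borel_measurable borel \<Longrightarrow>
      power_integral P (S F) \<le> ennreal C * power_integral P F"
    unfolding strong_type_def by blast
  then have "Lp_norm p (S F) \<le> ennreal (C powr (1 / P)) * Lp_norm p F" if "F \<in> borel_measurable borel" for F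
    unfolding P(2) using that by (intro Lp_norm_bound_of_strong_type P)
  then show ?thesis using P S by (intro exI[of _ P] exI[of _ "C powr (1 / P)"]) auto
qed

text \<open>
  The inequalities leave room for a \<open>w\<close> strictly between \<open>1/p\<^sub>1\<close> and \<open>1 - 1/p\<^sub>2\<close>, for a covering exponent
  \<open>b\<close> slightly above \<open>\<beta>\<close>, and for a \<open>\<gamma>\<close> between \<open>2 b max (1/p\<^sub>1) (1/p\<^sub>2)\<close> and \<open>1\<close>.
\<close>

theorem bilinear_maximal_bounded:
  fixes p1 p2 p :: ennreal
  defines "u \<equiv> enn2real (1 / p1)" and "v \<equiv> enn2real (1 / p2)"
  assumes p: "0 < p1" "0 < p2" "0 < p" and eq: "1 / p1 + 1 / p2 = 1 / p"
    and E: "E \<subseteq> {0<..}" and dim: "upper_minkowski_dim E = ereal \<beta>"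
    and uv: "u + v < 1" "min \<beta> 1 * u < 1 / 2" "min \<beta> 1 * v < 1 / 2"
  shows "\<exists>C::real. 0 \<le> C \<and> (\<forall>f1 f2. in_Lp p1 f1 \<longrightarrow> in_Lp p2 f2 \<longrightarrow>
      bilinear_maximal E f1 f2 \<in> borel_measurable lebesgue \<and>
      Lp_norm p (bilinear_maximal E f1 f2) \<le>
        ennreal C * Lp_norm p1 (\<lambda>x. ennreal (norm (f1 x))) * Lp_norm p2 (\<lambda>x. ennreal (norm (f2 x))))"
proof -
  have nn: "0 \<le> u" "0 \<le> v" by (simp_all add: u_def v_def)
  define m where "m = max u v"
  have m: "0 \<le> m" "m \<le> 1" "u \<le> m" "v \<le> m" using nn uv by (auto simp: m_def)
  define \<beta>' where "\<beta>' = max (min \<beta> 1) 0"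
  have \<beta>': "0 \<le> \<beta>'" "min \<beta> 1 \<le> \<beta>'" "2 * \<beta>' * m < 1"
    using uv nn by (auto simp: \<beta>'_def m_def max_def)
  define b where "b = \<beta>' + (1 - 2 * \<beta>' * m) / 4"
  have "0 < (1 - 2 * \<beta>' * m) / 4" using \<beta>' by simp
  then have b: "min \<beta> 1 < b" "0 \<le> b" unfolding b_def using \<beta>' by linarith+
  have bm: "2 * b * m < 1"
  proof -
    have "(1 - 2 * \<beta>' * m) / 2 * m \<le> (1 - 2 * \<beta>' * m) / 2 * 1"
      using \<beta>' m by (intro mult_left_mono) auto
    then show ?thesis using \<beta>' by (simp add: b_def algebra_simps)
  qed
  define \<gamma> where "\<gamma> = (2 * b * m + 1) / 2"
  have "0 \<le> 2 * b * m" using b m by simp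
  then have \<gamma>: "0 < \<gamma>" "\<gamma> < 1" "2 * b * m < \<gamma>" using bm by (auto simp: \<gamma>_def)
  have "2 * b * u \<le> 2 * b * m" "2 * b * v \<le> 2 * b * m" using b m by (simp_all add: mult_left_mono)
  then have bu: "2 * b * u < \<gamma>" "2 * b * v < \<gamma>" using \<gamma> by auto
  define w where "w = (u + 1 - v) / 2"
  have vw: "v < 1 - w" using uv(1) by (simp add: w_def field_simps)
  then have w: "0 < w" "w < 1" "u < w" "v < 1 - w" "0 < 1 - w"
    using uv(1) nn by (auto simp: w_def)
  obtain S1 S2 D where maj: "bilinear_majorant E S1 S2 D"
    and st1: "\<And>P. 1 < w * P \<Longrightarrow> 2 * b < \<gamma> * P \<Longrightarrow> strong_type S1 P"
    and st2: "\<And>P. 1 < (1 - w) * P \<Longrightarrow> 2 * b < \<gamma> * P \<Longrightarrow> strong_type S2 P"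
    using exists_majorant[OF E dim b w(1,2) \<gamma>(1,2)] by blast
  interpret bilinear_majorant E S1 S2 D by fact
  obtain P1 A1 where P1: "0 < P1" "p1 = top \<or> p1 = ennreal P1" "strong_type S1 P1" and A1: "0 \<le> A1"
    and L1: "\<And>F. F \<in> borel_measurable borel \<Longrightarrow> Lp_norm p1 (S1 F) \<le> ennreal A1 * Lp_norm p1 F"
    using Lp_bound_and_local_exponent[OF p(1) w(1) \<gamma>(1) b(2) w(3)[unfolded u_def] bu(1)[unfolded u_def]
      measurable_S1 S1_sup st1] by blast
  obtain P2 A2 where P2: "0 < P2" "p2 = top \<or> p2 = ennreal P2" "strong_type S2 P2" and A2: "0 \<le> A2"
    and L2: "\<And>F. F \<in> borel_measurable borel \<Longrightarrow> Lp_norm p2 (S2 F) \<le> ennreal A2 * Lp_norm p2 F"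
    using Lp_bound_and_local_exponent[OF p(2) w(5) \<gamma>(1) b(2) w(4)[unfolded v_def] bu(2)[unfolded v_def]
      measurable_S2 S2_sup st2] by blast
  show ?thesis
  proof (intro exI[of _ "A1 * A2"] conjI allI impI)
    show "0 \<le> A1 * A2" using A1 A2 by simp
    fix f1 f2 assume f: "in_Lp p1 f1" "in_Lp p2 f2"
    then have mf: "f1 \<in> borel_measurable lebesgue" "f2 \<in> borel_measurable lebesgue" by (auto simp: in_Lp_def)
    obtain g1 where g1 [measurable]: "g1 \<in> borel_measurable borel" and e1: "AE x in lborel. f1 x = g1 x"
      using exists_borel_representative[OF mf(1)] by blast
    obtain g2 where g2 [measurable]: "g2 \<in> borel_measurable borel" and e2: "AE x in lborel. f2 x = g2 x"
      using exists_borel_representative[OF mf(2)] by blast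
    let ?G1 = "\<lambda>x. ennreal (norm (g1 x))" and ?G2 = "\<lambda>x. ennreal (norm (g2 x))"
    have max_eq: "bilinear_maximal E f1 f2 = bilinear_maximal E g1 g2"
      by (rule bilinear_maximal_cong_AE[OF g1 g2 e1 e2])
    have n1: "Lp_norm p1 (\<lambda>x. ennreal (norm (f1 x))) = Lp_norm p1 ?G1"
      using e1 mf(1) borel_measurable_lebesgue[OF g1]
      by (intro Lp_norm_cong_AE measurable_norm_ennreal) (auto elim: eventually_mono)
    have n2: "Lp_norm p2 (\<lambda>x. ennreal (norm (f2 x))) = Lp_norm p2 ?G2"
      using e2 mf(2) borel_measurable_lebesgue[OF g2]
      by (intro Lp_norm_cong_AE measurable_norm_ennreal) (auto elim: eventually_mono)
    have fin: "Lp_norm p1 ?G1 < \<infinity>" "Lp_norm p2 ?G2 < \<infinity>"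
      using f by (auto simp: in_Lp_def n1 n2)
    have meas: "bilinear_maximal E g1 g2 \<in> borel_measurable lebesgue"
      by (rule bilinear_maximal_measurable[OF g1 g2 P1(1) P2(1) P1(3) P2(3)
           locally_integrable_power[OF fin(1) P1(1,2)] locally_integrable_power[OF fin(2) P2(1,2)]])
    then show "bilinear_maximal E f1 f2 \<in> borel_measurable lebesgue" by (simp add: max_eq)
    have "Lp_norm p (bilinear_maximal E g1 g2) \<le> Lp_norm p (\<lambda>x. S1 ?G1 x * S2 ?G2 x)"
      by (intro Lp_norm_mono meas bilinear_maximal_le g1 g2)
    also have "\<dots> \<le> Lp_norm p1 (S1 ?G1) * Lp_norm p2 (S2 ?G2)"
      by (rule Lp_norm_Holder[OF p eq]) measurable
    also have "\<dots> \<le> (ennreal A1 * Lp_norm p1 ?G1) * (ennreal A2 * Lp_norm p2 ?G2)"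
      by (intro mult_mono L1 L2) auto
    also have "\<dots> = ennreal (A1 * A2) * Lp_norm p1 ?G1 * Lp_norm p2 ?G2"
      using A1 A2 by (simp add: ennreal_mult ac_simps)
    finally show "Lp_norm p (bilinear_maximal E f1 f2) \<le>
        ennreal (A1 * A2) * Lp_norm p1 (\<lambda>x. ennreal (norm (f1 x))) * Lp_norm p2 (\<lambda>x. ennreal (norm (f2 x)))"
      by (simp add: max_eq n1 n2)
  qed
qed

theorem theorem2p2:
  fixes E :: "real set" and \<beta> :: real and p1 p2 p :: ennreal and D1 D2 D3 :: "real \<times> real"
  assumes "0 < p1" and "0 < p2" and "0 < p"
    and "1 / p1 + 1 / p2 = 1 / p"
    and "E \<subseteq> {0<..}"
    and "upper_minkowski_dim E = ereal \<beta>"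
    and "D1 = (if \<beta> < 1 / 2 then (1, 0) else (1 / (2 * \<beta>), 0))"
    and "D2 = (1 / 2, 1 / 2)"
    and "D3 = (if \<beta> < 1 / 2 then (0, 1) else (0, 1 / (2 * \<beta>)))"
    and "(enn2real (1 / p1), enn2real (1 / p2)) \<in>
           convex hull {(0, 0), D1, D2, D3} - (closed_segment D1 D2 \<union> closed_segment D2 D3)"
  shows "\<exists>C::real. 0 \<le> C \<and>
           (\<forall>f1 f2. in_Lp p1 f1 \<longrightarrow> in_Lp p2 f2 \<longrightarrow>
              bilinear_maximal E f1 f2 \<in> borel_measurable lebesgue \<and>
              Lp_norm p (bilinear_maximal E f1 f2) \<le>
                ennreal C * Lp_norm p1 (\<lambda>x. ennreal (norm (f1 x)))
                          * Lp_norm p2 (\<lambda>x. ennreal (norm (f2 x))))"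
proof (rule bilinear_maximal_bounded[OF assms(1-6)])
  define h where "h = (if \<beta> < 1 / 2 then 1 else 1 / (2 * \<beta>))"
  have h: "0 < h" "h \<le> 1" by (auto simp: h_def divide_le_eq)
  have D: "D1 = (h, 0)" "D3 = (0, h)" by (simp_all add: assms(7,9) h_def)
  note R = region_inequalities[OF h assms(10)[unfolded D assms(8)]]
  have *: "min \<beta> 1 * r < 1 / 2" if r: "0 \<le> r" "r < max h (1 / 2)" "r < 1" for r
  proof -
    consider "\<beta> \<le> 0" | "0 < \<beta>" "\<beta> < 1 / 2" | "1 / 2 \<le> \<beta>" "\<beta> \<le> 1" | "1 < \<beta>" by linarith
    then show ?thesis
    proof cases
      case 1
      then have "min \<beta> 1 * r \<le> 0" using r by (intro mult_nonpos_nonneg) auto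
      then show ?thesis by linarith
    next
      case 2
      then have "min \<beta> 1 * r \<le> \<beta> * 1" using r by (intro mult_mono) auto
      then show ?thesis using 2 by linarith
    next
      case 3
      then have "1 / 2 \<le> h" by (simp add: h_def field_simps)
      then have "r < 1 / (2 * \<beta>)" using r 3 by (simp add: h_def)
      then show ?thesis using 3 by (simp add: field_simps)
    next
      case 4
      then have "h < 1 / 2" by (simp add: h_def field_simps)
      then show ?thesis using r 4 by simp
    qed
  qed
  show "enn2real (1 / p1) + enn2real (1 / p2) < 1" by (rule R(3))
  show "min \<beta> 1 * enn2real (1 / p1) < 1 / 2" by (rule *) (use R in linarith)+
  show "min \<beta> 1 * enn2real (1 / p2) < 1 / 2" by (rule *) (use R in linarith)+
qed

end
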